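(* Let $\mathcal{G}$ be an ample groupoid. The functor $\mathsf{A}:\mathcal{G}\text{-Mod}\to C_c^\infty(\mathcal{G})\text{-Comod}$, $M\mapsto(M,T_M)$, and the functor $\mathsf{B}:C_c^\infty(\mathcal{G})\text{-Comod}\to\mathcal{G}\text{-Mod}$, $(M,T_M)\mapsto(M,\mu_M)$ (both identical on underlying spaces and on morphisms), defined in the context, are mutually inverse and hence implement an isomorphism of categories between the category $\mathcal{G}\text{-Mod}$ of $\mathcal{G}$-modules and the category $C_c^\infty(\mathcal{G})\text{-Comod}$ of $C_c^\infty(\mathcal{G})$-comodules.
   Context: An ample groupoid $\mathcal{G}$ is a locally compact Hausdorff étale topological groupoid (range map a local homeomorphism) with totally disconnected unit space $\mathcal{G}^{(0)}$; $s,r$ are source and range, $\mathcal{G}^x=r^{-1}(x)$, and $\mathcal{G}^{(2)}=\{(\alpha,\beta):s(\alpha)=r(\beta)\}$. For a totally disconnected locally compact Hausdorff space $X$, $C_c^\infty(X)$ is the algebra of locally constant compactly supported functions $X\to\mathbb{C}$ with pointwise product. $\mathcal{D}(\mathcal{G})$ is the vector space $C_c^\infty(\mathcal{G})$ with convolution $(f*g)(\alpha)=\sum_{\beta\in\mathcal{G}^{r(\alpha)}}f(\beta)g(\beta^{-1}\alpha)$; it contains $C_c^\infty(\mathcal{G}^{(0)})$ via extension by zero. A left module $M$ over an algebra $R$ is essential if $R\otimes_RM\to M$ is an isomorphism. A $\mathcal{G}$-module is an essential left $\mathcal{D}(\mathcal{G})$-module; $\mathcal{G}\text{-Mod}$ is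 the category of these with $\mathcal{D}(\mathcal{G})$-linear maps. For an essential $C_c^\infty(\mathcal{G}^{(0)})$-module $M$ and $p:X\to\mathcal{G}^{(0)}$ continuous, $C_c^\infty(X)\otimes^{p}M$ is the quotient of $C_c^\infty(X)\otimes M$ by the span of $f\,(h\circ p)\otimes m-f\otimes h\cdot m$, $h\in C_c^\infty(\mathcal{G}^{(0)})$. Let $d_0,d_1,d_2:\mathcal{G}^{(2)}\to\mathcal{G}$, $d_0(\alpha,\beta)=\beta$, $d_1(\alpha,\beta)=\alpha\beta$, $d_2(\alpha,\beta)=\alpha$, and $v_0=rd_1=rd_2$, $v_1=rd_0=sd_2$, $v_2=sd_0=sd_1$. Each $d_i$ makes $C_c^\infty(\mathcal{G}^{(2)})$ a $C_c^\infty(\mathcal{G})$-module by pointwise multiplication with $g\circ d_i$, and for a $C_c^\infty(\mathcal{G})$-linear map $T:C_c^\infty(\mathcal{G})\otimes^{r}M\to C_c^\infty(\mathcal{G})\otimes^{s}M$ one lets $d_i^*(T)=\mathrm{id}\otimes T$ on $C_c^\infty(\mathcal{G}^{(2)})\otimes_{C_c^\infty(\mathcal{G}),d_i}(-)$; using $C_c^\infty(\mathcal{G}^{(2)})\otimes_{C_c^\infty(\mathcal{G}),d_i}(C_c^\infty(\mathcal{G})\otimes^{p}M)\cong C_c^\infty(\mathcal{G}^{(2)})\otimes^{pd_i}M$ these are maps $d_0^*(T):C_c^\infty(\mathcal{G}^{(2)})\otimes^{v_1}M\to C_c^\infty(\mathcal{G}^{(2)})\otimes^{v_2}M$, $d_1^*(T):C_c^\infty(\mathcal{G}^{(2)})\otimes^{v_0}M\to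 C_c^\infty(\mathcal{G}^{(2)})\otimes^{v_2}M$, $d_2^*(T):C_c^\infty(\mathcal{G}^{(2)})\otimes^{v_0}M\to C_c^\infty(\mathcal{G}^{(2)})\otimes^{v_1}M$. A $C_c^\infty(\mathcal{G})$-comodule is an essential $C_c^\infty(\mathcal{G}^{(0)})$-module $M$ with a $C_c^\infty(\mathcal{G})$-linear isomorphism $T_M:C_c^\infty(\mathcal{G})\otimes^{r}M\to C_c^\infty(\mathcal{G})\otimes^{s}M$ such that $d_0^*(T_M)d_2^*(T_M)=d_1^*(T_M)$. A morphism is a $C_c^\infty(\mathcal{G}^{(0)})$-linear map $f:M\to N$ with $(\mathrm{id}\otimes f)T_M=T_N(\mathrm{id}\otimes f)$. Functor $\mathsf{A}$: let $T:C_c^\infty(\mathcal{G}\times_{r,r}\mathcal{G})\to C_c^\infty(\mathcal{G}\times_{s,r}\mathcal{G})$, $T(f)(\alpha,\beta)=f(\alpha,\alpha\beta)$ (fibre products; these spaces are identified with $C_c^\infty(\mathcal{G})\otimes_{C_c^\infty(\mathcal{G}^{(0)})}C_c^\infty(\mathcal{G})$ balanced via $r,r$ and $s,r$ respectively). $T$ is right $\mathcal{D}(\mathcal{G})$-linear in the second variable. For a $\mathcal{G}$-module $M$, with $C_c^\infty(\mathcal{G}^{(0)})$-action by restriction, $T_M$ is the map corresponding to $T\otimes\mathrm{id}_M$ under tensoring with $M$ over $\mathcal{D}(\mathcal{G})$ and $\mathcal{D}(\mathcal{G})\otimes_{\mathcal{D}(\mathcal{G})}M\cong M$. Functor $\mathsf{B}$: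 let $\lambda:C_c^\infty(\mathcal{G})\to C_c^\infty(\mathcal{G}^{(0)})$, $\lambda(f)(x)=\sum_{\alpha\in\mathcal{G}^x}f(\alpha)$. For a comodule $(M,T_M)$ the $\mathcal{D}(\mathcal{G})$-action is $\mu_M=(\lambda\otimes\mathrm{id})T_M^{-1}q_M:\mathcal{D}(\mathcal{G})\otimes M\to M$, where $q_M:C_c^\infty(\mathcal{G})\otimes M\to C_c^\infty(\mathcal{G})\otimes^{s}M$ is the quotient map and $C_c^\infty(\mathcal{G}^{(0)})\otimes_{C_c^\infty(\mathcal{G}^{(0)})}M\cong M$. *)

theory Defs
  imports "HOL-Analysis.Analysis" "HOL-Algebra.Algebraic_Closure_Type"
begin

section \<open>Complex vector spaces and their tensor products\<close>

text \<open>A complex vector space is a module, in the sense of HOL-Algebra, over the ring of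
  complex numbers.  The fields \<open>mult\<close> and \<open>one\<close> that the record type for modules inherits from
  rings play no role, except that \<open>mult\<close> is used for the product of an algebra.\<close>

abbreviation CC :: "complex ring" where
  "CC \<equiv> ring_of_type_algebra"

abbreviation vspace :: "(complex, 'v, 'z) module_scheme \<Rightarrow> bool" where
  "vspace V \<equiv> Module.module CC V"

text \<open>Linear maps are made extensional, so that they are determined by their values on the
  carrier and equality of morphisms is equality in HOL.\<close>

definition lin :: "(complex, 'v, 'z) module_scheme \<Rightarrow> (complex, 'w, 'y) module_scheme \<Rightarrow> ('v \<Rightarrow> 'w) set"
  where "lin V W = {f \<in> carrier V \<rightarrow>\<^sub>E carrier W.
     (\<forall>x\<in>carrier V. \<forall>y\<in>carrier V. f (x \<oplus>\<^bsub>V\<^esub> y) = f x \<oplus>\<^bsub>W\<^esub> f y) \<and>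
     (\<forall>c. \<forall>x\<in>carrier V. f (c \<odot>\<^bsub>V\<^esub> x) = c \<odot>\<^bsub>W\<^esub> f x)}"

definition the_lin :: "(complex, 'v, 'z) module_scheme \<Rightarrow> (complex, 'w, 'y) module_scheme \<Rightarrow>
     (('v \<Rightarrow> 'w) \<Rightarrow> bool) \<Rightarrow> 'v \<Rightarrow> 'w"
  where "the_lin V W P = (THE F. F \<in> lin V W \<and> P F)"

definition lspan :: "(complex, 'v, 'z) module_scheme \<Rightarrow> 'v set \<Rightarrow> 'v set"
  where "lspan V S = (\<lambda>H. submodule H CC V) hull S"

text \<open>The quotient of \<open>V\<close> by the linear span of \<open>S\<close>, and the quotient map.\<close>

definition quot :: "(complex, 'v, 'z) module_scheme \<Rightarrow> 'v set \<Rightarrow> (complex, 'v set) module"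
  where "quot V S = \<lparr>carrier = a_rcosets\<^bsub>V\<^esub> (lspan V S),
     mult = (\<lambda>_ _. undefined), one = undefined,
     zero = lspan V S, add = set_add V,
     smult = (\<lambda>c A. \<Union>a\<in>A. lspan V S +>\<^bsub>V\<^esub> (c \<odot>\<^bsub>V\<^esub> a))\<rparr>"

definition qmap :: "(complex, 'v, 'z) module_scheme \<Rightarrow> 'v set \<Rightarrow> 'v \<Rightarrow> 'v set"
  where "qmap V S v = lspan V S +>\<^bsub>V\<^esub> v"

definition free_vs :: "'a set \<Rightarrow> (complex, 'a \<Rightarrow> complex) module"
  where "free_vs A = \<lparr>carrier = {\<phi>. finite {a. \<phi> a \<noteq> 0} \<and> {a. \<phi> a \<noteq> 0} \<subseteq> A},
     mult = (\<lambda>_ _. undefined), one = undefined,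
     zero = (\<lambda>_. 0), add = (\<lambda>\<phi> \<psi> a. \<phi> a + \<psi> a), smult = (\<lambda>c \<phi> a. c * \<phi> a)\<rparr>"

definition free_gen :: "'a \<Rightarrow> 'a \<Rightarrow> complex"
  where "free_gen a = (\<lambda>b. if b = a then 1 else 0)"

type_synonym ('v, 'w) tens = "('v \<times> 'w \<Rightarrow> complex) set"

definition bilin_rels :: "(complex, 'v, 'z) module_scheme \<Rightarrow> (complex, 'w, 'y) module_scheme \<Rightarrow>
     ('v \<times> 'w \<Rightarrow> complex) set"
  where "bilin_rels V W = (let F = free_vs (carrier V \<times> carrier W); e = (\<lambda>v w. free_gen (v, w)) in
     {e (v \<oplus>\<^bsub>V\<^esub> v') w \<ominus>\<^bsub>F\<^esub> (e v w \<oplus>\<^bsub>F\<^esub> e v' w) | v v' w.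
        v \<in> carrier V \<and> v' \<in> carrier V \<and> w \<in> carrier W} \<union>
     {e v (w \<oplus>\<^bsub>W\<^esub> w') \<ominus>\<^bsub>F\<^esub> (e v w \<oplus>\<^bsub>F\<^esub> e v w') | v w w'.
        v \<in> carrier V \<and> w \<in> carrier W \<and> w' \<in> carrier W} \<union>
     {e (c \<odot>\<^bsub>V\<^esub> v) w \<ominus>\<^bsub>F\<^esub> (c \<odot>\<^bsub>F\<^esub> e v w) | c v w. v \<in> carrier V \<and> w \<in> carrier W} \<union>
     {e v (c \<odot>\<^bsub>W\<^esub> w) \<ominus>\<^bsub>F\<^esub> (c \<odot>\<^bsub>F\<^esub> e v w) | c v w. v \<in> carrier V \<and> w \<in> carrier W})"

definition tensor :: "(complex, 'v, 'z) module_scheme \<Rightarrow> (complex, 'w, 'y) module_scheme \<Rightarrow>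
     (complex, ('v, 'w) tens) module"
  where "tensor V W = quot (free_vs (carrier V \<times> carrier W)) (bilin_rels V W)"

definition pure :: "(complex, 'v, 'z) module_scheme \<Rightarrow> (complex, 'w, 'y) module_scheme \<Rightarrow>
     'v \<Rightarrow> 'w \<Rightarrow> ('v, 'w) tens"
  where "pure V W v w = qmap (free_vs (carrier V \<times> carrier W)) (bilin_rels V W) (free_gen (v, w))"

text \<open>Balanced tensor products: \<open>V\<close> carries a right action \<open>ra\<close> and \<open>W\<close> a left action \<open>la\<close> of
  the set \<open>R\<close>, and the elements \<open>v r \<otimes> w - v \<otimes> r w\<close> are divided out of the tensor product
  over the complex numbers.\<close>

type_synonym ('v, 'w) btens = "('v, 'w) tens set"

definition bal_rels :: "(complex, 'v, 'z) module_scheme \<Rightarrow> (complex, 'w, 'y) module_scheme \<Rightarrow> 'r set \<Rightarrow>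
     ('v \<Rightarrow> 'r \<Rightarrow> 'v) \<Rightarrow> ('r \<Rightarrow> 'w \<Rightarrow> 'w) \<Rightarrow> ('v, 'w) tens set"
  where "bal_rels V W R ra la =
     {pure V W (ra v r) w \<ominus>\<^bsub>tensor V W\<^esub> pure V W v (la r w) | v r w.
        v \<in> carrier V \<and> r \<in> R \<and> w \<in> carrier W}"

definition btensor :: "(complex, 'v, 'z) module_scheme \<Rightarrow> (complex, 'w, 'y) module_scheme \<Rightarrow> 'r set \<Rightarrow>
     ('v \<Rightarrow> 'r \<Rightarrow> 'v) \<Rightarrow> ('r \<Rightarrow> 'w \<Rightarrow> 'w) \<Rightarrow> (complex, ('v, 'w) btens) module"
  where "btensor V W R ra la = quot (tensor V W) (bal_rels V W R ra la)"

definition bpure :: "(complex, 'v, 'z) module_scheme \<Rightarrow> (complex, 'w, 'y) module_scheme \<Rightarrow> 'r set \<Rightarrow>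
     ('v \<Rightarrow> 'r \<Rightarrow> 'v) \<Rightarrow> ('r \<Rightarrow> 'w \<Rightarrow> 'w) \<Rightarrow> 'v \<Rightarrow> 'w \<Rightarrow> ('v, 'w) btens"
  where "bpure V W R ra la v w = qmap (tensor V W) (bal_rels V W R ra la) (pure V W v w)"


section \<open>Essential modules over complex algebras\<close>

record ('r, 'm) alg_mod = "(complex, 'm) module" +
  lact :: "'r \<Rightarrow> 'm \<Rightarrow> 'm"

text \<open>The algebra \<open>R\<close>, with product \<open>mult R\<close>, need not be unital.\<close>

definition alg_module :: "(complex, 'r, 'z) module_scheme \<Rightarrow> ('r, 'm, 'y) alg_mod_scheme \<Rightarrow> bool"
  where "alg_module R M \<longleftrightarrow> vspace M \<and>
     (\<forall>a\<in>carrier R. \<forall>x\<in>carrier M. lact M a x \<in> carrier M) \<and>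
     (\<forall>a\<in>carrier R. \<forall>x\<in>carrier M. \<forall>y\<in>carrier M.
        lact M a (x \<oplus>\<^bsub>M\<^esub> y) = lact M a x \<oplus>\<^bsub>M\<^esub> lact M a y) \<and>
     (\<forall>a\<in>carrier R. \<forall>b\<in>carrier R. \<forall>x\<in>carrier M.
        lact M (a \<oplus>\<^bsub>R\<^esub> b) x = lact M a x \<oplus>\<^bsub>M\<^esub> lact M b x) \<and>
     (\<forall>c. \<forall>a\<in>carrier R. \<forall>x\<in>carrier M.
        lact M (c \<odot>\<^bsub>R\<^esub> a) x = c \<odot>\<^bsub>M\<^esub> lact M a x \<and> lact M a (c \<odot>\<^bsub>M\<^esub> x) = c \<odot>\<^bsub>M\<^esub> lact M a x) \<and>
     (\<forall>a\<in>carrier R. \<forall>b\<in>carrier R. \<forall>x\<in>carrier M.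
        lact M (a \<otimes>\<^bsub>R\<^esub> b) x = lact M a (lact M b x))"

text \<open>The tensor product \<open>R \<otimes>\<^sub>R M\<close> and the multiplication map from it to \<open>M\<close>.\<close>

definition rtensor :: "(complex, 'r, 'z) module_scheme \<Rightarrow> ('r, 'm, 'y) alg_mod_scheme \<Rightarrow>
     (complex, ('r, 'm) btens) module"
  where "rtensor R M = btensor R M (carrier R) (mult R) (lact M)"

definition rpure :: "(complex, 'r, 'z) module_scheme \<Rightarrow> ('r, 'm, 'y) alg_mod_scheme \<Rightarrow>
     'r \<Rightarrow> 'm \<Rightarrow> ('r, 'm) btens"
  where "rpure R M = bpure R M (carrier R) (mult R) (lact M)"

definition mult_map :: "(complex, 'r, 'z) module_scheme \<Rightarrow> ('r, 'm, 'y) alg_mod_scheme \<Rightarrow>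
     ('r, 'm) btens \<Rightarrow> 'm"
  where "mult_map R M = the_lin (rtensor R M) M
     (\<lambda>F. \<forall>a\<in>carrier R. \<forall>x\<in>carrier M. F (rpure R M a x) = lact M a x)"

definition essential :: "(complex, 'r, 'z) module_scheme \<Rightarrow> ('r, 'm, 'y) alg_mod_scheme \<Rightarrow> bool"
  where "essential R M \<longleftrightarrow> alg_module R M \<and>
     bij_betw (mult_map R M) (carrier (rtensor R M)) (carrier M)"

definition mod_hom :: "(complex, 'r, 'z) module_scheme \<Rightarrow> ('r, 'm, 'y) alg_mod_scheme \<Rightarrow>
     ('r, 'n, 'x) alg_mod_scheme \<Rightarrow> ('m \<Rightarrow> 'n) set"
  where "mod_hom R M N = {f \<in> lin M N.
     \<forall>a\<in>carrier R. \<forall>x\<in>carrier M. f (lact M a x) = lact N a (f x)}"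

text \<open>Operations take the value \<open>undefined\<close> outside their domains.  Required of objects of the
  categories below, so that equality of records is equality of module structures.\<close>

definition normalised :: "(complex, 'r, 'z) module_scheme \<Rightarrow> ('r, 'm, 'y) alg_mod_scheme \<Rightarrow> bool"
  where "normalised R M \<longleftrightarrow>
     mult M = (\<lambda>_ _. undefined) \<and> one M = undefined \<and>
     (\<forall>x y. \<not> (x \<in> carrier M \<and> y \<in> carrier M) \<longrightarrow> x \<oplus>\<^bsub>M\<^esub> y = undefined) \<and>
     (\<forall>c x. x \<notin> carrier M \<longrightarrow> c \<odot>\<^bsub>M\<^esub> x = undefined) \<and>
     (\<forall>a x. \<not> (a \<in> carrier R \<and> x \<in> carrier M) \<longrightarrow> lact M a x = undefined)"


section \<open>Ample groupoids\<close>

text \<open>Units are themselves arrows, so that the unit space is a subspace of the groupoid.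
  The product \<open>gcomp G a b\<close> is meaningful only if \<open>gsrc G a = grng G b\<close>.\<close>

record 'g groupoid =
  gtop :: "'g topology"
  gunits :: "'g set"
  gsrc :: "'g \<Rightarrow> 'g"
  grng :: "'g \<Rightarrow> 'g"
  gcomp :: "'g \<Rightarrow> 'g \<Rightarrow> 'g"
  ginv :: "'g \<Rightarrow> 'g"

definition gtop0 :: "'g groupoid \<Rightarrow> 'g topology"
  where "gtop0 G = subtopology (gtop G) (gunits G)"

definition fibprod :: "'g groupoid \<Rightarrow> ('g \<Rightarrow> 'g) \<Rightarrow> ('g \<Rightarrow> 'g) \<Rightarrow> ('g \<times> 'g) topology"
  where "fibprod G p q = subtopology (prod_topology (gtop G) (gtop G)) {(a, b). p a = q b}"

abbreviation gtop2 :: "'g groupoid \<Rightarrow> ('g \<times> 'g) topology"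
  where "gtop2 G \<equiv> fibprod G (gsrc G) (grng G)"

definition local_homeomorphism :: "'a topology \<Rightarrow> 'b topology \<Rightarrow> ('a \<Rightarrow> 'b) \<Rightarrow> bool"
  where "local_homeomorphism E Y f \<longleftrightarrow> (\<forall>x\<in>topspace E. \<exists>U V. openin E U \<and> x \<in> U \<and> openin Y V \<and>
     homeomorphic_map (subtopology E U) (subtopology Y V) f)"

definition totally_disconnected_space :: "'a topology \<Rightarrow> bool"
  where "totally_disconnected_space E \<longleftrightarrow> (\<forall>S. connectedin E S \<longrightarrow> (\<exists>a. S \<subseteq> {a}))"

locale algebraic_groupoid =
  fixes G :: "'g groupoid"
  assumes units_subset: "gunits G \<subseteq> topspace (gtop G)"
    and src_in: "a \<in> topspace (gtop G) \<Longrightarrow> gsrc G a \<in> gunits G"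
    and rng_in: "a \<in> topspace (gtop G) \<Longrightarrow> grng G a \<in> gunits G"
    and src_unit: "x \<in> gunits G \<Longrightarrow> gsrc G x = x"
    and rng_unit: "x \<in> gunits G \<Longrightarrow> grng G x = x"
    and comp_in: "(a, b) \<in> topspace (gtop2 G) \<Longrightarrow> gcomp G a b \<in> topspace (gtop G)"
    and src_comp: "(a, b) \<in> topspace (gtop2 G) \<Longrightarrow> gsrc G (gcomp G a b) = gsrc G b"
    and rng_comp: "(a, b) \<in> topspace (gtop2 G) \<Longrightarrow> grng G (gcomp G a b) = grng G a"
    and comp_assoc: "(a, b) \<in> topspace (gtop2 G) \<Longrightarrow> (b, c) \<in> topspace (gtop2 G) \<Longrightarrow>
       gcomp G (gcomp G a b) c = gcomp G a (gcomp G b c)"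
    and comp_src: "a \<in> topspace (gtop G) \<Longrightarrow> gcomp G a (gsrc G a) = a"
    and rng_comp_left: "a \<in> topspace (gtop G) \<Longrightarrow> gcomp G (grng G a) a = a"
    and inv_in: "a \<in> topspace (gtop G) \<Longrightarrow> ginv G a \<in> topspace (gtop G)"
    and src_inv: "a \<in> topspace (gtop G) \<Longrightarrow> gsrc G (ginv G a) = grng G a"
    and rng_inv: "a \<in> topspace (gtop G) \<Longrightarrow> grng G (ginv G a) = gsrc G a"
    and comp_inv_right: "a \<in> topspace (gtop G) \<Longrightarrow> gcomp G a (ginv G a) = grng G a"
    and comp_inv_left: "a \<in> topspace (gtop G) \<Longrightarrow> gcomp G (ginv G a) a = gsrc G a"

locale ample_groupoid = algebraic_groupoid +
  assumes comp_continuous: "continuous_map (gtop2 G) (gtop G) (\<lambda>(a, b). gcomp G a b)"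
    and inv_continuous: "continuous_map (gtop G) (gtop G) (ginv G)"
    and hausdorff: "Hausdorff_space (gtop G)"
    and locally_compact: "locally_compact_space (gtop G)"
    and etale: "local_homeomorphism (gtop G) (gtop0 G) (grng G)"
    and totally_disconnected: "totally_disconnected_space (gtop0 G)"


section \<open>Function algebras\<close>

text \<open>Functions vanish outside the space they live on.  With this convention the extension by
  zero of a function on the unit space to the whole groupoid is the same HOL function.\<close>

definition CcInf :: "'x topology \<Rightarrow> ('x \<Rightarrow> complex) set"
  where "CcInf E = {f. (\<forall>x. x \<notin> topspace E \<longrightarrow> f x = 0) \<and>
     (\<forall>x\<in>topspace E. \<exists>U. openin E U \<and> x \<in> U \<and> (\<forall>y\<in>U. f y = f x)) \<and>
     compactin E (Abstract_Topology.closure_of E {x \<in> topspace E. f x \<noteq> 0})}"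

definition pmult :: "('x \<Rightarrow> complex) \<Rightarrow> ('x \<Rightarrow> complex) \<Rightarrow> 'x \<Rightarrow> complex"
  where "pmult f g = (\<lambda>x. f x * g x)"

definition Cc :: "'x topology \<Rightarrow> (complex, 'x \<Rightarrow> complex) module"
  where "Cc E = \<lparr>carrier = CcInf E, mult = pmult, one = undefined,
     zero = (\<lambda>_. 0), add = (\<lambda>f g x. f x + g x), smult = (\<lambda>c f x. c * f x)\<rparr>"

abbreviation CcG :: "'g groupoid \<Rightarrow> (complex, 'g \<Rightarrow> complex) module"
  where "CcG G \<equiv> Cc (gtop G)"

abbreviation CcG0 :: "'g groupoid \<Rightarrow> (complex, 'g \<Rightarrow> complex) module"
  where "CcG0 G \<equiv> Cc (gtop0 G)"

text \<open>In the fibrewise sums only finitely many terms are nonzero, but the fibres may be infinite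
  and HOL assigns the value zero to sums over infinite sets; hence the index sets are cut down
  to the points where the first factor does not vanish.\<close>

definition conv :: "'g groupoid \<Rightarrow> ('g \<Rightarrow> complex) \<Rightarrow> ('g \<Rightarrow> complex) \<Rightarrow> 'g \<Rightarrow> complex"
  where "conv G f g = (\<lambda>a. if a \<in> topspace (gtop G)
     then \<Sum>b | b \<in> topspace (gtop G) \<and> grng G b = grng G a \<and> f b \<noteq> 0. f b * g (gcomp G (ginv G b) a)
     else 0)"

definition DG :: "'g groupoid \<Rightarrow> (complex, 'g \<Rightarrow> complex) module"
  where "DG G = (CcG G)\<lparr>mult := conv G\<rparr>"

definition lam :: "'g groupoid \<Rightarrow> ('g \<Rightarrow> complex) \<Rightarrow> 'g \<Rightarrow> complex"
  where "lam G f = (\<lambda>x. if x \<in> gunits G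
     then \<Sum>a | a \<in> topspace (gtop G) \<and> grng G a = x \<and> f a \<noteq> 0. f a else 0)"


section \<open>Comodules\<close>

text \<open>The space written \<open>C\<^sub>c\<^sup>\<infinity>(E) \<otimes>\<^sup>p M\<close>, for \<open>p\<close> a map from \<open>E\<close> to the unit space.  As functions in
  the first factor vanish off \<open>E\<close>, only the values of \<open>p\<close> on \<open>E\<close> matter.\<close>

definition ptensor :: "'g groupoid \<Rightarrow> 'x topology \<Rightarrow> ('x \<Rightarrow> 'g) \<Rightarrow> ('g \<Rightarrow> complex, 'm, 'z) alg_mod_scheme \<Rightarrow>
     (complex, ('x \<Rightarrow> complex, 'm) btens) module"
  where "ptensor G E p M =
     btensor (Cc E) M (carrier (CcG0 G)) (\<lambda>f h. pmult f (h \<circ> p)) (lact M)"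

definition ppure :: "'g groupoid \<Rightarrow> 'x topology \<Rightarrow> ('x \<Rightarrow> 'g) \<Rightarrow> ('g \<Rightarrow> complex, 'm, 'z) alg_mod_scheme \<Rightarrow>
     ('x \<Rightarrow> complex) \<Rightarrow> 'm \<Rightarrow> ('x \<Rightarrow> complex, 'm) btens"
  where "ppure G E p M =
     bpure (Cc E) M (carrier (CcG0 G)) (\<lambda>f h. pmult f (h \<circ> p)) (lact M)"

text \<open>The quotient map from \<open>C\<^sub>c\<^sup>\<infinity>(E) \<otimes> M\<close> to \<open>C\<^sub>c\<^sup>\<infinity>(E) \<otimes>\<^sup>p M\<close>.\<close>

definition pquot :: "'g groupoid \<Rightarrow> 'x topology \<Rightarrow> ('x \<Rightarrow> 'g) \<Rightarrow> ('g \<Rightarrow> complex, 'm, 'z) alg_mod_scheme \<Rightarrow>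
     ('x \<Rightarrow> complex, 'm) tens \<Rightarrow> ('x \<Rightarrow> complex, 'm) btens"
  where "pquot G E p M =
     qmap (tensor (Cc E) M) (bal_rels (Cc E) M (carrier (CcG0 G)) (\<lambda>f h. pmult f (h \<circ> p)) (lact M))"

text \<open>The action of \<open>C\<^sub>c\<^sup>\<infinity>(G)\<close> on \<open>C\<^sub>c\<^sup>\<infinity>(G) \<otimes>\<^sup>p M\<close> by pointwise multiplication.\<close>

definition cact :: "'g groupoid \<Rightarrow> ('g \<Rightarrow> 'g) \<Rightarrow> ('g \<Rightarrow> complex, 'm, 'z) alg_mod_scheme \<Rightarrow>
     ('g \<Rightarrow> complex) \<Rightarrow> ('g \<Rightarrow> complex, 'm) btens \<Rightarrow> ('g \<Rightarrow> complex, 'm) btens"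
  where "cact G p M g = the_lin (ptensor G (gtop G) p M) (ptensor G (gtop G) p M)
     (\<lambda>F. \<forall>f\<in>carrier (CcG G). \<forall>x\<in>carrier M.
        F (ppure G (gtop G) p M f x) = ppure G (gtop G) p M (pmult g f) x)"

definition clinear :: "'g groupoid \<Rightarrow> ('g \<Rightarrow> complex, 'm, 'z) alg_mod_scheme \<Rightarrow>
     (('g \<Rightarrow> complex, 'm) btens \<Rightarrow> ('g \<Rightarrow> complex, 'm) btens) set"
  where "clinear G M = {T \<in> lin (ptensor G (gtop G) (grng G) M) (ptensor G (gtop G) (gsrc G) M).
     \<forall>g\<in>carrier (CcG G). \<forall>t\<in>carrier (ptensor G (gtop G) (grng G) M).
       T (cact G (grng G) M g t) = cact G (gsrc G) M g (T t)}"

definition face0 :: "'g groupoid \<Rightarrow> 'g \<times> 'g \<Rightarrow> 'g" where "face0 G = (\<lambda>(a, b). b)"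
definition face1 :: "'g groupoid \<Rightarrow> 'g \<times> 'g \<Rightarrow> 'g" where "face1 G = (\<lambda>(a, b). gcomp G a b)"
definition face2 :: "'g groupoid \<Rightarrow> 'g \<times> 'g \<Rightarrow> 'g" where "face2 G = (\<lambda>(a, b). a)"

text \<open>For \<open>d\<close> one of the face maps: the tensor product of \<open>C\<^sub>c\<^sup>\<infinity>(G\<^sup>2)\<close> and \<open>C\<^sub>c\<^sup>\<infinity>(G) \<otimes>\<^sup>p M\<close> over \<open>C\<^sub>c\<^sup>\<infinity>(G)\<close>
  along \<open>d\<close>, and its identification with \<open>C\<^sub>c\<^sup>\<infinity>(G\<^sup>2) \<otimes>\<^bsup>p d\<^esup> M\<close>.\<close>

definition dtensor :: "'g groupoid \<Rightarrow> ('g \<times> 'g \<Rightarrow> 'g) \<Rightarrow> ('g \<Rightarrow> 'g) \<Rightarrow>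
     ('g \<Rightarrow> complex, 'm, 'z) alg_mod_scheme \<Rightarrow>
     (complex, ('g \<times> 'g \<Rightarrow> complex, ('g \<Rightarrow> complex, 'm) btens) btens) module"
  where "dtensor G d p M = btensor (Cc (gtop2 G)) (ptensor G (gtop G) p M)
     (carrier (CcG G)) (\<lambda>k g. pmult k (g \<circ> d)) (cact G p M)"

definition dpure :: "'g groupoid \<Rightarrow> ('g \<times> 'g \<Rightarrow> 'g) \<Rightarrow> ('g \<Rightarrow> 'g) \<Rightarrow>
     ('g \<Rightarrow> complex, 'm, 'z) alg_mod_scheme \<Rightarrow>
     ('g \<times> 'g \<Rightarrow> complex) \<Rightarrow> ('g \<Rightarrow> complex, 'm) btens \<Rightarrow>
     ('g \<times> 'g \<Rightarrow> complex, ('g \<Rightarrow> complex, 'm) btens) btens"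
  where "dpure G d p M = bpure (Cc (gtop2 G)) (ptensor G (gtop G) p M)
     (carrier (CcG G)) (\<lambda>k g. pmult k (g \<circ> d)) (cact G p M)"

definition dident :: "'g groupoid \<Rightarrow> ('g \<times> 'g \<Rightarrow> 'g) \<Rightarrow> ('g \<Rightarrow> 'g) \<Rightarrow>
     ('g \<Rightarrow> complex, 'm, 'z) alg_mod_scheme \<Rightarrow>
     ('g \<times> 'g \<Rightarrow> complex, ('g \<Rightarrow> complex, 'm) btens) btens \<Rightarrow> ('g \<times> 'g \<Rightarrow> complex, 'm) btens"
  where "dident G d p M = the_lin (dtensor G d p M) (ptensor G (gtop2 G) (p \<circ> d) M)
     (\<lambda>F. \<forall>k\<in>carrier (Cc (gtop2 G)). \<forall>f\<in>carrier (CcG G). \<forall>x\<in>carrier M.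
        F (dpure G d p M k (ppure G (gtop G) p M f x)) =
        ppure G (gtop2 G) (p \<circ> d) M (pmult k (f \<circ> d)) x)"

text \<open>The map \<open>id \<otimes> T\<close> between the tensor products along \<open>d\<close>, and \<open>d\<^sup>*(T)\<close>, which is this map
  transported along the identifications.\<close>

definition id_tensor :: "'g groupoid \<Rightarrow> ('g \<times> 'g \<Rightarrow> 'g) \<Rightarrow> ('g \<Rightarrow> complex, 'm, 'z) alg_mod_scheme \<Rightarrow>
     (('g \<Rightarrow> complex, 'm) btens \<Rightarrow> ('g \<Rightarrow> complex, 'm) btens) \<Rightarrow>
     ('g \<times> 'g \<Rightarrow> complex, ('g \<Rightarrow> complex, 'm) btens) btens \<Rightarrow>
     ('g \<times> 'g \<Rightarrow> complex, ('g \<Rightarrow> complex, 'm) btens) btens"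
  where "id_tensor G d M T = the_lin (dtensor G d (grng G) M) (dtensor G d (gsrc G) M)
     (\<lambda>F. \<forall>k\<in>carrier (Cc (gtop2 G)). \<forall>t\<in>carrier (ptensor G (gtop G) (grng G) M).
        F (dpure G d (grng G) M k t) = dpure G d (gsrc G) M k (T t))"

definition dstar :: "'g groupoid \<Rightarrow> ('g \<times> 'g \<Rightarrow> 'g) \<Rightarrow> ('g \<Rightarrow> complex, 'm, 'z) alg_mod_scheme \<Rightarrow>
     (('g \<Rightarrow> complex, 'm) btens \<Rightarrow> ('g \<Rightarrow> complex, 'm) btens) \<Rightarrow>
     ('g \<times> 'g \<Rightarrow> complex, 'm) btens \<Rightarrow> ('g \<times> 'g \<Rightarrow> complex, 'm) btens"
  where "dstar G d M T = restrict
     (dident G d (gsrc G) M \<circ> id_tensor G d M T \<circ>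
        inv_into (carrier (dtensor G d (grng G) M)) (dident G d (grng G) M))
     (carrier (ptensor G (gtop2 G) (grng G \<circ> d) M))"

record ('g, 'm) comod = "('g \<Rightarrow> complex, 'm) alg_mod" +
  coT :: "('g \<Rightarrow> complex, 'm) btens \<Rightarrow> ('g \<Rightarrow> complex, 'm) btens"

text \<open>The cocycle identity compares maps out of the space \<open>C\<^sub>c\<^sup>\<infinity>(G\<^sup>2) \<otimes>\<^bsup>v\<^esup> M\<close> with \<open>v = r d\<^sub>1\<close>.  Since
  \<open>r d\<^sub>1 = r d\<^sub>2\<close>, \<open>r d\<^sub>0 = s d\<^sub>2\<close> and \<open>s d\<^sub>0 = s d\<^sub>1\<close> on \<open>G\<^sup>2\<close>, the sources and targets of the three maps
  agree as required.\<close>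

definition comodule :: "'g groupoid \<Rightarrow> ('g, 'm) comod \<Rightarrow> bool"
  where "comodule G M \<longleftrightarrow> essential (CcG0 G) M \<and> coT M \<in> clinear G M \<and>
     bij_betw (coT M) (carrier (ptensor G (gtop G) (grng G) M)) (carrier (ptensor G (gtop G) (gsrc G) M)) \<and>
     (\<forall>t\<in>carrier (ptensor G (gtop2 G) (grng G \<circ> face1 G) M).
        dstar G (face0 G) M (coT M) (dstar G (face2 G) M (coT M) t) = dstar G (face1 G) M (coT M) t)"

text \<open>The map \<open>id \<otimes> f\<close> from \<open>C\<^sub>c\<^sup>\<infinity>(G) \<otimes>\<^sup>p M\<close> to \<open>C\<^sub>c\<^sup>\<infinity>(G) \<otimes>\<^sup>p N\<close>.\<close>

definition ptensor_map :: "'g groupoid \<Rightarrow> ('g \<Rightarrow> 'g) \<Rightarrow> ('g \<Rightarrow> complex, 'm, 'z) alg_mod_scheme \<Rightarrow>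
     ('g \<Rightarrow> complex, 'n, 'y) alg_mod_scheme \<Rightarrow> ('m \<Rightarrow> 'n) \<Rightarrow>
     ('g \<Rightarrow> complex, 'm) btens \<Rightarrow> ('g \<Rightarrow> complex, 'n) btens"
  where "ptensor_map G p M N f = the_lin (ptensor G (gtop G) p M) (ptensor G (gtop G) p N)
     (\<lambda>F. \<forall>k\<in>carrier (CcG G). \<forall>x\<in>carrier M.
        F (ppure G (gtop G) p M k x) = ppure G (gtop G) p N k (f x))"

definition comod_hom :: "'g groupoid \<Rightarrow> ('g, 'm) comod \<Rightarrow> ('g, 'n) comod \<Rightarrow> ('m \<Rightarrow> 'n) set"
  where "comod_hom G M N = {f \<in> mod_hom (CcG0 G) M N.
     \<forall>t\<in>carrier (ptensor G (gtop G) (grng G) M).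
       ptensor_map G (gsrc G) M N f (coT M t) = coT N (ptensor_map G (grng G) M N f t)}"


section \<open>Categories and functors\<close>

text \<open>Arrows are typed by their source and target objects: a HOL function may be an arrow in
  several hom-sets, and composition and arrow maps take the objects as arguments.\<close>

record ('o, 'a) category =
  Obj :: "'o set"
  Hom :: "'o \<Rightarrow> 'o \<Rightarrow> 'a set"
  Ident :: "'o \<Rightarrow> 'a"
  Comp :: "'o \<Rightarrow> 'o \<Rightarrow> 'o \<Rightarrow> 'a \<Rightarrow> 'a \<Rightarrow> 'a"

definition is_category :: "('o, 'a) category \<Rightarrow> bool"
  where "is_category C \<longleftrightarrow>
     (\<forall>U\<in>Obj C. Ident C U \<in> Hom C U U) \<and>
     (\<forall>U\<in>Obj C. \<forall>V\<in>Obj C. \<forall>W\<in>Obj C. \<forall>f\<in>Hom C U V. \<forall>g\<in>Hom C V W. Comp C U V W g f \<in> Hom C U W) \<and>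
     (\<forall>U\<in>Obj C. \<forall>V\<in>Obj C. \<forall>f\<in>Hom C U V.
        Comp C U U V f (Ident C U) = f \<and> Comp C U V V (Ident C V) f = f) \<and>
     (\<forall>T\<in>Obj C. \<forall>U\<in>Obj C. \<forall>V\<in>Obj C. \<forall>W\<in>Obj C.
        \<forall>f\<in>Hom C T U. \<forall>g\<in>Hom C U V. \<forall>h\<in>Hom C V W.
          Comp C T U W (Comp C U V W h g) f = Comp C T V W h (Comp C T U V g f))"

record ('o, 'a, 'p, 'b) functr =
  omap :: "'o \<Rightarrow> 'p"
  amap :: "'o \<Rightarrow> 'o \<Rightarrow> 'a \<Rightarrow> 'b"

definition is_functor :: "('o, 'a) category \<Rightarrow> ('p, 'b) category \<Rightarrow> ('o, 'a, 'p, 'b) functr \<Rightarrow> bool"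
  where "is_functor C D F \<longleftrightarrow> is_category C \<and> is_category D \<and>
     (\<forall>U\<in>Obj C. omap F U \<in> Obj D) \<and>
     (\<forall>U\<in>Obj C. \<forall>V\<in>Obj C. \<forall>f\<in>Hom C U V. amap F U V f \<in> Hom D (omap F U) (omap F V)) \<and>
     (\<forall>U\<in>Obj C. amap F U U (Ident C U) = Ident D (omap F U)) \<and>
     (\<forall>U\<in>Obj C. \<forall>V\<in>Obj C. \<forall>W\<in>Obj C. \<forall>f\<in>Hom C U V. \<forall>g\<in>Hom C V W.
        amap F U W (Comp C U V W g f) =
        Comp D (omap F U) (omap F V) (omap F W) (amap F V W g) (amap F U V f))"

definition left_inverse_functor :: "('o, 'a) category \<Rightarrow> ('o, 'a, 'p, 'b) functr \<Rightarrow>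
     ('p, 'b, 'o, 'a) functr \<Rightarrow> bool"
  where "left_inverse_functor C F K \<longleftrightarrow>
     (\<forall>U\<in>Obj C. omap K (omap F U) = U) \<and>
     (\<forall>U\<in>Obj C. \<forall>V\<in>Obj C. \<forall>f\<in>Hom C U V. amap K (omap F U) (omap F V) (amap F U V f) = f)"

definition mutually_inverse :: "('o, 'a) category \<Rightarrow> ('p, 'b) category \<Rightarrow> ('o, 'a, 'p, 'b) functr \<Rightarrow>
     ('p, 'b, 'o, 'a) functr \<Rightarrow> bool"
  where "mutually_inverse C D F K \<longleftrightarrow> is_functor C D F \<and> is_functor D C K \<and>
     left_inverse_functor C F K \<and> left_inverse_functor D K F"

definition category_isomorphism :: "('o, 'a) category \<Rightarrow> ('p, 'b) category \<Rightarrow>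
     ('o, 'a, 'p, 'b) functr \<Rightarrow> bool"
  where "category_isomorphism C D F \<longleftrightarrow> (\<exists>K. mutually_inverse C D F K)"


section \<open>The two categories and the two functors\<close>

text \<open>The modules and comodules are those whose underlying sets are subsets of the (arbitrary)
  type \<open>'m\<close>, which plays the role of a universe.\<close>

definition GMod :: "'g groupoid \<Rightarrow> (('g \<Rightarrow> complex, 'm) alg_mod, 'm \<Rightarrow> 'm) category"
  where "GMod G = \<lparr>Obj = {M. essential (DG G) M \<and> normalised (DG G) M},
     Hom = mod_hom (DG G),
     Ident = (\<lambda>M. restrict id (carrier M)),
     Comp = (\<lambda>L M N g f. compose (carrier L) g f)\<rparr>"

definition Comod :: "'g groupoid \<Rightarrow> (('g, 'm) comod, 'm \<Rightarrow> 'm) category"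
  where "Comod G = \<lparr>Obj = {M. comodule G M \<and> normalised (CcG0 G) M},
     Hom = comod_hom G,
     Ident = (\<lambda>M. restrict id (carrier M)),
     Comp = (\<lambda>L M N g f. compose (carrier L) g f)\<rparr>"

text \<open>The tensor product of \<open>C\<^sub>c\<^sup>\<infinity>(G \<times>\<^bsub>p,r\<^esub> G)\<close> and \<open>M\<close> over \<open>D(G)\<close>, which acts by convolution in the
  second variable.\<close>

definition rconv :: "'g groupoid \<Rightarrow> ('g \<Rightarrow> 'g) \<Rightarrow> ('g \<times> 'g \<Rightarrow> complex) \<Rightarrow> ('g \<Rightarrow> complex) \<Rightarrow>
     'g \<times> 'g \<Rightarrow> complex"
  where "rconv G p k g = (\<lambda>(a, b). if (a, b) \<in> topspace (fibprod G p (grng G))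
     then \<Sum>c | c \<in> topspace (gtop G) \<and> grng G c = grng G b \<and> k (a, c) \<noteq> 0.
            k (a, c) * g (gcomp G (ginv G c) b)
     else 0)"

definition ctensor :: "'g groupoid \<Rightarrow> ('g \<Rightarrow> 'g) \<Rightarrow> ('g \<Rightarrow> complex, 'm, 'z) alg_mod_scheme \<Rightarrow>
     (complex, ('g \<times> 'g \<Rightarrow> complex, 'm) btens) module"
  where "ctensor G p M = btensor (Cc (fibprod G p (grng G))) M (carrier (DG G)) (rconv G p) (lact M)"

definition cpure :: "'g groupoid \<Rightarrow> ('g \<Rightarrow> 'g) \<Rightarrow> ('g \<Rightarrow> complex, 'm, 'z) alg_mod_scheme \<Rightarrow>
     ('g \<times> 'g \<Rightarrow> complex) \<Rightarrow> 'm \<Rightarrow> ('g \<times> 'g \<Rightarrow> complex, 'm) btens"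
  where "cpure G p M = bpure (Cc (fibprod G p (grng G))) M (carrier (DG G)) (rconv G p) (lact M)"

text \<open>The function corresponding to \<open>f \<otimes> g\<close> under the identification of \<open>C\<^sub>c\<^sup>\<infinity>(G \<times>\<^bsub>p,r\<^esub> G)\<close> with the
  tensor product of two copies of \<open>C\<^sub>c\<^sup>\<infinity>(G)\<close> over \<open>C\<^sub>c\<^sup>\<infinity>(G\<^sup>0)\<close>, balanced via \<open>p\<close> and \<open>r\<close>.\<close>

definition ext_prod :: "'g groupoid \<Rightarrow> ('g \<Rightarrow> 'g) \<Rightarrow> ('g \<Rightarrow> complex) \<Rightarrow> ('g \<Rightarrow> complex) \<Rightarrow>
     'g \<times> 'g \<Rightarrow> complex"
  where "ext_prod G p f g = (\<lambda>(a, b). if (a, b) \<in> topspace (fibprod G p (grng G)) then f a * g b else 0)"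

text \<open>The identification of \<open>C\<^sub>c\<^sup>\<infinity>(G \<times>\<^bsub>p,r\<^esub> G) \<otimes> M\<close> (over \<open>D(G)\<close>) with \<open>C\<^sub>c\<^sup>\<infinity>(G) \<otimes>\<^sup>p M\<close> obtained from
  the previous one, associativity, and the multiplication isomorphism \<open>D(G) \<otimes> M \<cong> M\<close> (over \<open>D(G)\<close>);
  it sends \<open>(f \<otimes> g) \<otimes> m\<close> to \<open>f \<otimes> g m\<close>.\<close>

definition cident :: "'g groupoid \<Rightarrow> ('g \<Rightarrow> 'g) \<Rightarrow> ('g \<Rightarrow> complex, 'm, 'z) alg_mod_scheme \<Rightarrow>
     ('g \<times> 'g \<Rightarrow> complex, 'm) btens \<Rightarrow> ('g \<Rightarrow> complex, 'm) btens"
  where "cident G p M = the_lin (ctensor G p M) (ptensor G (gtop G) p M)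
     (\<lambda>F. \<forall>f\<in>carrier (CcG G). \<forall>g\<in>carrier (DG G). \<forall>x\<in>carrier M.
        F (cpure G p M (ext_prod G p f g) x) = ppure G (gtop G) p M f (lact M g x))"

definition can_map :: "'g groupoid \<Rightarrow> ('g \<times> 'g \<Rightarrow> complex) \<Rightarrow> 'g \<times> 'g \<Rightarrow> complex"
  where "can_map G k = (\<lambda>(a, b). if (a, b) \<in> topspace (gtop2 G) then k (a, gcomp G a b) else 0)"

definition can_map_tensor :: "'g groupoid \<Rightarrow> ('g \<Rightarrow> complex, 'm, 'z) alg_mod_scheme \<Rightarrow>
     ('g \<times> 'g \<Rightarrow> complex, 'm) btens \<Rightarrow> ('g \<times> 'g \<Rightarrow> complex, 'm) btens"
  where "can_map_tensor G M = the_lin (ctensor G (grng G) M) (ctensor G (gsrc G) M)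
     (\<lambda>F. \<forall>k\<in>carrier (Cc (fibprod G (grng G) (grng G))). \<forall>x\<in>carrier M.
        F (cpure G (grng G) M k x) = cpure G (gsrc G) M (can_map G k) x)"

definition TM :: "'g groupoid \<Rightarrow> ('g \<Rightarrow> complex, 'm, 'z) alg_mod_scheme \<Rightarrow>
     ('g \<Rightarrow> complex, 'm) btens \<Rightarrow> ('g \<Rightarrow> complex, 'm) btens"
  where "TM G M = restrict
     (cident G (gsrc G) M \<circ> can_map_tensor G M \<circ>
        inv_into (carrier (ctensor G (grng G) M)) (cident G (grng G) M))
     (carrier (ptensor G (gtop G) (grng G) M))"

definition functor_A :: "'g groupoid \<Rightarrow>
     (('g \<Rightarrow> complex, 'm) alg_mod, 'm \<Rightarrow> 'm, ('g, 'm) comod, 'm \<Rightarrow> 'm) functr"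
  where "functor_A G = \<lparr>
     omap = (\<lambda>M. \<lparr>carrier = carrier M, mult = mult M, one = one M, zero = zero M, add = add M,
        smult = smult M,
        lact = (\<lambda>h. if h \<in> carrier (CcG0 G) then lact M h else (\<lambda>_. undefined)),
        coT = TM G M\<rparr>),
     amap = (\<lambda>M N f. f)\<rparr>"

definition lam_tensor :: "'g groupoid \<Rightarrow> ('g \<Rightarrow> complex, 'm, 'z) alg_mod_scheme \<Rightarrow>
     ('g \<Rightarrow> complex, 'm) btens \<Rightarrow> ('g \<Rightarrow> complex, 'm) btens"
  where "lam_tensor G M = the_lin (ptensor G (gtop G) (grng G) M) (rtensor (CcG0 G) M)
     (\<lambda>F. \<forall>f\<in>carrier (CcG G). \<forall>x\<in>carrier M.
        F (ppure G (gtop G) (grng G) M f x) = rpure (CcG0 G) M (lam G f) x)"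

definition muM :: "'g groupoid \<Rightarrow> ('g, 'm) comod \<Rightarrow> ('g \<Rightarrow> complex, 'm) tens \<Rightarrow> 'm"
  where "muM G M = mult_map (CcG0 G) M \<circ> lam_tensor G M \<circ>
     inv_into (carrier (ptensor G (gtop G) (grng G) M)) (coT M) \<circ> pquot G (gtop G) (gsrc G) M"

definition functor_B :: "'g groupoid \<Rightarrow>
     (('g, 'm) comod, 'm \<Rightarrow> 'm, ('g \<Rightarrow> complex, 'm) alg_mod, 'm \<Rightarrow> 'm) functr"
  where "functor_B G = \<lparr>
     omap = (\<lambda>M. \<lparr>carrier = carrier M, mult = mult M, one = one M, zero = zero M, add = add M,
        smult = smult M,
        lact = (\<lambda>f x. if f \<in> carrier (DG G) \<and> x \<in> carrier M
           then muM G M (pure (DG G) M f x) else undefined)\<rparr>),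
     amap = (\<lambda>M N f. f)\<rparr>"

end

theory Submission
  imports Defs
begin

text \<open>Everything reduces to compact open bisections \<open>U\<close>, whose indicator functions span \<open>C\<^sub>c\<^sup>\<infinity>(G)\<close>.  Since
  both legs are injective on \<open>U\<close>, the part of \<open>C\<^sub>c\<^sup>\<infinity>(G) \<otimes>\<^sup>p M\<close> supported on \<open>U\<close> is the corner of \<open>M\<close> cut out
  by \<open>p(U)\<close>, via \<open>1\<^sub>U \<otimes> x\<close>.  Hence a \<open>C\<^sub>c\<^sup>\<infinity>(G)\<close>-linear isomorphism \<open>T\<close> amounts to bijections between corners,
  \<open>T(1\<^sub>U \<otimes> x) = 1\<^sub>U \<otimes> \<tau>\<^sub>U x\<close>, and the cocycle identity says \<open>\<tau>\<^sub>V \<tau>\<^sub>U = \<tau>\<^bsub>UV\<^esub>\<close>.  For a \<open>G\<close>-module,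
  \<open>\<tau>\<^sub>U\<close> is the action of the indicator function of the inverse of \<open>U\<close>; for a comodule, \<open>1\<^sub>U\<close> acts by the inverse
  of \<open>\<tau>\<^sub>U\<close> on these corners.  The identifications of balanced tensor products are injective because of
  local units: each has a directed family of linear maps in the other direction, and every element is
  recovered by the sufficiently large members of the family.\<close>

section \<open>Linear algebra\<close>

text \<open>Neither algebra has a unit, so no single map inverts an identification such as
  \<open>cident\<close>, and a definite description \<open>the_lin\<close> says nothing until a map
  with the prescribed values is known to exist. For \<open>cident\<close> the prescription covers
  only functions of the form \<open>ext_prod\<close>. Existence is obtained without first proving
  that functions on the fibre product form a tensor product: an element of C_c(G) \<otimes>^p M is
  determined by its traces over bisections (\<open>PG_eqI\<close>), and the trace over U of the
  element represented by k \<otimes> x has to be the restriction of k to U acting on x. Independence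
  of the way k is decomposed is then automatic. The inverse of U comes from the shear map: for a in
  U, the value e(ab) is the value at b of the convolution of e with the indicator of the inverse of
  U. The cocycle identity is at first an equation in a tensor product over pairs of arrows. Read in
  M, it controls all of V only if every arrow of V has a partner in U. Multiplicativity is therefore
  proved for bisections that fit together exactly, and extended to the others by trimming both
  factors to their composable parts.\<close>

lemma CC_simps [simp]:
  "carrier CC = UNIV" "a \<oplus>\<^bsub>CC\<^esub> b = a + b" "a \<otimes>\<^bsub>CC\<^esub> b = a * b" "\<one>\<^bsub>CC\<^esub> = 1" "\<zero>\<^bsub>CC\<^esub> = 0"
  by (simp_all add: ring_of_type_algebra_def)

lemma vspaceI:
  assumes "abelian_group V"
    and "\<And>c x. x \<in> carrier V \<Longrightarrow> c \<odot>\<^bsub>V\<^esub> x \<in> carrier V"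
    and "\<And>c d x. x \<in> carrier V \<Longrightarrow> (c + d) \<odot>\<^bsub>V\<^esub> x = c \<odot>\<^bsub>V\<^esub> x \<oplus>\<^bsub>V\<^esub> d \<odot>\<^bsub>V\<^esub> x"
    and "\<And>c x y. x \<in> carrier V \<Longrightarrow> y \<in> carrier V \<Longrightarrow> c \<odot>\<^bsub>V\<^esub> (x \<oplus>\<^bsub>V\<^esub> y) = c \<odot>\<^bsub>V\<^esub> x \<oplus>\<^bsub>V\<^esub> c \<odot>\<^bsub>V\<^esub> y"
    and "\<And>c d x. x \<in> carrier V \<Longrightarrow> (c * d) \<odot>\<^bsub>V\<^esub> x = c \<odot>\<^bsub>V\<^esub> (d \<odot>\<^bsub>V\<^esub> x)"
    and "\<And>x. x \<in> carrier V \<Longrightarrow> 1 \<odot>\<^bsub>V\<^esub> x = x"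
  shows "vspace V"
  by (rule moduleI) (use assms in \<open>auto intro: cring_from_type_algebra\<close>)

lemma vspaceD:
  assumes "vspace V"
  shows "abelian_group V"
    and "x \<in> carrier V \<Longrightarrow> c \<odot>\<^bsub>V\<^esub> x \<in> carrier V"
    and "x \<in> carrier V \<Longrightarrow> (c + d) \<odot>\<^bsub>V\<^esub> x = c \<odot>\<^bsub>V\<^esub> x \<oplus>\<^bsub>V\<^esub> d \<odot>\<^bsub>V\<^esub> x"
    and "x \<in> carrier V \<Longrightarrow> y \<in> carrier V \<Longrightarrow> c \<odot>\<^bsub>V\<^esub> (x \<oplus>\<^bsub>V\<^esub> y) = c \<odot>\<^bsub>V\<^esub> x \<oplus>\<^bsub>V\<^esub> c \<odot>\<^bsub>V\<^esub> y"
    and "x \<in> carrier V \<Longrightarrow> (c * d) \<odot>\<^bsub>V\<^esub> x = c \<odot>\<^bsub>V\<^esub> (d \<odot>\<^bsub>V\<^esub> x)"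
    and "x \<in> carrier V \<Longrightarrow> 1 \<odot>\<^bsub>V\<^esub> x = x"
    and "x \<in> carrier V \<Longrightarrow> 0 \<odot>\<^bsub>V\<^esub> x = \<zero>\<^bsub>V\<^esub>"
    and "c \<odot>\<^bsub>V\<^esub> \<zero>\<^bsub>V\<^esub> = \<zero>\<^bsub>V\<^esub>"
proof -
  interpret module CC V by fact
  show "abelian_group V" by (rule M.abelian_group_axioms)
  show "x \<in> carrier V \<Longrightarrow> c \<odot>\<^bsub>V\<^esub> x \<in> carrier V"
    "x \<in> carrier V \<Longrightarrow> (c + d) \<odot>\<^bsub>V\<^esub> x = c \<odot>\<^bsub>V\<^esub> x \<oplus>\<^bsub>V\<^esub> d \<odot>\<^bsub>V\<^esub> x"
    "x \<in> carrier V \<Longrightarrow> y \<in> carrier V \<Longrightarrow> c \<odot>\<^bsub>V\<^esub> (x \<oplus>\<^bsub>V\<^esub> y) = c \<odot>\<^bsub>V\<^esub> x \<oplus>\<^bsub>V\<^esub> c \<odot>\<^bsub>V\<^esub> y"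
    "x \<in> carrier V \<Longrightarrow> (c * d) \<odot>\<^bsub>V\<^esub> x = c \<odot>\<^bsub>V\<^esub> (d \<odot>\<^bsub>V\<^esub> x)"
    "x \<in> carrier V \<Longrightarrow> 1 \<odot>\<^bsub>V\<^esub> x = x" "x \<in> carrier V \<Longrightarrow> 0 \<odot>\<^bsub>V\<^esub> x = \<zero>\<^bsub>V\<^esub>"
    "c \<odot>\<^bsub>V\<^esub> \<zero>\<^bsub>V\<^esub> = \<zero>\<^bsub>V\<^esub>"
    using smult_closed[of c x] smult_l_distr[of c d x] smult_r_distr[of c x y]
      smult_assoc1[of c d x] smult_one[of x] smult_l_null[of x] smult_r_null[of c] by auto
qed

text \<open>Linearity without the extensionality demanded by \<open>lin\<close>, so that composites
  and pointwise sums need not be restricted to the carrier.\<close>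

definition linmap :: "(complex, 'v, 'z) module_scheme \<Rightarrow> (complex, 'w, 'y) module_scheme \<Rightarrow> ('v \<Rightarrow> 'w) \<Rightarrow> bool"
  where "linmap V W f \<longleftrightarrow> (\<forall>x\<in>carrier V. f x \<in> carrier W) \<and>
     (\<forall>x\<in>carrier V. \<forall>y\<in>carrier V. f (x \<oplus>\<^bsub>V\<^esub> y) = f x \<oplus>\<^bsub>W\<^esub> f y) \<and>
     (\<forall>c. \<forall>x\<in>carrier V. f (c \<odot>\<^bsub>V\<^esub> x) = c \<odot>\<^bsub>W\<^esub> f x)"

lemma linmapI [intro?]:
  assumes "\<And>x. x \<in> carrier V \<Longrightarrow> f x \<in> carrier W"
    and "\<And>x y. x \<in> carrier V \<Longrightarrow> y \<in> carrier V \<Longrightarrow> f (x \<oplus>\<^bsub>V\<^esub> y) = f x \<oplus>\<^bsub>W\<^esub> f y"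
    and "\<And>c x. x \<in> carrier V \<Longrightarrow> f (c \<odot>\<^bsub>V\<^esub> x) = c \<odot>\<^bsub>W\<^esub> f x"
  shows "linmap V W f"
  using assms by (auto simp: linmap_def)

lemma linmapD:
  assumes "linmap V W f"
  shows "x \<in> carrier V \<Longrightarrow> f x \<in> carrier W"
    and "x \<in> carrier V \<Longrightarrow> y \<in> carrier V \<Longrightarrow> f (x \<oplus>\<^bsub>V\<^esub> y) = f x \<oplus>\<^bsub>W\<^esub> f y"
    and "x \<in> carrier V \<Longrightarrow> f (c \<odot>\<^bsub>V\<^esub> x) = c \<odot>\<^bsub>W\<^esub> f x"
  using assms by (auto simp: linmap_def)

lemma lin_iff: "f \<in> lin V W \<longleftrightarrow> linmap V W f \<and> f \<in> extensional (carrier V)"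
  by (auto simp: lin_def linmap_def PiE_def)

lemma lin_linmap: "f \<in> lin V W \<Longrightarrow> linmap V W f"
  by (simp add: lin_iff)

lemma linmap_restrict:
  assumes "vspace V" shows "linmap V W (restrict f (carrier V)) \<longleftrightarrow> linmap V W f"
proof -
  interpret abelian_group V using assms by (rule vspaceD)
  show ?thesis using assms by (auto simp: linmap_def vspaceD(2))
qed

lemma restrict_in_lin:
  assumes "vspace V" "linmap V W f" shows "restrict f (carrier V) \<in> lin V W"
  using assms by (simp add: lin_iff linmap_restrict)

lemma linmap_comp:
  assumes "linmap V W f" "linmap W Z g" shows "linmap V Z (g \<circ> f)"
  using assms by (auto simp: linmap_def)

lemma linmap_zero:
  assumes "vspace V" "vspace W" "linmap V W f" shows "f \<zero>\<^bsub>V\<^esub> = \<zero>\<^bsub>W\<^esub>"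
proof -
  interpret V: module CC V by fact
  interpret W: module CC W by fact
  have "f (0 \<odot>\<^bsub>V\<^esub> \<zero>\<^bsub>V\<^esub>) = 0 \<odot>\<^bsub>W\<^esub> f \<zero>\<^bsub>V\<^esub>" by (rule linmapD(3)[OF assms(3)]) simp
  then show ?thesis using V.smult_l_null W.smult_l_null linmapD(1)[OF assms(3)] by simp
qed

lemma vspace_minus:
  assumes "vspace V" "x \<in> carrier V" shows "\<ominus>\<^bsub>V\<^esub> x = (-1) \<odot>\<^bsub>V\<^esub> x"
proof -
  interpret V: module CC V by fact
  have "1 \<odot>\<^bsub>V\<^esub> x = x" using V.smult_one assms by simp
  moreover have "(-1) \<odot>\<^bsub>V\<^esub> x \<oplus>\<^bsub>V\<^esub> 1 \<odot>\<^bsub>V\<^esub> x = \<zero>\<^bsub>V\<^esub>"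
    using V.smult_l_distr[of "-1" 1 x] V.smult_l_null assms by simp
  moreover have "(-1) \<odot>\<^bsub>V\<^esub> x \<in> carrier V" using V.smult_closed assms by simp
  ultimately show ?thesis using assms(2) by (metis V.minus_equality)
qed

lemma vspace_minus_eq_zero:
  assumes "vspace V" "x \<in> carrier V" "y \<in> carrier V" shows "x \<ominus>\<^bsub>V\<^esub> y = \<zero>\<^bsub>V\<^esub> \<longleftrightarrow> x = y"
proof -
  interpret V: module CC V by fact
  show ?thesis using assms(2,3)
    by (metis a_minus_def V.add.inv_closed V.minus_equality V.minus_minus V.r_neg)
qed

lemma linmap_minus:
  assumes "vspace V" "vspace W" "linmap V W f" "x \<in> carrier V" "y \<in> carrier V"
  shows "f (x \<ominus>\<^bsub>V\<^esub> y) = f x \<ominus>\<^bsub>W\<^esub> f y"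
proof -
  interpret V: module CC V by fact
  have c: "(-1) \<odot>\<^bsub>V\<^esub> y \<in> carrier V" by (rule vspaceD(2)) fact+
  have "f (x \<ominus>\<^bsub>V\<^esub> y) = f (x \<oplus>\<^bsub>V\<^esub> (-1) \<odot>\<^bsub>V\<^esub> y)"
    unfolding a_minus_def vspace_minus[OF assms(1,5)] ..
  also have "\<dots> = f x \<oplus>\<^bsub>W\<^esub> (-1) \<odot>\<^bsub>W\<^esub> f y"
    unfolding linmapD(2)[OF assms(3,4) c] linmapD(3)[OF assms(3,5)] ..
  also have "\<dots> = f x \<ominus>\<^bsub>W\<^esub> f y"
    unfolding a_minus_def vspace_minus[OF assms(2) linmapD(1)[OF assms(3,5)]] ..
  finally show ?thesis .
qed

lemma the_linI:
  assumes "F \<in> lin V W" "P F" "\<And>F'. F' \<in> lin V W \<Longrightarrow> P F' \<Longrightarrow> F' = F"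
  shows "the_lin V W P = F"
  unfolding the_lin_def using assms by blast

lemma lin_eqI:
  assumes "f \<in> lin V W" "g \<in> lin V W" "\<And>x. x \<in> carrier V \<Longrightarrow> f x = g x" shows "f = g"
  using assms by (metis lin_iff extensionalityI)

subsection \<open>Quotients\<close>

lemma submodule_lspan:
  assumes "vspace V" "S \<subseteq> carrier V"
  shows "submodule (lspan V S) CC V"
proof -
  interpret V: module CC V by fact
  have c: "submodule (carrier V) CC V" by (rule V.carrier_is_submodule)
  show ?thesis
    unfolding lspan_def hull_def
  proof (rule V.submoduleI, goal_cases)
    case 1 then show ?case using c assms(2) by auto
  next
    case 2 then show ?case
      by (auto dest!: submodule.axioms(1) subgroup.one_closed)
  next
    case 3 then show ?case using V.submoduleE(3) by auto
  next
    case 4 then show ?case using V.submoduleE(5) by auto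
  next
    case 5 then show ?case using V.submoduleE(4) by auto
  qed
qed

text \<open>The kernel of \<open>f\<close> is a submodule containing \<open>S\<close>, and the span
  is the least such submodule.\<close>

lemma linmap_vanishes_lspan:
  assumes V: "vspace V" and W: "vspace W" and S: "S \<subseteq> carrier V" and f: "linmap V W f"
    and 0: "\<And>s. s \<in> S \<Longrightarrow> f s = \<zero>\<^bsub>W\<^esub>" and x: "x \<in> lspan V S"
  shows "f x = \<zero>\<^bsub>W\<^esub>"
proof -
  interpret V: module CC V by fact
  interpret W: module CC W by fact
  have "submodule {x \<in> carrier V. f x = \<zero>\<^bsub>W\<^esub>} CC V"
  proof (rule V.submoduleI, goal_cases)
    case (3 a) then show ?case using V.smult_closed[of "-1" a] W.smult_r_null[of "-1"]
      by (simp add: vspace_minus[OF V] linmapD[OF f])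
  next
    case 2 then show ?case using linmap_zero[OF V W f] by simp
  next
    case (5 a x) then show ?case using V.smult_closed W.smult_r_null by (simp add: linmapD[OF f])
  qed (auto simp: linmapD[OF f])
  then have "lspan V S \<subseteq> {x \<in> carrier V. f x = \<zero>\<^bsub>W\<^esub>}"
    unfolding lspan_def by (intro hull_minimal) (use S 0 in auto)
  with x show ?thesis by auto
qed

locale vquot =
  fixes V :: "(complex, 'v, 'z) module_scheme" and S :: "'v set"
  assumes vsp: "vspace V" and rels: "S \<subseteq> carrier V"
begin

interpretation V: module CC V by (rule vsp)

interpretation H: submodule "lspan V S" CC V by (rule submodule_lspan[OF vsp rels])

interpretation H: abelian_subgroup "lspan V S" V
  by (rule abelian_subgroupI3) (auto intro: additive_subgroupI H.subgroup_axioms V.abelian_group_axioms)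

lemma qmap_closed: "x \<in> carrier V \<Longrightarrow> qmap V S x \<in> carrier (quot V S)"
  by (auto simp: quot_def qmap_def intro: V.a_rcosetsI[OF H.a_subset])

lemma qmap_surj:
  assumes "A \<in> carrier (quot V S)" obtains x where "x \<in> carrier V" "A = qmap V S x"
  using assms by (auto simp: quot_def qmap_def A_RCOSETS_def')

lemma qmap_add:
  "x \<in> carrier V \<Longrightarrow> y \<in> carrier V \<Longrightarrow> qmap V S (x \<oplus>\<^bsub>V\<^esub> y) = qmap V S x \<oplus>\<^bsub>quot V S\<^esub> qmap V S y"
  by (simp add: quot_def qmap_def H.a_rcos_sum)

lemma qmap_eq_iff:
  assumes "x \<in> carrier V" "y \<in> carrier V"
  shows "qmap V S x = qmap V S y \<longleftrightarrow> x \<ominus>\<^bsub>V\<^esub> y \<in> lspan V S"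
proof -
  have "x \<ominus>\<^bsub>V\<^esub> y \<in> lspan V S \<longleftrightarrow> x \<in> qmap V S y"
    unfolding qmap_def using H.a_rcos_module_minus[OF _ assms(2,1)] V.abelian_group_axioms
    by (metis H.a_rcos_module H.a_Hcarr a_minus_def assms)
  then show ?thesis unfolding qmap_def
    using assms H.a_rcos_self V.a_repr_independence H.subgroup_axioms
    by (metis H.a_repr_independence')
qed

lemma qmap_smult:
  assumes "x \<in> carrier V"
  shows "qmap V S (c \<odot>\<^bsub>V\<^esub> x) = c \<odot>\<^bsub>quot V S\<^esub> qmap V S x"
proof -
  have self: "x \<in> lspan V S +>\<^bsub>V\<^esub> x" using assms by (simp add: H.a_rcos_self)
  \<comment> \<open>A scalar multiple of a coset is defined as a union over all representatives; all
    the cosets in that union coincide.\<close>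
  have "lspan V S +>\<^bsub>V\<^esub> (c \<odot>\<^bsub>V\<^esub> a) = lspan V S +>\<^bsub>V\<^esub> (c \<odot>\<^bsub>V\<^esub> x)" if "a \<in> lspan V S +>\<^bsub>V\<^esub> x" for a
  proof -
    from that obtain h where h: "h \<in> lspan V S" "a = h \<oplus>\<^bsub>V\<^esub> x"
      by (auto simp: a_r_coset_def')
    have hc: "h \<in> carrier V" "c \<odot>\<^bsub>V\<^esub> x \<in> carrier V" "c \<odot>\<^bsub>V\<^esub> h \<in> lspan V S"
      using h H.a_Hcarr V.smult_closed[of c x] H.smult_closed[of c h] assms by auto
    have "c \<odot>\<^bsub>V\<^esub> a = c \<odot>\<^bsub>V\<^esub> h \<oplus>\<^bsub>V\<^esub> c \<odot>\<^bsub>V\<^esub> x"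
      using h hc V.smult_r_distr[of c h x] assms by simp
    then have "c \<odot>\<^bsub>V\<^esub> a \<in> lspan V S +>\<^bsub>V\<^esub> (c \<odot>\<^bsub>V\<^esub> x)"
      using hc by (auto simp: a_r_coset_def')
    then show ?thesis using hc(2) by (metis H.a_repr_independence')
  qed
  then have "(\<Union>a\<in>lspan V S +>\<^bsub>V\<^esub> x. lspan V S +>\<^bsub>V\<^esub> (c \<odot>\<^bsub>V\<^esub> a)) = lspan V S +>\<^bsub>V\<^esub> (c \<odot>\<^bsub>V\<^esub> x)"
    by (intro SUP_eq_const) (use self in blast)+
  then show ?thesis by (simp add: quot_def qmap_def)
qed

lemma qmap_zero: "qmap V S \<zero>\<^bsub>V\<^esub> = \<zero>\<^bsub>quot V S\<^esub>"
  using V.a_coset_add_zero[OF H.a_subset] by (simp add: quot_def qmap_def)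

lemma vspace_quot: "vspace (quot V S)"
proof -
  have *: "(\<And>v. v \<in> carrier V \<Longrightarrow> P (qmap V S v)) \<Longrightarrow> x \<in> carrier (quot V S) \<Longrightarrow> P x" for P x
    by (elim qmap_surj) simp
  note [simp] = qmap_closed vspaceD[OF vsp]
  note [simp] = qmap_add[symmetric] qmap_smult[symmetric] qmap_zero[symmetric]
  have "abelian_group (quot V S)"
  proof (rule abelian_groupI)
    show "\<And>x y. x \<in> carrier (quot V S) \<Longrightarrow> y \<in> carrier (quot V S) \<Longrightarrow> x \<oplus>\<^bsub>quot V S\<^esub> y \<in> carrier (quot V S)"
      by (elim qmap_surj) simp
    show "\<And>x y z. x \<in> carrier (quot V S) \<Longrightarrow> y \<in> carrier (quot V S) \<Longrightarrow> z \<in> carrier (quot V S) \<Longrightarrow>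
      x \<oplus>\<^bsub>quot V S\<^esub> y \<oplus>\<^bsub>quot V S\<^esub> z = x \<oplus>\<^bsub>quot V S\<^esub> (y \<oplus>\<^bsub>quot V S\<^esub> z)"
      by (elim qmap_surj) (simp add: V.a_assoc)
    show "\<And>x y. x \<in> carrier (quot V S) \<Longrightarrow> y \<in> carrier (quot V S) \<Longrightarrow> x \<oplus>\<^bsub>quot V S\<^esub> y = y \<oplus>\<^bsub>quot V S\<^esub> x"
      by (elim qmap_surj) (simp add: V.a_comm)
    show "\<zero>\<^bsub>quot V S\<^esub> \<in> carrier (quot V S)" by simp
    show "\<And>x. x \<in> carrier (quot V S) \<Longrightarrow> \<zero>\<^bsub>quot V S\<^esub> \<oplus>\<^bsub>quot V S\<^esub> x = x" by (elim qmap_surj) simp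
    show "\<exists>y\<in>carrier (quot V S). y \<oplus>\<^bsub>quot V S\<^esub> x = \<zero>\<^bsub>quot V S\<^esub>" if "x \<in> carrier (quot V S)" for x
    proof -
      from that obtain v where v: "v \<in> carrier V" "x = qmap V S v" by (rule qmap_surj)
      then show ?thesis by (intro bexI[of _ "qmap V S (\<ominus>\<^bsub>V\<^esub> v)"]) (simp_all add: V.l_neg)
    qed
  qed
  then show ?thesis
  proof (rule vspaceI)
    show "\<And>c x. x \<in> carrier (quot V S) \<Longrightarrow> c \<odot>\<^bsub>quot V S\<^esub> x \<in> carrier (quot V S)"
      by (elim qmap_surj) simp
    show "\<And>c d x. x \<in> carrier (quot V S) \<Longrightarrow>
      (c + d) \<odot>\<^bsub>quot V S\<^esub> x = c \<odot>\<^bsub>quot V S\<^esub> x \<oplus>\<^bsub>quot V S\<^esub> d \<odot>\<^bsub>quot V S\<^esub> x"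
      by (elim qmap_surj) simp
    show "\<And>c x y. x \<in> carrier (quot V S) \<Longrightarrow> y \<in> carrier (quot V S) \<Longrightarrow>
      c \<odot>\<^bsub>quot V S\<^esub> (x \<oplus>\<^bsub>quot V S\<^esub> y) = c \<odot>\<^bsub>quot V S\<^esub> x \<oplus>\<^bsub>quot V S\<^esub> c \<odot>\<^bsub>quot V S\<^esub> y"
      by (elim qmap_surj) simp
    show "\<And>c d x. x \<in> carrier (quot V S) \<Longrightarrow>
      (c * d) \<odot>\<^bsub>quot V S\<^esub> x = c \<odot>\<^bsub>quot V S\<^esub> (d \<odot>\<^bsub>quot V S\<^esub> x)"
      by (elim qmap_surj) simp
    show "\<And>x. x \<in> carrier (quot V S) \<Longrightarrow> 1 \<odot>\<^bsub>quot V S\<^esub> x = x" by (elim qmap_surj) simp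
  qed
qed

lemma qmap_rel: "x \<in> carrier V \<Longrightarrow> y \<in> carrier V \<Longrightarrow> x \<ominus>\<^bsub>V\<^esub> y \<in> S \<Longrightarrow> qmap V S x = qmap V S y"
  using qmap_eq_iff hull_subset[of S "\<lambda>H. submodule H CC V"] by (auto simp: lspan_def)

text \<open>Two representatives of a class differ by an element of the span, where \<open>f\<close>
  vanishes. Hence the value at an arbitrarily chosen representative is a well-defined lift.\<close>

lemma quot_lift:
  assumes W: "vspace W" and f: "linmap V W f" and 0: "\<And>s. s \<in> S \<Longrightarrow> f s = \<zero>\<^bsub>W\<^esub>"
  obtains F where "linmap (quot V S) W F" "\<And>x. x \<in> carrier V \<Longrightarrow> F (qmap V S x) = f x"
proof -
  have wd: "f x = f y" if "x \<in> carrier V" "y \<in> carrier V" "qmap V S x = qmap V S y" for x y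
  proof -
    have "f (x \<ominus>\<^bsub>V\<^esub> y) = \<zero>\<^bsub>W\<^esub>"
      by (rule linmap_vanishes_lspan[OF vsp W rels f 0]) (use that qmap_eq_iff in auto)
    then show ?thesis
      using that by (simp add: linmap_minus[OF vsp W f] vspace_minus_eq_zero[OF W] linmapD[OF f])
  qed
  define F where "F A = f (SOME x. x \<in> carrier V \<and> A = qmap V S x)" for A
  have F: "F (qmap V S x) = f x" if "x \<in> carrier V" for x
    unfolding F_def by (rule wd[OF _ that]) (use someI_ex[of "\<lambda>y. y \<in> carrier V \<and> qmap V S x = qmap V S y"] that in auto)
  have "linmap (quot V S) W F"
  proof (rule linmapI, goal_cases)
    case (1 x) then show ?case by (auto elim!: qmap_surj simp: F linmapD[OF f])
  next
    case (2 x y) then show ?case by (auto elim!: qmap_surj simp: F linmapD[OF f] simp flip: qmap_add)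
  next
    case (3 c x) then show ?case using V.smult_closed[of c]
      by (auto elim!: qmap_surj simp: F linmapD[OF f] simp flip: qmap_smult)
  qed
  then show ?thesis using F that by blast
qed

end

subsection \<open>Tensor products\<close>

lemma free_vs_simps [simp]:
  "carrier (free_vs A) = {\<phi>. finite {a. \<phi> a \<noteq> 0} \<and> {a. \<phi> a \<noteq> 0} \<subseteq> A}"
  "\<zero>\<^bsub>free_vs A\<^esub> = (\<lambda>_. 0)" "\<phi> \<oplus>\<^bsub>free_vs A\<^esub> \<psi> = (\<lambda>a. \<phi> a + \<psi> a)" "c \<odot>\<^bsub>free_vs A\<^esub> \<phi> = (\<lambda>a. c * \<phi> a)"
  by (simp_all add: free_vs_def)

lemma vspace_free_vs: "vspace (free_vs A)"
proof (rule vspaceI, rule abelian_groupI, goal_cases)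
  case (1 x y)
  have "{a. x a + y a \<noteq> 0} \<subseteq> {a. x a \<noteq> 0} \<union> {a. y a \<noteq> 0}" by auto
  with 1 show ?case by simp (meson finite_Un finite_subset le_sup_iff order_trans)
next
  case (6 x) then show ?case by (intro bexI[of _ "\<lambda>a. - x a"]) auto
next
  case (7 c x)
  have "{a. c * x a \<noteq> 0} \<subseteq> {a. x a \<noteq> 0}" by auto
  with 7 show ?case by simp (meson finite_subset order_trans)
qed (auto simp: algebra_simps)

lemma free_gen_closed: "a \<in> A \<Longrightarrow> free_gen a \<in> carrier (free_vs A)"
  by (auto simp: free_gen_def)

text \<open>The induction runs over a finite set containing the support rather than over the support
  itself, because the point removed may already carry the value zero.\<close>

lemma free_vs_induct [consumes 1, case_names zero gen]:
  assumes "\<phi> \<in> carrier (free_vs A)" "P (\<lambda>_. 0)"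
    and "\<And>c a \<phi>. a \<in> A \<Longrightarrow> \<phi> \<in> carrier (free_vs A) \<Longrightarrow> P \<phi> \<Longrightarrow> P (c \<odot>\<^bsub>free_vs A\<^esub> free_gen a \<oplus>\<^bsub>free_vs A\<^esub> \<phi>)"
  shows "P \<phi>"
proof -
  have *: "finite B \<Longrightarrow> B \<subseteq> A \<Longrightarrow> {a. \<phi> a \<noteq> 0} \<subseteq> B \<Longrightarrow> P \<phi>" for B \<phi>
  proof (induction B arbitrary: \<phi> rule: finite_induct)
    case empty then have "\<phi> = (\<lambda>_. 0)" by auto
    then show ?case using assms(2) by simp
  next
    case (insert b B)
    let ?\<psi> = "\<phi>(b := 0)"
    have sub: "{a. ?\<psi> a \<noteq> 0} \<subseteq> B" using insert.prems(2) by auto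
    have fin: "finite {a. ?\<psi> a \<noteq> 0}" using sub insert.hyps(1) by (rule finite_subset)
    have "P ?\<psi>" using insert.IH[of ?\<psi>] sub insert.prems(1) by blast
    moreover have "?\<psi> \<in> carrier (free_vs A)" using sub fin insert.prems(1) by (simp del: fun_upd_apply) blast
    ultimately have "P (\<phi> b \<odot>\<^bsub>free_vs A\<^esub> free_gen b \<oplus>\<^bsub>free_vs A\<^esub> ?\<psi>)"
      using assms(3)[of b ?\<psi> "\<phi> b"] insert.prems(1) by blast
    also have "\<phi> b \<odot>\<^bsub>free_vs A\<^esub> free_gen b \<oplus>\<^bsub>free_vs A\<^esub> ?\<psi> = \<phi>" by (auto simp: free_gen_def)
    finally show ?case .
  qed
  show ?thesis using *[of "{a. \<phi> a \<noteq> 0}" \<phi>] assms(1) by simp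
qed

lemma free_vs_lift:
  assumes Z: "vspace Z" and g: "\<And>a. a \<in> A \<Longrightarrow> g a \<in> carrier Z"
  obtains F where "linmap (free_vs A) Z F" "\<And>a. a \<in> A \<Longrightarrow> F (free_gen a) = g a"
proof -
  interpret Z: module CC Z by fact
  note [simp] = vspaceD[OF Z] g
  define F where "F \<phi> = finsum Z (\<lambda>a. \<phi> a \<odot>\<^bsub>Z\<^esub> g a) {a. \<phi> a \<noteq> 0}" for \<phi>
  \<comment> \<open>Any finite set containing the support may serve as index set, so that two
    functions can be summed over a common one.\<close>
  have F: "F \<phi> = finsum Z (\<lambda>a. \<phi> a \<odot>\<^bsub>Z\<^esub> g a) B"
    if "{a. \<phi> a \<noteq> 0} \<subseteq> B" "finite B" "B \<subseteq> A" for \<phi> B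
    unfolding F_def by (rule Z.add.finprod_mono_neutral_cong_left) (use that in auto)
  have "linmap (free_vs A) Z F"
  proof (rule linmapI, goal_cases)
    case (1 \<phi>) then show ?case unfolding F_def by (intro Z.finsum_closed) auto
  next
    case (2 \<phi> \<psi>)
    let ?B = "{a. \<phi> a \<noteq> 0} \<union> {a. \<psi> a \<noteq> 0}"
    have B: "finite ?B" "?B \<subseteq> A" using 2 by auto
    have "F (\<lambda>a. \<phi> a + \<psi> a) = finsum Z (\<lambda>a. (\<phi> a + \<psi> a) \<odot>\<^bsub>Z\<^esub> g a) ?B"
      by (rule F[OF _ B]) auto
    also have "\<dots> = finsum Z (\<lambda>a. \<phi> a \<odot>\<^bsub>Z\<^esub> g a \<oplus>\<^bsub>Z\<^esub> \<psi> a \<odot>\<^bsub>Z\<^esub> g a) ?B"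
      by (rule Z.finsum_cong') (use B in auto)
    also have "\<dots> = finsum Z (\<lambda>a. \<phi> a \<odot>\<^bsub>Z\<^esub> g a) ?B \<oplus>\<^bsub>Z\<^esub> finsum Z (\<lambda>a. \<psi> a \<odot>\<^bsub>Z\<^esub> g a) ?B"
      by (rule Z.finsum_addf) (use B in auto)
    also have "\<dots> = F \<phi> \<oplus>\<^bsub>Z\<^esub> F \<psi>" using F[OF _ B, of \<phi>] F[OF _ B, of \<psi>] by auto
    finally show ?case by simp
  next
    case (3 c \<phi>)
    let ?B = "{a. \<phi> a \<noteq> 0}"
    have B: "finite ?B" "?B \<subseteq> A" using 3 by auto
    have "F (\<lambda>a. c * \<phi> a) = finsum Z (\<lambda>a. (c * \<phi> a) \<odot>\<^bsub>Z\<^esub> g a) ?B"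
      by (rule F[OF _ B]) auto
    also have "\<dots> = finsum Z (\<lambda>a. c \<odot>\<^bsub>Z\<^esub> (\<phi> a \<odot>\<^bsub>Z\<^esub> g a)) ?B"
      by (rule Z.finsum_cong') (use B in auto)
    also have "\<dots> = c \<odot>\<^bsub>Z\<^esub> F \<phi>" unfolding F_def
      by (subst Z.finsum_smult_ldistr) (use B in auto)
    finally show ?case by simp
  qed
  moreover have "F (free_gen a) = g a" if "a \<in> A" for a
    using F[of "free_gen a" "{a}"] that by (simp add: free_gen_def)
  ultimately show ?thesis using that by blast
qed

section \<open>Bilinear maps and tensor products over the complex numbers\<close>

definition bilin :: "(complex, 'v, 'z) module_scheme \<Rightarrow> (complex, 'w, 'y) module_scheme \<Rightarrow>
     (complex, 'u, 'x) module_scheme \<Rightarrow> ('v \<Rightarrow> 'w \<Rightarrow> 'u) \<Rightarrow> bool"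
  where "bilin V W Z \<beta> \<longleftrightarrow> (\<forall>v\<in>carrier V. linmap W Z (\<beta> v)) \<and> (\<forall>w\<in>carrier W. linmap V Z (\<lambda>v. \<beta> v w))"

lemma bilinI:
  assumes "\<And>v. v \<in> carrier V \<Longrightarrow> linmap W Z (\<beta> v)" "\<And>w. w \<in> carrier W \<Longrightarrow> linmap V Z (\<lambda>v. \<beta> v w)"
  shows "bilin V W Z \<beta>"
  using assms by (auto simp: bilin_def)

lemma bilinD:
  assumes "bilin V W Z \<beta>"
  shows "v \<in> carrier V \<Longrightarrow> w \<in> carrier W \<Longrightarrow> \<beta> v w \<in> carrier Z"
    and "v \<in> carrier V \<Longrightarrow> v' \<in> carrier V \<Longrightarrow> w \<in> carrier W \<Longrightarrow> \<beta> (v \<oplus>\<^bsub>V\<^esub> v') w = \<beta> v w \<oplus>\<^bsub>Z\<^esub> \<beta> v' w"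
    and "v \<in> carrier V \<Longrightarrow> w \<in> carrier W \<Longrightarrow> w' \<in> carrier W \<Longrightarrow> \<beta> v (w \<oplus>\<^bsub>W\<^esub> w') = \<beta> v w \<oplus>\<^bsub>Z\<^esub> \<beta> v w'"
    and "v \<in> carrier V \<Longrightarrow> w \<in> carrier W \<Longrightarrow> \<beta> (c \<odot>\<^bsub>V\<^esub> v) w = c \<odot>\<^bsub>Z\<^esub> \<beta> v w"
    and "v \<in> carrier V \<Longrightarrow> w \<in> carrier W \<Longrightarrow> \<beta> v (c \<odot>\<^bsub>W\<^esub> w) = c \<odot>\<^bsub>Z\<^esub> \<beta> v w"
  using assms by (auto simp: bilin_def linmap_def)

locale two_vspaces =
  fixes V :: "(complex, 'v, 'z) module_scheme" and W :: "(complex, 'w, 'y) module_scheme"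
  assumes vspV: "vspace V" and vspW: "vspace W"
begin

interpretation V: module CC V by (rule vspV)
interpretation W: module CC W by (rule vspW)

abbreviation (input) "FF \<equiv> free_vs (carrier V \<times> carrier W)"
abbreviation (input) "ee v w \<equiv> free_gen (v, w) :: _ \<Rightarrow> complex"

lemma ee_closed: "v \<in> carrier V \<Longrightarrow> w \<in> carrier W \<Longrightarrow> ee v w \<in> carrier FF"
  by (rule free_gen_closed) simp

interpretation FF: module CC FF by (rule vspace_free_vs)

lemma FF_closed:
  "x \<in> carrier FF \<Longrightarrow> y \<in> carrier FF \<Longrightarrow> x \<oplus>\<^bsub>FF\<^esub> y \<in> carrier FF" 
  "x \<in> carrier FF \<Longrightarrow> c \<odot>\<^bsub>FF\<^esub> x \<in> carrier FF" 
  "x \<in> carrier FF \<Longrightarrow> y \<in> carrier FF \<Longrightarrow> x \<ominus>\<^bsub>FF\<^esub> y \<in> carrier FF" 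
  by (rule FF.add.m_closed vspaceD(2)[OF vspace_free_vs] FF.minus_closed; assumption)+

lemma bilin_rels_closed: "bilin_rels V W \<subseteq> carrier FF"
  unfolding bilin_rels_def Let_def
  using V.add.m_closed W.add.m_closed vspaceD(2)[OF vspV] vspaceD(2)[OF vspW]
  by (auto intro!: FF_closed(3,2,1) ee_closed simp del: free_vs_simps)

sublocale Q: vquot FF "bilin_rels V W"
  by unfold_locales (rule vspace_free_vs bilin_rels_closed)+

lemma vspace_tensor: "vspace (tensor V W)"
  unfolding tensor_def by (rule Q.vspace_quot)

lemma bilin_pure: "bilin V W (tensor V W) (pure V W)"
proof -
  have rel: "x \<ominus>\<^bsub>FF\<^esub> y \<in> bilin_rels V W \<Longrightarrow> x \<in> carrier FF \<Longrightarrow> y \<in> carrier FF \<Longrightarrow>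
      qmap FF (bilin_rels V W) x = qmap FF (bilin_rels V W) y" for x y
    by (rule Q.qmap_rel)
  note cl = V.add.m_closed W.add.m_closed vspaceD(2)[OF vspV] vspaceD(2)[OF vspW]
    ee_closed FF_closed
  show ?thesis
    unfolding tensor_def pure_def
  proof (intro bilinI linmapI, goal_cases)
    case 1 then show ?case by (intro Q.qmap_closed ee_closed)
  next
    case (2 v w w')
    show ?case
      by (subst Q.qmap_add[symmetric], (rule cl 2)+, rule rel, unfold bilin_rels_def Let_def)
         (use 2 in \<open>auto intro!: cl simp del: free_vs_simps\<close>)
  next
    case (3 v c w)
    show ?case
      by (subst Q.qmap_smult[symmetric], (rule cl 3)+, rule rel, unfold bilin_rels_def Let_def)
         (use 3 in \<open>auto intro!: cl simp del: free_vs_simps\<close>)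
  next
    case 4 then show ?case by (intro Q.qmap_closed ee_closed)
  next
    case (5 w v v')
    show ?case
      by (subst Q.qmap_add[symmetric], (rule cl 5)+, rule rel, unfold bilin_rels_def Let_def)
         (use 5 in \<open>auto intro!: cl simp del: free_vs_simps\<close>)
  next
    case (6 w c v)
    show ?case
      by (subst Q.qmap_smult[symmetric], (rule cl 6)+, rule rel, unfold bilin_rels_def Let_def)
         (use 6 in \<open>auto intro!: cl simp del: free_vs_simps\<close>)
  qed
qed

lemmas pure_simps = bilinD[OF bilin_pure]

text \<open>Scalars get no case of their own, since they are absorbed in the first factor, and zero
  is itself a pure tensor.\<close>

lemma tensor_induct [consumes 1, case_names pure add]:
  assumes "t \<in> carrier (tensor V W)"
    and p: "\<And>v w. v \<in> carrier V \<Longrightarrow> w \<in> carrier W \<Longrightarrow> P (pure V W v w)"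
    and a: "\<And>x y. x \<in> carrier (tensor V W) \<Longrightarrow> y \<in> carrier (tensor V W) \<Longrightarrow> P x \<Longrightarrow> P y \<Longrightarrow> P (x \<oplus>\<^bsub>tensor V W\<^esub> y)"
  shows "P t"
proof -
  let ?q = "qmap FF (bilin_rels V W)"
  from assms(1) obtain \<phi> where \<phi>: "\<phi> \<in> carrier FF" "t = ?q \<phi>"
    unfolding tensor_def by (rule Q.qmap_surj)
  have "P (?q \<phi>)" using \<phi>(1)
  proof (induction rule: free_vs_induct)
    case zero
    have "?q (\<lambda>_. 0) = \<zero>\<^bsub>tensor V W\<^esub>" using Q.qmap_zero by (simp add: tensor_def)
    also have "\<dots> = 0 \<odot>\<^bsub>tensor V W\<^esub> pure V W \<zero>\<^bsub>V\<^esub> \<zero>\<^bsub>W\<^esub>"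
      using vspaceD(7)[OF vspace_tensor] pure_simps(1) by simp
    also have "\<dots> = pure V W (0 \<odot>\<^bsub>V\<^esub> \<zero>\<^bsub>V\<^esub>) \<zero>\<^bsub>W\<^esub>" by (subst pure_simps(4)) auto
    finally show ?case using p vspaceD(8)[OF vspV] by simp
  next
    case (gen c a \<phi>)
    obtain v w where vw: "a = (v, w)" "v \<in> carrier V" "w \<in> carrier W" using gen(1) by auto
    have e: "ee v w \<in> carrier FF" by (rule ee_closed) fact+
    have ce: "c \<odot>\<^bsub>FF\<^esub> ee v w \<in> carrier FF" by (rule FF_closed(2)) fact
    have "?q (c \<odot>\<^bsub>FF\<^esub> ee v w \<oplus>\<^bsub>FF\<^esub> \<phi>) = pure V W (c \<odot>\<^bsub>V\<^esub> v) w \<oplus>\<^bsub>tensor V W\<^esub> ?q \<phi>"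
      unfolding Q.qmap_add[OF ce gen(2)] Q.qmap_smult[OF e] pure_simps(4)[OF vw(2,3)]
      by (simp add: tensor_def pure_def)
    moreover have "P \<dots>"
    proof (rule a)
      show "pure V W (c \<odot>\<^bsub>V\<^esub> v) w \<in> carrier (tensor V W)" "P (pure V W (c \<odot>\<^bsub>V\<^esub> v) w)"
        using vw vspaceD(2)[OF vspV] by (auto intro: pure_simps(1) p)
      show "?q \<phi> \<in> carrier (tensor V W)" unfolding tensor_def by (rule Q.qmap_closed[OF gen(2)])
    qed (fact gen(3))
    ultimately show ?case using vw(1) by simp
  qed
  with \<phi> show ?thesis by simp
qed

lemma tensor_lift:
  assumes Z: "vspace Z" and \<beta>: "bilin V W Z \<beta>"
  obtains F where "linmap (tensor V W) Z F"
    "\<And>v w. v \<in> carrier V \<Longrightarrow> w \<in> carrier W \<Longrightarrow> F (pure V W v w) = \<beta> v w"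
proof -
  interpret Z: module CC Z by fact
  obtain f where f: "linmap FF Z f" "\<And>a. a \<in> carrier V \<times> carrier W \<Longrightarrow> f (free_gen a) = (case a of (v, w) \<Rightarrow> \<beta> v w)"
    by (rule free_vs_lift[OF Z, of "carrier V \<times> carrier W" "\<lambda>(v, w). \<beta> v w"]) (auto simp: bilinD[OF \<beta>])
  have ff: "v \<in> carrier V \<Longrightarrow> w \<in> carrier W \<Longrightarrow> f (ee v w) = \<beta> v w" for v w using f(2) by simp
  note cl = V.add.m_closed W.add.m_closed vspaceD(2)[OF vspV] vspaceD(2)[OF vspW] ee_closed FF_closed
  have z: "f (x \<ominus>\<^bsub>FF\<^esub> y) = \<zero>\<^bsub>Z\<^esub>" if "x \<in> carrier FF" "y \<in> carrier FF" "f x = f y" for x y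
    unfolding linmap_minus[OF vspace_free_vs Z f(1) that(1,2)]
    using that linmapD(1)[OF f(1)] by (subst vspace_minus_eq_zero[OF Z]) auto
  have "f s = \<zero>\<^bsub>Z\<^esub>" if "s \<in> bilin_rels V W" for s
    using that unfolding bilin_rels_def Let_def
    by (auto intro!: z cl simp: linmapD[OF f(1)] ff cl bilinD[OF \<beta>] simp del: free_vs_simps)
  then obtain F where "linmap (quot FF (bilin_rels V W)) Z F"
    "\<And>x. x \<in> carrier FF \<Longrightarrow> F (qmap FF (bilin_rels V W) x) = f x"
    using Q.quot_lift[OF Z f(1)] by blast
  then show ?thesis
    by (intro that[of F]) (simp_all add: tensor_def pure_def ff ee_closed del: free_vs_simps)
qed

end

text \<open>\<open>R\<close> is a bare set of operators preserving the two carriers, so that one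
  locale covers balancing over C_c(G0), over C_c(G) acting pointwise, and over D(G) acting by
  convolution.\<close>

locale btens = two_vspaces V W
  for V :: "(complex, 'v, 'z) module_scheme" and W :: "(complex, 'w, 'y) module_scheme" +
  fixes R :: "'r set" and ra :: "'v \<Rightarrow> 'r \<Rightarrow> 'v" and la :: "'r \<Rightarrow> 'w \<Rightarrow> 'w"
  assumes ra_closed: "v \<in> carrier V \<Longrightarrow> r \<in> R \<Longrightarrow> ra v r \<in> carrier V"
    and la_closed: "r \<in> R \<Longrightarrow> w \<in> carrier W \<Longrightarrow> la r w \<in> carrier W"
begin

abbreviation (input) "BT \<equiv> btensor V W R ra la"
abbreviation (input) "bp \<equiv> bpure V W R ra la"

interpretation T: module CC "tensor V W" by (rule vspace_tensor)

lemma bal_rels_closed: "bal_rels V W R ra la \<subseteq> carrier (tensor V W)"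
  unfolding bal_rels_def by (auto intro!: T.minus_closed pure_simps(1) ra_closed la_closed)

sublocale B: vquot "tensor V W" "bal_rels V W R ra la"
  by unfold_locales (rule vspace_tensor bal_rels_closed)+

lemma vspace_btensor: "vspace BT"
  unfolding btensor_def by (rule B.vspace_quot)

lemma bilin_bpure: "bilin V W BT bp"
  unfolding bpure_def btensor_def
  by (intro bilinI linmapI; (subst pure_simps; assumption?)?)
     (auto intro!: B.qmap_closed B.qmap_add B.qmap_smult pure_simps(1))

lemmas bpure_simps = bilinD[OF bilin_bpure]

lemma bpure_bal: "v \<in> carrier V \<Longrightarrow> r \<in> R \<Longrightarrow> w \<in> carrier W \<Longrightarrow> bp (ra v r) w = bp v (la r w)"
  unfolding bpure_def by (rule B.qmap_rel) (auto simp: bal_rels_def intro!: pure_simps(1) ra_closed la_closed)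

lemma btensor_induct [consumes 1, case_names pure add]:
  assumes "t \<in> carrier BT"
    and p: "\<And>v w. v \<in> carrier V \<Longrightarrow> w \<in> carrier W \<Longrightarrow> P (bp v w)"
    and a: "\<And>x y. x \<in> carrier BT \<Longrightarrow> y \<in> carrier BT \<Longrightarrow> P x \<Longrightarrow> P y \<Longrightarrow> P (x \<oplus>\<^bsub>BT\<^esub> y)"
  shows "P t"
proof -
  let ?q = "qmap (tensor V W) (bal_rels V W R ra la)"
  from assms(1) obtain u where u: "u \<in> carrier (tensor V W)" "t = ?q u"
    unfolding btensor_def by (rule B.qmap_surj)
  have "P (?q u)" using u(1)
  proof (induction rule: tensor_induct)
    case (pure v w) then show ?case using p[of v w] by (simp add: bpure_def)
  next
    case (add x y) then show ?case
      using a[of "?q x" "?q y"] B.qmap_closed by (simp add: B.qmap_add btensor_def)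
  qed
  with u show ?thesis by simp
qed

lemma btensor_lift:
  assumes Z: "vspace Z" and \<beta>: "bilin V W Z \<beta>"
    and bal: "\<And>v r w. v \<in> carrier V \<Longrightarrow> r \<in> R \<Longrightarrow> w \<in> carrier W \<Longrightarrow> \<beta> (ra v r) w = \<beta> v (la r w)"
  obtains F where "F \<in> lin BT Z"
    "\<And>v w. v \<in> carrier V \<Longrightarrow> w \<in> carrier W \<Longrightarrow> F (bp v w) = \<beta> v w"
proof -
  obtain f where f: "linmap (tensor V W) Z f"
    "\<And>v w. v \<in> carrier V \<Longrightarrow> w \<in> carrier W \<Longrightarrow> f (pure V W v w) = \<beta> v w"
    using tensor_lift[OF Z \<beta>] by blast
  have "f s = \<zero>\<^bsub>Z\<^esub>" if "s \<in> bal_rels V W R ra la" for s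
  proof -
    from that obtain v r w where s: "v \<in> carrier V" "r \<in> R" "w \<in> carrier W"
      "s = pure V W (ra v r) w \<ominus>\<^bsub>tensor V W\<^esub> pure V W v (la r w)" by (auto simp: bal_rels_def)
    note c = ra_closed[OF s(1,2)] la_closed[OF s(2,3)]
    have e: "\<beta> v (la r w) \<in> carrier Z" using bilinD(1)[OF \<beta> s(1) c(2)] .
    have "f s = f (pure V W (ra v r) w) \<ominus>\<^bsub>Z\<^esub> f (pure V W v (la r w))"
      unfolding s(4) using s c by (intro linmap_minus[OF vspace_tensor Z f(1)] pure_simps(1))
    also have "\<dots> = \<beta> v (la r w) \<ominus>\<^bsub>Z\<^esub> \<beta> v (la r w)" using s c f(2) bal by simp
    also have "\<dots> = \<zero>\<^bsub>Z\<^esub>" using vspace_minus_eq_zero[OF Z e e] by simp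
    finally show ?thesis .
  qed
  then obtain F where F: "linmap BT Z F"
    "\<And>x. x \<in> carrier (tensor V W) \<Longrightarrow> F (qmap (tensor V W) (bal_rels V W R ra la) x) = f x"
    using B.quot_lift[OF Z f(1)] unfolding btensor_def by blast
  show ?thesis
    by (rule that[of "restrict F (carrier BT)"])
       (auto simp: restrict_in_lin[OF vspace_btensor F(1)] bpure_simps(1), auto simp: bpure_def F(2) f(2) pure_simps(1))
qed

lemma linmap_eqI:
  assumes Z: "vspace Z" and "linmap BT Z F" "linmap BT Z F'"
    and "\<And>v w. v \<in> carrier V \<Longrightarrow> w \<in> carrier W \<Longrightarrow> F (bp v w) = F' (bp v w)"
    and "t \<in> carrier BT"
  shows "F t = F' t"
  using assms(5) by (induction rule: btensor_induct) (simp_all add: assms(4) linmapD[OF assms(2)] linmapD[OF assms(3)])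

lemma lin_btensor_eqI:
  assumes "vspace Z" "F \<in> lin BT Z" "F' \<in> lin BT Z"
    and "\<And>v w. v \<in> carrier V \<Longrightarrow> w \<in> carrier W \<Longrightarrow> F (bp v w) = F' (bp v w)"
  shows "F = F'"
  by (rule lin_eqI[OF assms(2,3)], rule linmap_eqI[OF assms(1) lin_linmap[OF assms(2)] lin_linmap[OF assms(3)] assms(4)])

text \<open>This evaluates the maps that the definitions describe by their values on pure tensors:
  existence is the universal property, uniqueness holds because pure tensors generate.\<close>

lemma the_lin_btensor:
  assumes Z: "vspace Z" and \<beta>: "bilin V W Z \<beta>"
    and bal: "\<And>v r w. v \<in> carrier V \<Longrightarrow> r \<in> R \<Longrightarrow> w \<in> carrier W \<Longrightarrow> \<beta> (ra v r) w = \<beta> v (la r w)"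
  defines "F \<equiv> the_lin BT Z (\<lambda>F. \<forall>v\<in>carrier V. \<forall>w\<in>carrier W. F (bp v w) = \<beta> v w)"
  shows "F \<in> lin BT Z" "v \<in> carrier V \<Longrightarrow> w \<in> carrier W \<Longrightarrow> F (bp v w) = \<beta> v w"
proof -
  obtain F' where F': "F' \<in> lin BT Z" "\<And>v w. v \<in> carrier V \<Longrightarrow> w \<in> carrier W \<Longrightarrow> F' (bp v w) = \<beta> v w"
    using btensor_lift[OF Z \<beta> bal] by blast
  have "F = F'"
    unfolding F_def
  proof (rule the_linI[OF F'(1)], goal_cases)
    case (2 F'')
    then show ?case by (intro lin_btensor_eqI[OF Z 2(1) F'(1)]) (simp add: F'(2))
  qed (use F' in auto)
  with F' show "F \<in> lin BT Z" "v \<in> carrier V \<Longrightarrow> w \<in> carrier W \<Longrightarrow> F (bp v w) = \<beta> v w" by auto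
qed

end

section \<open>Locally constant functions with compact support\<close>

text \<open>Kept apart from compactness of the support, because a pullback such as
  \<open>h \<circ> p\<close> is locally constant but in general not compactly supported. It is still
  a legitimate multiplier of C_c.\<close>

definition loc_const :: "'x topology \<Rightarrow> ('x \<Rightarrow> 'b) \<Rightarrow> bool"
  where "loc_const E f \<longleftrightarrow> (\<forall>x\<in>topspace E. \<exists>U. openin E U \<and> x \<in> U \<and> (\<forall>y\<in>U. f y = f x))"

lemma loc_const_openin:
  assumes "loc_const E f" shows "openin E {x \<in> topspace E. P (f x)}"
proof (subst openin_subopen, safe)
  fix x assume x: "x \<in> topspace E" "P (f x)"
  then obtain U where "openin E U" "x \<in> U" "\<forall>y\<in>U. f y = f x" using assms by (auto simp: loc_const_def)
  then show "\<exists>T. openin E T \<and> x \<in> T \<and> T \<subseteq> {x \<in> topspace E. P (f x)}"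
    using x openin_subset by (intro exI[of _ U]) fastforce
qed

lemma loc_const_closedin:
  assumes "loc_const E f" shows "closedin E {x \<in> topspace E. P (f x)}"
proof -
  have "topspace E - {x \<in> topspace E. P (f x)} = {x \<in> topspace E. \<not> P (f x)}" by auto
  then show ?thesis using loc_const_openin[OF assms, of "\<lambda>y. \<not> P y"] by (auto simp: closedin_def)
qed

lemma loc_const_comp2:
  assumes "loc_const E f" "loc_const E g" shows "loc_const E (\<lambda>x. h (f x) (g x))"
  unfolding loc_const_def
proof
  fix x assume x: "x \<in> topspace E"
  obtain U where U: "openin E U" "x \<in> U" "\<forall>y\<in>U. f y = f x"
    using x assms(1) by (auto simp: loc_const_def)
  obtain V where V: "openin E V" "x \<in> V" "\<forall>y\<in>V. g y = g x"
    using x assms(2) by (auto simp: loc_const_def)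
  from U V show "\<exists>U. openin E U \<and> x \<in> U \<and> (\<forall>y\<in>U. h (f y) (g y) = h (f x) (g x))"
    by (metis IntD1 IntD2 IntI openin_Int)
qed

lemma loc_const_const: "loc_const E (\<lambda>_. c)"
  by (auto simp: loc_const_def)

lemma loc_const_compose:
  assumes "continuous_map E E' p" "loc_const E' f" shows "loc_const E (\<lambda>x. f (p x))"
  unfolding loc_const_def
proof
  fix x assume x: "x \<in> topspace E"
  then have "p x \<in> topspace E'" using assms(1) continuous_map_image_subset_topspace by fastforce
  then obtain U where U: "openin E' U" "p x \<in> U" "\<forall>y\<in>U. f y = f (p x)"
    using assms(2) by (auto simp: loc_const_def)
  then show "\<exists>U. openin E U \<and> x \<in> U \<and> (\<forall>y\<in>U. f (p y) = f (p x))"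
    using x openin_continuous_map_preimage[OF assms(1) U(1)]
    by (metis (no_types, lifting) mem_Collect_eq)
qed

text \<open>The set where a locally constant function is nonzero is already closed, so the closure
  in the definition of the support disappears.\<close>

lemma CcInf_iff:
  "f \<in> CcInf E \<longleftrightarrow> (\<forall>x. x \<notin> topspace E \<longrightarrow> f x = 0) \<and> loc_const E f \<and> compactin E {x. f x \<noteq> 0}"
proof -
  have "Abstract_Topology.closure_of E {x \<in> topspace E. f x \<noteq> 0} = {x. f x \<noteq> 0}"
    if "\<forall>x. x \<notin> topspace E \<longrightarrow> f x = 0" "loc_const E f"
  proof -
    have "{x \<in> topspace E. f x \<noteq> 0} = {x. f x \<noteq> 0}" using that(1) by auto
    then show ?thesis using loc_const_closedin[OF that(2), of "\<lambda>y. y \<noteq> 0"]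
      by (simp add: closure_of_closedin)
  qed
  then show ?thesis by (auto simp: CcInf_def loc_const_def)
qed

lemma CcInf_zero_off: "f \<in> CcInf E \<Longrightarrow> x \<notin> topspace E \<Longrightarrow> f x = 0"
  by (simp add: CcInf_iff)

lemma CcInf_supp: "f \<in> CcInf E \<Longrightarrow> f x \<noteq> 0 \<Longrightarrow> x \<in> topspace E"
  by (auto simp: CcInf_iff)

lemma CcInf_loc_const: "f \<in> CcInf E \<Longrightarrow> loc_const E f"
  by (simp add: CcInf_iff)

text \<open>Closedness is recorded because the general lemmas do not assume a Hausdorff space; where
  there is one, \<open>copenI\<close> supplies it from compactness.\<close>

definition copen :: "'x topology \<Rightarrow> 'x set \<Rightarrow> bool"
  where "copen E U \<longleftrightarrow> openin E U \<and> closedin E U \<and> compactin E U"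

lemma copenI: "Hausdorff_space E \<Longrightarrow> openin E U \<Longrightarrow> compactin E U \<Longrightarrow> copen E U"
  by (simp add: copen_def compactin_imp_closedin)

lemma copen_subset: "copen E U \<Longrightarrow> U \<subseteq> topspace E"
  by (simp add: copen_def openin_subset)

lemma copen_empty: "copen E {}" by (simp add: copen_def)

lemma copen_clopen_Int: "copen E U \<Longrightarrow> openin E V \<Longrightarrow> closedin E V \<Longrightarrow> copen E (U \<inter> V)"
  by (simp add: copen_def openin_Int closedin_Int compact_Int_closedin)

lemma copen_Int: "copen E U \<Longrightarrow> copen E V \<Longrightarrow> copen E (U \<inter> V)"
  by (rule copen_clopen_Int) (auto simp: copen_def)

lemma copen_Un: "copen E U \<Longrightarrow> copen E V \<Longrightarrow> copen E (U \<union> V)"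
  by (simp add: copen_def openin_Un closedin_Un compactin_Un)

lemma copen_Union: "finite \<U> \<Longrightarrow> (\<And>U. U \<in> \<U> \<Longrightarrow> copen E U) \<Longrightarrow> copen E (\<Union>\<U>)"
  by (induction rule: finite_induct) (auto simp: copen_empty intro: copen_Un)

lemma copen_supp: "f \<in> CcInf E \<Longrightarrow> copen E {x. f x \<noteq> 0}"
proof -
  assume f: "f \<in> CcInf E"
  have "{x. f x \<noteq> 0} = {x \<in> topspace E. f x \<noteq> 0}" using CcInf_supp[OF f] by auto
  then show ?thesis using f loc_const_openin[of E f "\<lambda>y. y \<noteq> 0"] loc_const_closedin[of E f "\<lambda>y. y \<noteq> 0"]
    by (auto simp: CcInf_iff copen_def)
qed

lemma CcInfI:
  assumes "loc_const E f" "copen E K" "\<And>x. f x \<noteq> 0 \<Longrightarrow> x \<in> K" shows "f \<in> CcInf E"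
proof -
  have z: "x \<notin> topspace E \<Longrightarrow> f x = 0" for x using assms(3) copen_subset[OF assms(2)] by blast
  then have "{x. f x \<noteq> 0} = K \<inter> {x \<in> topspace E. f x \<noteq> 0}" using assms(3) by auto
  moreover have "compactin E \<dots>"
    using assms(2) by (intro compact_Int_closedin loc_const_closedin assms(1)) (simp add: copen_def)
  ultimately show ?thesis using z assms(1) by (simp add: CcInf_iff)
qed

lemma CcInf_level: "f \<in> CcInf E \<Longrightarrow> c \<noteq> 0 \<Longrightarrow> copen E {x. f x = c}"
proof -
  assume f: "f \<in> CcInf E" and c: "c \<noteq> 0"
  then have "{x. f x = c} = {x. f x \<noteq> 0} \<inter> {x \<in> topspace E. f x = c}" using CcInf_supp[OF f] by auto
  then show ?thesis using f loc_const_openin[of E f "\<lambda>y. y = c"] loc_const_closedin[of E f "\<lambda>y. y = c"]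
    copen_supp[OF f] by (auto simp: CcInf_iff intro: copen_clopen_Int)
qed

lemma loc_const_indicator: "openin E U \<Longrightarrow> closedin E U \<Longrightarrow> loc_const E (indicator U)"
  unfolding loc_const_def
proof
  fix x assume "openin E U" "closedin E U" "x \<in> topspace E"
  then show "\<exists>W. openin E W \<and> x \<in> W \<and> (\<forall>y\<in>W. indicator U y = indicator U x)"
    by (intro exI[of _ "if x \<in> U then U else topspace E - U"]) (auto simp: indicator_def)
qed

lemma indicator_CcInf: "copen E U \<Longrightarrow> indicator U \<in> CcInf E"
  by (rule CcInfI[OF loc_const_indicator]) (auto simp: copen_def indicator_def split: if_splits)

lemma CcInf_add: "f \<in> CcInf E \<Longrightarrow> g \<in> CcInf E \<Longrightarrow> (\<lambda>x. f x + g x) \<in> CcInf E"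
  by (rule CcInfI[OF loc_const_comp2[OF CcInf_loc_const CcInf_loc_const, where h="(+)"]
        copen_Un[OF copen_supp[of f] copen_supp[of g]]]) auto

lemma CcInf_smult: "f \<in> CcInf E \<Longrightarrow> (\<lambda>x. c * f x) \<in> CcInf E"
  by (rule CcInfI[OF loc_const_comp2[OF loc_const_const] copen_supp]) (auto simp: CcInf_iff)

lemma CcInf_pmult: "f \<in> CcInf E \<Longrightarrow> loc_const E g \<Longrightarrow> pmult f g \<in> CcInf E"
  unfolding pmult_def by (rule CcInfI[OF loc_const_comp2 copen_supp]) (auto simp: CcInf_iff)

lemma CcInf_zero: "(\<lambda>_. 0) \<in> CcInf E"
  by (simp add: CcInf_iff loc_const_const)

lemma pmult_commute: "pmult f g = pmult g f"
  by (auto simp: pmult_def)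

lemma pmult_assoc: "pmult (pmult f g) h = pmult f (pmult g h)"
  by (auto simp: pmult_def mult.assoc)

lemma Cc_simps [simp]:
  "carrier (Cc E) = CcInf E" "f \<otimes>\<^bsub>Cc E\<^esub> g = pmult f g" "\<zero>\<^bsub>Cc E\<^esub> = (\<lambda>_. 0)"
  "f \<oplus>\<^bsub>Cc E\<^esub> g = (\<lambda>x. f x + g x)" "c \<odot>\<^bsub>Cc E\<^esub> f = (\<lambda>x. c * f x)"
  by (simp_all add: Cc_def)

lemma vspace_Cc: "vspace (Cc E)"
proof (rule vspaceI, rule abelian_groupI, goal_cases)
  case (6 x) then show ?case using CcInf_smult[of x E "-1"] by (intro bexI[of _ "\<lambda>a. - x a"]) auto
qed (auto simp: CcInf_add CcInf_smult CcInf_zero algebra_simps)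

text \<open>Three instances are used: bisections in the groupoid, rectangles of bisections in a
  fibre product, and all compact open sets of units. Stability under intersections is what makes
  inclusion-exclusion available.\<close>

locale copen_base =
  fixes E :: "'x topology" and B :: "'x set set"
  assumes base_copen: "U \<in> B \<Longrightarrow> copen E U"
    and base_empty: "{} \<in> B"
    and base_Int: "U \<in> B \<Longrightarrow> V \<in> B \<Longrightarrow> U \<inter> V \<in> B"
    and base_nhd: "openin E W \<Longrightarrow> x \<in> W \<Longrightarrow> \<exists>U\<in>B. x \<in> U \<and> U \<subseteq> W"
begin

lemma copen_finite_union:
  assumes "copen E K" obtains \<U> where "finite \<U>" "\<U> \<subseteq> B" "K = \<Union>\<U>"
proof -
  have "compactin E K" "openin E K" using assms by (auto simp: copen_def)
  moreover have "\<And>U. U \<in> {U \<in> B. U \<subseteq> K} \<Longrightarrow> openin E U" "K \<subseteq> \<Union>{U \<in> B. U \<subseteq> K}"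
    using base_nhd[OF \<open>openin E K\<close>] base_copen by (auto simp: copen_def) blast
  ultimately obtain \<F> where "finite \<F>" "\<F> \<subseteq> {U \<in> B. U \<subseteq> K}" "K \<subseteq> \<Union>\<F>"
    unfolding compactin_def by meson
  then show ?thesis by (intro that[of \<F>]) auto
qed

lemma copen_induct [consumes 1, case_names base Un]:
  assumes "copen E K" "\<And>U. U \<in> B \<Longrightarrow> P U"
    and "\<And>U K. U \<in> B \<Longrightarrow> copen E K \<Longrightarrow> P K \<Longrightarrow> P (U \<union> K)"
  shows "P K"
proof -
  obtain \<U> where \<U>: "finite \<U>" "\<U> \<subseteq> B" "K = \<Union>\<U>" using copen_finite_union[OF assms(1)] .
  have "P (\<Union>\<U>)" using \<U>(1,2)
    by (induction rule: finite_induct) (auto intro: assms(2) base_empty assms(3) copen_Union base_copen)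
  with \<U> show ?thesis by simp
qed

text \<open>Finitely many level sets reduce the claim to indicators of compact open sets, and these
  are finite unions of basic sets. A disjoint decomposition would require differences of basic sets,
  which rectangles do not provide; inclusion-exclusion uses intersections only.\<close>

lemma Cc_induct [consumes 1, case_names indicator add]:
  assumes f: "f \<in> CcInf E"
    and gen: "\<And>c U. U \<in> B \<Longrightarrow> P (\<lambda>x. c * indicator U x)"
    and add: "\<And>f g. f \<in> CcInf E \<Longrightarrow> g \<in> CcInf E \<Longrightarrow> P f \<Longrightarrow> P g \<Longrightarrow> P (\<lambda>x. f x + g x)"
  shows "P f"
proof -
  \<comment> \<open>The induction is on a bound for the number of sets: the intersections with
    \<open>U\<close> form another family, no larger than \<open>\<V>\<close>.\<close>
  have U: "P (\<lambda>x. c * indicator (\<Union>\<U>) x)" if "finite \<U>" "card \<U> \<le> n" "\<U> \<subseteq> B" for n \<U> c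
    using that
  proof (induction n arbitrary: \<U> c)
    case 0 then have "\<U> = {}" by simp
    then show ?case using gen[OF base_empty, of c] by simp
  next
    case (Suc n)
    show ?case
    proof (cases "\<U> = {}")
      case True then show ?thesis using gen[OF base_empty, of c] by simp
    next
      case False
      then obtain U \<V> where UV: "\<U> = insert U \<V>" "U \<notin> \<V>" by (meson Set.set_insert ex_in_conv)
      let ?\<W> = "(\<lambda>V. U \<inter> V) ` \<V>"
      have fin: "finite \<V>" "card \<V> \<le> n" "U \<in> B" "\<V> \<subseteq> B" using UV Suc.prems by auto
      have fin2: "finite ?\<W>" "card ?\<W> \<le> n" using fin card_image_le[of \<V>] by (auto intro: order_trans)
      have sub: "?\<W> \<subseteq> B" using fin base_Int by auto
      have c: "copen E U" "copen E (\<Union>\<V>)" "copen E (\<Union>?\<W>)"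
        using base_copen[OF fin(3)] copen_Union[OF fin(1)] copen_Union[OF fin2(1)] base_copen fin(4) sub
        by blast+
      have "P (\<lambda>x. (c * indicator U x + c * indicator (\<Union>\<V>) x) + (- c) * indicator (\<Union>?\<W>) x)"
        by (intro add[OF CcInf_add] add CcInf_smult indicator_CcInf c gen[OF fin(3)]
            Suc.IH[OF fin(1,2,4)] Suc.IH[OF fin2 sub])
      also have "(\<lambda>x. (c * indicator U x + c * indicator (\<Union>\<V>) x) + (- c) * indicator (\<Union>?\<W>) x) =
          (\<lambda>x. c * indicator (\<Union>\<U>) x)"
        unfolding UV(1) by (rule ext) (simp add: indicator_def algebra_simps)
      finally show ?thesis .
    qed
  qed
  have K: "P (\<lambda>x. c * indicator K x)" if "copen E K" for K c
    using copen_finite_union[OF that] U by (metis order_refl)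
  \<comment> \<open>The level sets at nonzero values are open and cover the compact support, so only
    finitely many values occur.\<close>
  have fin: "finite (f ` {x. f x \<noteq> 0})"
  proof -
    let ?L = "(\<lambda>c. {x. f x = c}) ` (f ` {x. f x \<noteq> 0})"
    have "compactin E {x. f x \<noteq> 0}" using f by (simp add: CcInf_iff)
    moreover have "\<And>U. U \<in> ?L \<Longrightarrow> openin E U" "{x. f x \<noteq> 0} \<subseteq> \<Union>?L"
      using CcInf_level[OF f] by (auto simp: copen_def)
    ultimately obtain \<F> where \<F>: "finite \<F>" "\<F> \<subseteq> ?L" "{x. f x \<noteq> 0} \<subseteq> \<Union>\<F>"
      unfolding compactin_def by meson
    obtain C where C: "finite C" "\<F> = (\<lambda>c. {x. f x = c}) ` C" using \<F>(1,2) by (meson finite_subset_image)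
    have "f ` {x. f x \<noteq> 0} \<subseteq> C" using \<F>(3) C by auto
    then show ?thesis using C(1) finite_subset by blast
  qed
  \<comment> \<open>Subtracting \<open>c\<close> times the indicator of the level set of
    \<open>c\<close> removes this value and leaves the other nonzero values unchanged.\<close>
  have "finite A \<Longrightarrow> g ` {x. g x \<noteq> 0} \<subseteq> A \<Longrightarrow> g \<in> CcInf E \<Longrightarrow> P g" for A g
  proof (induction A arbitrary: g rule: finite_induct)
    case empty then have "g = (\<lambda>x. 0 * indicator {} x)" by auto
    then show ?case using gen[OF base_empty, of 0] by simp
  next
    case (insert c A)
    show ?case
    proof (cases "c = 0")
      case True then show ?thesis using insert by (intro insert.IH) auto
    next
      case False
      let ?C = "{x. g x = c}"
      have C: "copen E ?C" using CcInf_level[OF insert.prems(2) False] .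
      have m: "(\<lambda>x. c * indicator ?C x) \<in> CcInf E" "(\<lambda>x. g x + (- c) * indicator ?C x) \<in> CcInf E"
        by (intro CcInf_add CcInf_smult indicator_CcInf C insert.prems)+
      have "P (\<lambda>x. g x + (- c) * indicator ?C x)"
        by (rule insert.IH[OF _ m(2)]) (use insert.prems(1) in \<open>auto simp: indicator_def split: if_splits\<close>)
      from add[OF m K[OF C] this] show ?thesis by (simp add: algebra_simps)
    qed
  qed
  from this[OF fin order_refl f] show ?thesis .
qed

end

lemma CcInf_homeomorphic:
  assumes "continuous_map E E' \<phi>" "continuous_map E' E \<psi>"
    and "\<And>x. x \<in> topspace E \<Longrightarrow> \<psi> (\<phi> x) = x" "\<And>y. y \<in> topspace E' \<Longrightarrow> \<phi> (\<psi> y) = y" "f \<in> CcInf E'"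
  shows "(\<lambda>x. if x \<in> topspace E then f (\<phi> x) else 0) \<in> CcInf E"
proof -
  have im: "\<phi> x \<in> topspace E'" if "x \<in> topspace E" for x
    using assms(1) that continuous_map_image_subset_topspace by fastforce
  have im': "\<psi> x \<in> topspace E" if "x \<in> topspace E'" for x
    using assms(2) that continuous_map_image_subset_topspace by fastforce
  have "{x. (if x \<in> topspace E then f (\<phi> x) else 0) \<noteq> 0} = \<psi> ` {y. f y \<noteq> 0}"
    using assms(3,4) im im' CcInf_supp[OF assms(5)] by (auto simp: image_iff split: if_splits) metis
  moreover have "compactin E \<dots>"
    by (rule image_compactin[OF _ assms(2)]) (use assms(5) in \<open>simp add: CcInf_iff\<close>)
  moreover have "loc_const E (\<lambda>x. if x \<in> topspace E then f (\<phi> x) else 0)"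
    using loc_const_compose[OF assms(1) CcInf_loc_const[OF assms(5)]] openin_subset
    unfolding loc_const_def by (smt (verit) subsetD)
  ultimately show ?thesis by (simp add: CcInf_iff)
qed

lemma copen_subtopology:
  assumes "openin E S" "closedin E S"
  shows "copen (subtopology E S) U \<longleftrightarrow> copen E U \<and> U \<subseteq> S"
  using assms
  by (auto simp: copen_def compactin_subtopology openin_open_subtopology closedin_closed_subtopology)

text \<open>Openness of \<open>S\<close> carries neighbourhoods from the subspace to
  \<open>E\<close>; closedness supplies neighbourhoods of the points outside, where the function
  vanishes.\<close>

lemma CcInf_subtopology:
  assumes S: "openin E S" "closedin E S"
  shows "f \<in> CcInf (subtopology E S) \<longleftrightarrow> f \<in> CcInf E \<and> (\<forall>x. x \<notin> S \<longrightarrow> f x = 0)"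
proof
  assume f: "f \<in> CcInf (subtopology E S)"
  have z: "x \<notin> S \<Longrightarrow> f x = 0" for x using CcInf_zero_off[OF f] by simp
  have "loc_const E f" unfolding loc_const_def
  proof
    fix x assume x: "x \<in> topspace E"
    show "\<exists>U. openin E U \<and> x \<in> U \<and> (\<forall>y\<in>U. f y = f x)"
    proof (cases "x \<in> S")
      case True
      then have "x \<in> topspace (subtopology E S)" using x by simp
      then obtain U where "openin (subtopology E S) U" "x \<in> U" "\<forall>y\<in>U. f y = f x"
        using CcInf_loc_const[OF f] unfolding loc_const_def by blast
      then show ?thesis using openin_open_subtopology[OF S(1)] by blast
    next
      case False
      then show ?thesis using S(2) x z by (intro exI[of _ "topspace E - S"]) auto
    qed
  qed
  then show "f \<in> CcInf E \<and> (\<forall>x. x \<notin> S \<longrightarrow> f x = 0)"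
    using copen_supp[OF f] z unfolding copen_subtopology[OF S] by (auto intro: CcInfI)
next
  assume f: "f \<in> CcInf E \<and> (\<forall>x. x \<notin> S \<longrightarrow> f x = 0)"
  have "loc_const (subtopology E S) f"
    using loc_const_compose[OF continuous_map_id_subt, of E f S] f CcInf_loc_const by (auto simp: id_def)
  then show "f \<in> CcInf (subtopology E S)"
    by (rule CcInfI[where K = "{x. f x \<noteq> 0}"]) (use f in \<open>auto simp: copen_subtopology[OF S] copen_supp\<close>)
qed

section \<open>Topology of ample groupoids\<close>

text \<open>In a locally compact Hausdorff space a compact component can be separated by a clopen
  set lying inside any given open neighbourhood. Here the component is a single point, and the
  neighbourhood is shrunk into a compact set beforehand.\<close>

lemma totally_disconnected_copen_nhd:
  assumes E: "locally_compact_space E" "Hausdorff_space E" "totally_disconnected_space E"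
    and W: "openin E W" "x \<in> W"
  obtains C where "copen E C" "x \<in> C" "C \<subseteq> W"
proof -
  have x: "x \<in> topspace E" using W openin_subset by blast
  obtain U K where UK: "openin E U" "compactin E K" "x \<in> U" "U \<subseteq> K"
    using E(1) x by (auto simp: locally_compact_space_def)
  obtain a where "connected_component_of_set E x \<subseteq> {a}"
    using E(3) connectedin_connected_component_of unfolding totally_disconnected_space_def by metis
  moreover have "x \<in> connected_component_of_set E x" using x by (simp add: connected_component_of_refl)
  ultimately have "connected_component_of_set E x = {x}" by auto
  then have C: "{x} \<in> connected_components_of E" using x by (metis connected_component_in_connected_components_of)
  have "compactin E {x}" using x by simp
  moreover have "openin E (U \<inter> W)" "{x} \<subseteq> U \<inter> W" using UK W by auto
  ultimately obtain A B where AB: "openin E A" "openin E B" "disjnt A B" "A \<union> B = topspace E" "{x} \<subseteq> A" "A \<subseteq> U \<inter> W"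
    using wilder_locally_compact_component_thm[OF E(1,2) C] by metis
  have "topspace E - A = B" using AB(3,4) by (auto simp: disjnt_iff)
  then have "closedin E A" using AB by (auto simp: closedin_def)
  moreover have "compactin E A" by (rule closed_compactin[OF UK(2)]) (use AB UK calculation in auto)
  ultimately show ?thesis using AB by (intro that[of A]) (auto simp: copen_def)
qed

lemma local_homeomorphism_continuous:
  assumes "local_homeomorphism E Y f" shows "continuous_map E Y f"
proof (subst continuous_map_def, safe)
  fix x assume x: "x \<in> topspace E"
  then obtain U V where UV: "openin E U" "x \<in> U" "openin Y V" "homeomorphic_map (subtopology E U) (subtopology Y V) f"
    using assms by (auto simp: local_homeomorphism_def)
  then have "f x \<in> topspace (subtopology Y V)"
    using x homeomorphic_imp_surjective_map by (metis IntI imageI topspace_subtopology)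
  then show "f x \<in> topspace Y" by simp
next
  fix T assume T: "openin Y T"
  show "openin E {x \<in> topspace E. f x \<in> T}"
  proof (subst openin_subopen, safe)
    fix x assume x: "x \<in> topspace E" "f x \<in> T"
    then obtain U V where UV: "openin E U" "x \<in> U" "openin Y V" "homeomorphic_map (subtopology E U) (subtopology Y V) f"
      using assms by (auto simp: local_homeomorphism_def)
    have im: "f ` (topspace (subtopology E U)) = topspace (subtopology Y V)"
      using UV(4) by (rule homeomorphic_imp_surjective_map)
    have "continuous_map (subtopology E U) (subtopology Y V) f" using UV(4) by (rule homeomorphic_imp_continuous_map)
    moreover have "openin (subtopology Y V) (T \<inter> V)" using T by (simp add: openin_subtopology_Int)
    ultimately have "openin (subtopology E U) {y \<in> topspace (subtopology E U). f y \<in> T \<inter> V}"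
      by (rule openin_continuous_map_preimage)
    then have "openin E {y \<in> topspace (subtopology E U). f y \<in> T \<inter> V}"
      using UV(1) openin_trans_full by blast
    then show "\<exists>S. openin E S \<and> x \<in> S \<and> S \<subseteq> {x \<in> topspace E. f x \<in> T}"
      using x UV im by (intro exI[of _ "{y \<in> topspace (subtopology E U). f y \<in> T \<inter> V}"]) auto
  qed
qed

lemma local_homeomorphism_open:
  assumes "local_homeomorphism E Y f" shows "open_map E Y f"
  unfolding open_map_def
proof safe
  fix W assume W: "openin E W"
  show "openin Y (f ` W)"
  proof (subst openin_subopen, safe)
    fix x assume x: "x \<in> W"
    then have "x \<in> topspace E" using W openin_subset by blast
    then obtain U V where UV: "openin E U" "x \<in> U" "openin Y V" "homeomorphic_map (subtopology E U) (subtopology Y V) f"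
      using assms by (auto simp: local_homeomorphism_def)
    have "openin (subtopology E U) (W \<inter> U)" using W by (simp add: openin_subtopology_Int)
    then have "openin (subtopology Y V) (f ` (W \<inter> U))"
      using homeomorphic_imp_open_map[OF UV(4)] by (simp add: open_map_def)
    then have "openin Y (f ` (W \<inter> U))" using UV(3) openin_trans_full by blast
    then show "\<exists>T. openin Y T \<and> f x \<in> T \<and> T \<subseteq> f ` W"
      using x UV by (intro exI[of _ "f ` (W \<inter> U)"]) auto
  qed
qed

lemma local_homeomorphism_inj:
  assumes "local_homeomorphism E Y f" "x \<in> topspace E"
  obtains U where "openin E U" "x \<in> U" "inj_on f U"
proof -
  obtain U V where UV: "openin E U" "x \<in> U" "openin Y V" "homeomorphic_map (subtopology E U) (subtopology Y V) f"
    using assms by (auto simp: local_homeomorphism_def)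
  have "inj_on f (topspace (subtopology E U))" using UV(4) by (rule homeomorphic_imp_injective_map)
  moreover have "topspace (subtopology E U) = U" using openin_subset[OF UV(1)] by auto
  ultimately show ?thesis using UV that by auto
qed

context ample_groupoid
begin

abbreviation "XX \<equiv> topspace (gtop G)"
abbreviation "rr \<equiv> grng G"
abbreviation "ss \<equiv> gsrc G"
abbreviation "iv \<equiv> ginv G"
abbreviation gmul (infixl "\<diamond>" 70) where "a \<diamond> b \<equiv> gcomp G a b"

subsection \<open>Algebra of arrows\<close>

lemma topspace_fibprod: "topspace (fibprod G p q) = {(a, b). a \<in> XX \<and> b \<in> XX \<and> p a = q b}"
  by (auto simp: fibprod_def)

lemma topspace_gtop0: "topspace (gtop0 G) = gunits G"
  using units_subset by (auto simp: gtop0_def)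

lemma mul_closed: "a \<in> XX \<Longrightarrow> b \<in> XX \<Longrightarrow> ss a = rr b \<Longrightarrow> a \<diamond> b \<in> XX"
  and ss_mul: "a \<in> XX \<Longrightarrow> b \<in> XX \<Longrightarrow> ss a = rr b \<Longrightarrow> ss (a \<diamond> b) = ss b"
  and rr_mul: "a \<in> XX \<Longrightarrow> b \<in> XX \<Longrightarrow> ss a = rr b \<Longrightarrow> rr (a \<diamond> b) = rr a"
  using comp_in src_comp rng_comp by (auto simp: topspace_fibprod)

lemma mul_assoc:
  "a \<in> XX \<Longrightarrow> b \<in> XX \<Longrightarrow> c \<in> XX \<Longrightarrow> ss a = rr b \<Longrightarrow> ss b = rr c \<Longrightarrow> a \<diamond> b \<diamond> c = a \<diamond> (b \<diamond> c)"
  using comp_assoc by (auto simp: topspace_fibprod)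

lemma unit_in: "x \<in> gunits G \<Longrightarrow> x \<in> XX"
  using units_subset by auto

lemma rr_rr: "a \<in> XX \<Longrightarrow> rr (rr a) = rr a"
  using rng_unit rng_in by auto

lemma unit_iff: "a \<in> XX \<Longrightarrow> a \<in> gunits G \<longleftrightarrow> rr a = a"
  using rng_in rng_unit by metis

lemma iv_mul_cancel: "a \<in> XX \<Longrightarrow> b \<in> XX \<Longrightarrow> ss a = rr b \<Longrightarrow> iv a \<diamond> (a \<diamond> b) = b"
  by (metis comp_inv_left inv_in mul_assoc rng_comp_left src_inv)

lemma mul_iv_cancel: "a \<in> XX \<Longrightarrow> b \<in> XX \<Longrightarrow> rr a = rr b \<Longrightarrow> a \<diamond> (iv a \<diamond> b) = b"
  by (metis comp_inv_right inv_in mul_assoc rng_comp_left rng_inv src_inv)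

lemma iv_iv: "a \<in> XX \<Longrightarrow> iv (iv a) = a"
  by (metis comp_inv_left comp_src inv_in iv_mul_cancel rng_inv src_inv)

lemma iv_unit: "x \<in> gunits G \<Longrightarrow> iv x = x"
  by (metis comp_inv_left comp_src inv_in rng_unit src_inv src_unit unit_in)

lemma iv_mul_closed: "a \<in> XX \<Longrightarrow> b \<in> XX \<Longrightarrow> rr a = rr b \<Longrightarrow> iv a \<diamond> b \<in> XX"
  and rr_iv_mul: "a \<in> XX \<Longrightarrow> b \<in> XX \<Longrightarrow> rr a = rr b \<Longrightarrow> rr (iv a \<diamond> b) = ss a"
  by (simp_all add: mul_closed inv_in src_inv ss_mul rr_mul rng_inv)

subsection \<open>Source and range maps\<close>

lemma rr_continuous: "continuous_map (gtop G) (gtop0 G) rr"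
  by (rule local_homeomorphism_continuous[OF etale])

text \<open>Range and source are treated together, since inversion exchanges them and carries over
  to the source whatever is known for the range.\<close>

definition leg :: "('a \<Rightarrow> 'a) \<Rightarrow> bool"
  where "leg p \<longleftrightarrow> p = rr \<or> p = ss"

lemma leg_rr: "leg rr" and leg_ss: "leg ss"
  by (auto simp: leg_def)

lemma ss_eq: "a \<in> XX \<Longrightarrow> ss a = rr (iv a)"
  by (simp add: rng_inv)

lemma leg_continuous: "leg p \<Longrightarrow> continuous_map (gtop G) (gtop0 G) p"
proof -
  have "continuous_map (gtop G) (gtop0 G) ss"
    by (rule continuous_map_eq[OF continuous_map_compose[OF inv_continuous rr_continuous]]) (simp add: ss_eq)
  then show "leg p \<Longrightarrow> continuous_map (gtop G) (gtop0 G) p" using rr_continuous by (auto simp: leg_def)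
qed

lemma leg_unit: "leg p \<Longrightarrow> x \<in> gunits G \<Longrightarrow> p x = x"
  using rng_unit src_unit by (auto simp: leg_def)

lemma gtop0_gtop: "continuous_map E (gtop0 G) f \<Longrightarrow> continuous_map E (gtop G) f"
  unfolding gtop0_def by (rule continuous_map_into_fulltopology)

lemma iv_image: "U \<subseteq> XX \<Longrightarrow> iv ` U = {a \<in> XX. iv a \<in> U}"
  using iv_iv inv_in by (auto simp: image_iff subset_iff) metis

lemma iv_open: "openin (gtop G) U \<Longrightarrow> openin (gtop G) (iv ` U)"
  using iv_image[of U] openin_subset openin_continuous_map_preimage[OF inv_continuous] by metis

lemma leg_open:
  assumes "leg p" "openin (gtop G) U" shows "openin (gtop0 G) (p ` U)"
proof -
  have r: "openin (gtop G) U \<Longrightarrow> openin (gtop0 G) (rr ` U)" for U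
    using local_homeomorphism_open[OF etale] by (simp add: open_map_def)
  have "ss ` U = rr ` iv ` U" using openin_subset[OF assms(2)] ss_eq by (force simp: image_iff)
  then show ?thesis using assms r iv_open by (auto simp: leg_def)
qed

text \<open>If the range map is injective on \<open>U\<close> and both \<open>a\<close> and
  \<open>rr a\<close> lie in \<open>U\<close>, then \<open>a = rr a\<close>, because the two have
  the same range.\<close>

lemma units_open: "openin (gtop G) (gunits G)"
proof (subst openin_subopen, safe)
  fix x assume x: "x \<in> gunits G"
  obtain U where U: "openin (gtop G) U" "x \<in> U" "inj_on rr U"
    using local_homeomorphism_inj[OF etale unit_in[OF x]] .
  let ?W = "{a \<in> XX. rr a \<in> U \<inter> gunits G} \<inter> U"
  have "openin (gtop0 G) (U \<inter> gunits G)" unfolding gtop0_def using U(1) by (simp add: openin_subtopology_Int)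
  from openin_continuous_map_preimage[OF rr_continuous this] have "openin (gtop G) ?W" using U(1) by blast
  moreover have "?W \<subseteq> gunits G" using U(3) rr_rr by (auto simp: unit_iff inj_on_def)
  ultimately show "\<exists>T. openin (gtop G) T \<and> x \<in> T \<and> T \<subseteq> gunits G"
    using x U(2) rng_unit unit_in by (intro exI[of _ ?W]) auto
qed

text \<open>Units are the fixed points of the range map, and in a Hausdorff space the fixed points
  of a continuous map form a closed set.\<close>

lemma units_closed: "closedin (gtop G) (gunits G)"
proof -
  have "closedin (gtop G) {a \<in> XX. rr a = a}"
    using closedin_continuous_maps_eq[OF hausdorff gtop0_gtop[OF rr_continuous] continuous_map_id] by (simp add: id_def)
  also have "{a \<in> XX. rr a = a} = gunits G" using unit_iff unit_in by auto
  finally show ?thesis .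
qed

lemma copen0_iff: "copen (gtop0 G) K \<longleftrightarrow> copen (gtop G) K \<and> K \<subseteq> gunits G"
  unfolding gtop0_def by (rule copen_subtopology[OF units_open units_closed])

lemma CcInf0_iff: "f \<in> CcInf (gtop0 G) \<longleftrightarrow> f \<in> CcInf (gtop G) \<and> (\<forall>x. x \<notin> gunits G \<longrightarrow> f x = 0)"
  unfolding gtop0_def by (rule CcInf_subtopology[OF units_open units_closed])

lemma Hausdorff_gtop0: "Hausdorff_space (gtop0 G)"
  unfolding gtop0_def by (rule Hausdorff_space_subtopology[OF hausdorff])

lemma gtop0_copen_nhd:
  assumes "openin (gtop0 G) W" "x \<in> W" obtains C where "copen (gtop0 G) C" "x \<in> C" "C \<subseteq> W"
proof (rule totally_disconnected_copen_nhd[OF _ Hausdorff_gtop0 totally_disconnected assms])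
  show "locally_compact_space (gtop0 G)"
    unfolding gtop0_def by (rule locally_compact_space_closed_subset[OF locally_compact units_closed])
qed

lemma leg_inj_nhd:
  assumes "leg p" "a \<in> XX" obtains U where "openin (gtop G) U" "a \<in> U" "inj_on p U"
proof (cases "p = rr")
  case True then show ?thesis using local_homeomorphism_inj[OF etale assms(2)] that by metis
next
  case False
  then have p: "p = ss" using assms(1) by (simp add: leg_def)
  obtain U where U: "openin (gtop G) U" "iv a \<in> U" "inj_on rr U"
    using local_homeomorphism_inj[OF etale inv_in[OF assms(2)]] .
  show ?thesis
  proof (rule that[of "iv ` U"])
    show "openin (gtop G) (iv ` U)" using U iv_open by blast
    show "a \<in> iv ` U" using U(2) iv_iv[OF assms(2)] by (metis image_eqI)
    show "inj_on p (iv ` U)" unfolding p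
      using U(3) openin_subset[OF U(1)] src_inv by (auto simp: inj_on_def subset_iff)
  qed
qed

subsection \<open>Compact open bisections\<close>

definition bisec :: "'a set \<Rightarrow> bool"
  where "bisec U \<longleftrightarrow> copen (gtop G) U \<and> inj_on rr U \<and> inj_on ss U"

lemma bisec_copen: "bisec U \<Longrightarrow> copen (gtop G) U"
  by (simp add: bisec_def)

lemma bisec_in: "bisec U \<Longrightarrow> a \<in> U \<Longrightarrow> a \<in> XX"
  using copen_subset by (auto simp: bisec_def)

lemma bisec_inj: "bisec U \<Longrightarrow> leg p \<Longrightarrow> inj_on p U"
  by (auto simp: bisec_def leg_def)

lemma bisec_eq: "bisec U \<Longrightarrow> leg p \<Longrightarrow> a \<in> U \<Longrightarrow> b \<in> U \<Longrightarrow> p a = p b \<Longrightarrow> a = b"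
  using bisec_inj by (auto dest: inj_onD)

lemma bisec_mono: "bisec U \<Longrightarrow> V \<subseteq> U \<Longrightarrow> copen (gtop G) V \<Longrightarrow> bisec V"
  by (auto simp: bisec_def inj_on_subset)

lemma bisec_unit: "copen (gtop0 G) K \<Longrightarrow> bisec K"
  unfolding copen0_iff bisec_def using rng_unit src_unit by (auto simp: inj_on_def subset_iff)

text \<open>Total disconnectedness is given for the unit space only, so a compact open set
  \<open>C\<close> is found there, around \<open>rr a\<close>, and transported to the groupoid by
  the local inverse \<open>g\<close> of the range map. Injectivity of both legs is arranged by
  shrinking first.\<close>

lemma bisec_nhd:
  assumes W: "openin (gtop G) W" "a \<in> W" shows "\<exists>U. bisec U \<and> a \<in> U \<and> U \<subseteq> W"
proof -
  have a: "a \<in> XX" using W openin_subset by blast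
  obtain U1 where U1: "openin (gtop G) U1" "a \<in> U1" "inj_on rr U1" using leg_inj_nhd[OF leg_rr a] .
  obtain U2 where U2: "openin (gtop G) U2" "a \<in> U2" "inj_on ss U2" using leg_inj_nhd[OF leg_ss a] .
  obtain O1 O2 where O: "openin (gtop G) O1" "a \<in> O1" "openin (gtop0 G) O2"
    "homeomorphic_map (subtopology (gtop G) O1) (subtopology (gtop0 G) O2) rr"
    using etale a by (auto simp: local_homeomorphism_def)
  let ?U = "U1 \<inter> U2 \<inter> W \<inter> O1"
  have U: "openin (gtop G) ?U" "a \<in> ?U" using U1 U2 W O by auto
  obtain C where C: "copen (gtop0 G) C" "rr a \<in> C" "C \<subseteq> rr ` ?U"
    using gtop0_copen_nhd[OF leg_open[OF leg_rr U(1)], of "rr a"] U(2) by blast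
  let ?V = "?U \<inter> {a \<in> XX. rr a \<in> C}"
  have Vo: "openin (gtop G) ?V" using U(1) C(1) openin_continuous_map_preimage[OF rr_continuous]
    by (auto simp: copen_def intro!: openin_Int[OF U(1), simplified])
  have OX: "O1 \<subseteq> XX" "O2 \<subseteq> gunits G" using O(1,3) openin_subset topspace_gtop0 by auto
  have im: "rr ` ?V = C" using C(3) OX by auto
  obtain g where g: "homeomorphic_maps (subtopology (gtop G) O1) (subtopology (gtop0 G) O2) rr g"
    using O(4) homeomorphic_map_maps by blast
  have gr: "b \<in> O1 \<Longrightarrow> g (rr b) = b" for b using g OX by (auto simp: homeomorphic_maps_def)
  have "g ` (rr ` ?V) = ?V" using gr by (force simp: image_image)
  then have "?V = g ` C" using im by argo
  moreover have "compactin (subtopology (gtop G) O1) (g ` C)"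
  proof (rule image_compactin)
    show "continuous_map (subtopology (gtop0 G) O2) (subtopology (gtop G) O1) g"
      using g by (simp add: homeomorphic_maps_def)
    have "rr ` O1 \<subseteq> O2" using homeomorphic_imp_surjective_map[OF O(4)] OX topspace_gtop0 by auto
    then have "C \<subseteq> O2" using im by blast
    then show "compactin (subtopology (gtop0 G) O2) C" using C(1) by (simp add: compactin_subtopology copen_def)
  qed
  ultimately have "compactin (gtop G) ?V" by (simp add: compactin_subtopology)
  then have "bisec ?V" using Vo U1(3) U2(3) hausdorff
    by (auto simp: bisec_def intro!: copenI intro: inj_on_subset)
  then show ?thesis using a U(2) C(2) by (intro exI[of _ ?V]) auto
qed

sublocale bisecs: copen_base "gtop G" "{U. bisec U}"
proof
  show "U \<in> {U. bisec U} \<Longrightarrow> V \<in> {U. bisec U} \<Longrightarrow> U \<inter> V \<in> {U. bisec U}" for U V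
    using bisec_mono[of U "U \<inter> V"] copen_Int bisec_copen by auto
  show "openin (gtop G) W \<Longrightarrow> x \<in> W \<Longrightarrow> \<exists>U\<in>{U. bisec U}. x \<in> U \<and> U \<subseteq> W" for W x
    using bisec_nhd by auto
qed (auto simp: bisec_copen bisec_def copen_empty)

lemma bisec_Int: "bisec U \<Longrightarrow> bisec V \<Longrightarrow> bisec (U \<inter> V)"
  using bisecs.base_Int by simp

lemma bisec_restrict:
  assumes "bisec U" "leg p" "copen (gtop0 G) K" shows "bisec {a \<in> U. p a \<in> K}"
proof (rule bisec_mono[OF assms(1)])
  have "copen (gtop G) (U \<inter> {a \<in> XX. p a \<in> K})"
    using assms(3) openin_continuous_map_preimage[OF leg_continuous[OF assms(2)]]
      closedin_continuous_map_preimage[OF leg_continuous[OF assms(2)]]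
    by (intro copen_clopen_Int bisec_copen assms(1)) (auto simp: copen_def)
  also have "U \<inter> {a \<in> XX. p a \<in> K} = {a \<in> U. p a \<in> K}" using bisec_in[OF assms(1)] by auto
  finally show "copen (gtop G) {a \<in> U. p a \<in> K}" .
qed auto

lemma copen_leg_image:
  assumes "copen (gtop G) U" "leg p" shows "copen (gtop0 G) (p ` U)"
  using assms by (intro copenI Hausdorff_gtop0 leg_open image_compactin[OF _ leg_continuous]) (auto simp: copen_def)

lemma bisec_leg_image: "bisec U \<Longrightarrow> leg p \<Longrightarrow> copen (gtop0 G) (p ` U)"
  by (intro copen_leg_image bisec_copen)

lemma bisec_iv:
  assumes "bisec U" shows "bisec (iv ` U)"
  unfolding bisec_def
proof (intro conjI copenI hausdorff)
  show "openin (gtop G) (iv ` U)" "compactin (gtop G) (iv ` U)"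
    using assms iv_open image_compactin[OF _ inv_continuous] by (auto simp: bisec_def copen_def)
  show "inj_on rr (iv ` U)" "inj_on ss (iv ` U)"
    using bisec_in[OF assms] bisec_eq[OF assms leg_rr] bisec_eq[OF assms leg_ss]
    by (intro inj_onI; elim imageE; metis src_inv rng_inv)+
qed

lemma leg_iv_image:
  assumes "bisec U" shows "rr ` iv ` U = ss ` U" "ss ` iv ` U = rr ` U"
  using bisec_in[OF assms] by (force simp: src_inv rng_inv image_iff)+

subsection \<open>Fibre products\<close>

lemma Hausdorff_fibprod: "Hausdorff_space (fibprod G p q)"
  unfolding fibprod_def
  by (intro Hausdorff_space_subtopology) (simp add: Hausdorff_space_prod_topology hausdorff)

lemma fst_continuous: "continuous_map (fibprod G p q) (gtop G) fst"
  and snd_continuous: "continuous_map (fibprod G p q) (gtop G) snd"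
  unfolding fibprod_def
  by (intro continuous_map_from_subtopology continuous_map_fst continuous_map_snd)+

lemma continuous_fibprodI:
  assumes "continuous_map E (gtop G) f" "continuous_map E (gtop G) g"
    "\<And>x. x \<in> topspace E \<Longrightarrow> p (f x) = q (g x)"
  shows "continuous_map E (fibprod G p q) (\<lambda>x. (f x, g x))"
  unfolding fibprod_def using assms
  by (intro continuous_map_into_subtopology continuous_map_pairedI) auto

lemma mul_continuous: "continuous_map (gtop2 G) (gtop G) (\<lambda>x. fst x \<diamond> snd x)"
  using comp_continuous by (simp add: case_prod_unfold)

lemma iv_mul_continuous: "continuous_map (fibprod G rr rr) (gtop G) (\<lambda>x. iv (fst x) \<diamond> snd x)"
proof -
  have "continuous_map (fibprod G rr rr) (gtop2 G) (\<lambda>x. (iv (fst x), snd x))"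
    by (intro continuous_fibprodI snd_continuous continuous_map_compose[OF fst_continuous inv_continuous, unfolded o_def])
       (auto simp: topspace_fibprod src_inv)
  from continuous_map_compose[OF this mul_continuous] show ?thesis by (simp add: o_def)
qed

definition rect :: "('a \<Rightarrow> 'a) \<Rightarrow> 'a set \<Rightarrow> 'a set \<Rightarrow> ('a \<times> 'a) set"
  where "rect p U V = {(a, b). a \<in> U \<and> b \<in> V \<and> p a = rr b}"

text \<open>The rectangle is cut out of the compact set \<open>U \<times> V\<close> by the equation
  \<open>p a = rr b\<close>, which is a closed condition because the unit space is
  Hausdorff.\<close>

lemma copen_rect:
  assumes "leg p" "copen (gtop G) U" "copen (gtop G) V" shows "copen (fibprod G p rr) (rect p U V)"
proof (rule copenI[OF Hausdorff_fibprod])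
  let ?D = "{x \<in> topspace (prod_topology (gtop G) (gtop G)). (p \<circ> fst) x = (rr \<circ> snd) x}"
  have R: "rect p U V = U \<times> V \<inter> {(a, b). p a = rr b}" by (auto simp: rect_def)
  show "openin (fibprod G p rr) (rect p U V)"
    unfolding R fibprod_def using assms by (intro openin_subtopology_Int) (simp add: openin_prod_Times_iff copen_def)
  have "closedin (prod_topology (gtop G) (gtop G)) ?D"
    by (rule closedin_continuous_maps_eq[OF Hausdorff_gtop0])
       (intro continuous_map_compose[OF continuous_map_fst] continuous_map_compose[OF continuous_map_snd]
         leg_continuous assms leg_rr)+
  moreover have "compactin (prod_topology (gtop G) (gtop G)) (U \<times> V)"
    using assms by (simp add: compactin_Times copen_def)
  ultimately have "compactin (prod_topology (gtop G) (gtop G)) (U \<times> V \<inter> ?D)"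
    by (intro compact_Int_closedin)
  also have "U \<times> V \<inter> ?D = rect p U V"
    using copen_subset[OF assms(2)] copen_subset[OF assms(3)] by (auto simp: rect_def)
  finally show "compactin (fibprod G p rr) (rect p U V)"
    unfolding fibprod_def by (auto simp: compactin_subtopology rect_def)
qed

lemma copen_base_rect:
  assumes "leg p" shows "copen_base (fibprod G p rr) {rect p U V | U V. bisec U \<and> bisec V}"
proof
  show "R \<in> {rect p U V | U V. bisec U \<and> bisec V} \<Longrightarrow> copen (fibprod G p rr) R" for R
    using copen_rect[OF assms] bisec_copen by auto
  have "rect p {} {} = {}" by (auto simp: rect_def)
  then show "{} \<in> {rect p U V | U V. bisec U \<and> bisec V}" using bisecs.base_empty by force
next
  fix R R' assume "R \<in> {rect p U V | U V. bisec U \<and> bisec V}" "R' \<in> {rect p U V | U V. bisec U \<and> bisec V}"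
  then obtain U V U' V' where *: "R = rect p U V" "R' = rect p U' V'" "bisec U" "bisec V" "bisec U'" "bisec V'" by blast
  then have "R \<inter> R' = rect p (U \<inter> U') (V \<inter> V')" by (auto simp: rect_def)
  then show "R \<inter> R' \<in> {rect p U V | U V. bisec U \<and> bisec V}" using * bisec_Int by blast
next
  fix W x assume W: "openin (fibprod G p rr) W" "x \<in> W"
  obtain a b where x: "x = (a, b)" by force
  obtain T where T: "openin (prod_topology (gtop G) (gtop G)) T" "W = T \<inter> {(a, b). p a = rr b}"
    using W(1) by (auto simp: fibprod_def openin_subtopology)
  then obtain A B where AB: "openin (gtop G) A" "openin (gtop G) B" "a \<in> A" "b \<in> B" "A \<times> B \<subseteq> T"
    using T(1)[unfolded openin_prod_topology_alt, rule_format, of a b] W(2) x by auto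
  obtain U where U: "bisec U" "a \<in> U" "U \<subseteq> A" using bisec_nhd[OF AB(1,3)] by blast
  obtain V where V: "bisec V" "b \<in> V" "V \<subseteq> B" using bisec_nhd[OF AB(2,4)] by blast
  have "x \<in> rect p U V" "rect p U V \<subseteq> W" using U V AB T W(2) x by (auto simp: rect_def)
  then show "\<exists>R\<in>{rect p U V | U V. bisec U \<and> bisec V}. x \<in> R \<and> R \<subseteq> W" using U V by blast
qed

section \<open>Products of bisections\<close>

definition prodset :: "'a set \<Rightarrow> 'a set \<Rightarrow> 'a set"
  where "prodset U V = {a \<diamond> b | a b. a \<in> U \<and> b \<in> V \<and> ss a = rr b}"

text \<open>The projection of a basic rectangle consists of the points of \<open>V\<close> whose
  range lies in the image of \<open>U\<close> under \<open>p\<close>, and this is a compact open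
  set.\<close>

lemma snd_open:
  assumes "leg p" "openin (fibprod G p rr) W" shows "openin (gtop G) (snd ` W)"
proof (subst openin_subopen, safe)
  fix a b assume ab: "(a, b) \<in> W"
  interpret copen_base "fibprod G p rr" "{rect p U V | U V. bisec U \<and> bisec V}" by (rule copen_base_rect[OF assms(1)])
  obtain U V where UV: "bisec U" "bisec V" "(a, b) \<in> rect p U V" "rect p U V \<subseteq> W"
    using base_nhd[OF assms(2) ab] by blast
  have "copen (gtop G) {b \<in> V. rr b \<in> p ` U}"
    using bisec_copen bisec_restrict[OF UV(2) leg_rr bisec_leg_image[OF UV(1) assms(1)]] by blast
  moreover have "{b \<in> V. rr b \<in> p ` U} \<subseteq> snd ` W" using UV(4) by (force simp: rect_def)
  moreover have "b \<in> {b \<in> V. rr b \<in> p ` U}" using UV(3) unfolding rect_def by simp (metis image_eqI)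
  ultimately show "\<exists>T. openin (gtop G) T \<and> snd (a, b) \<in> T \<and> T \<subseteq> snd ` W"
    by (metis copen_def snd_conv)
qed

lemma bisec_prodset:
  assumes U: "bisec U" and V: "bisec V" shows "bisec (prodset U V)"
  unfolding bisec_def
proof (intro conjI copenI hausdorff)
  note inU = bisec_in[OF U] and inV = bisec_in[OF V]
  have "prodset U V = (\<lambda>x. fst x \<diamond> snd x) ` rect ss U V"
    by (force simp: prodset_def rect_def image_iff)
  moreover have "compactin (gtop2 G) (rect ss U V)"
    using copen_rect[OF leg_ss bisec_copen[OF U] bisec_copen[OF V]] by (simp add: copen_def)
  ultimately show "compactin (gtop G) (prodset U V)"
    using image_compactin[OF _ mul_continuous] by simp
  \<comment> \<open>A product c = ab with a in \<open>U\<close> and b in \<open>V\<close> is a pair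
    (a, c) with a in \<open>U\<close> and a^{-1}c in \<open>V\<close>. This makes the product set a
    projection of an open set, so openness of multiplication need not be known beforehand.\<close>
  let ?W = "{x \<in> topspace (fibprod G rr rr). fst x \<in> U} \<inter> {x \<in> topspace (fibprod G rr rr). iv (fst x) \<diamond> snd x \<in> V}"
  have "openin (fibprod G rr rr) ?W"
    using U V by (intro openin_Int openin_continuous_map_preimage[OF fst_continuous]
        openin_continuous_map_preimage[OF iv_mul_continuous]) (auto simp: bisec_def copen_def)
  then have "openin (gtop G) (snd ` ?W)" by (rule snd_open[OF leg_rr])
  also have "snd ` ?W = prodset U V"
  proof safe
    fix a b assume "(a, b) \<in> topspace (fibprod G rr rr)" "fst (a, b) \<in> U" "iv (fst (a, b)) \<diamond> snd (a, b) \<in> V"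
    then show "snd (a, b) \<in> prodset U V" unfolding prodset_def
      using mul_iv_cancel rr_iv_mul by (intro CollectI exI[of _ a] exI[of _ "iv a \<diamond> b"]) (auto simp: topspace_fibprod)
  next
    fix c assume "c \<in> prodset U V"
    then obtain a b where "c = a \<diamond> b" "a \<in> U" "b \<in> V" "ss a = rr b" by (auto simp: prodset_def)
    then show "c \<in> snd ` ?W"
      using inU inV by (intro image_eqI[of _ _ "(a, c)"])
        (auto simp: topspace_fibprod mul_closed rr_mul iv_mul_cancel)
  qed
  finally show "openin (gtop G) (prodset U V)" .
  show "inj_on rr (prodset U V)"
    by (rule inj_onI) (auto simp: prodset_def rr_mul inU inV,
        metis bisec_eq[OF U leg_rr] bisec_eq[OF V leg_rr])
  show "inj_on ss (prodset U V)"
    by (rule inj_onI) (auto simp: prodset_def ss_mul inU inV,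
        metis bisec_eq[OF U leg_ss] bisec_eq[OF V leg_ss])
qed

lemma prodset_unit: "copen (gtop0 G) K \<Longrightarrow> bisec U \<Longrightarrow> prodset K U = {a \<in> U. rr a \<in> K}"
  unfolding prodset_def copen0_iff using rng_comp_left bisec_in src_unit rr_rr rng_in
  by (auto simp: subset_iff) metis+

text \<open>An inverse of a in U composes with b in U only if a and b have the same range, which
  forces a = b.\<close>

lemma prodset_iv:
  assumes "bisec U" shows "prodset (iv ` U) U = ss ` U"
proof
  show "prodset (iv ` U) U \<subseteq> ss ` U"
    using bisec_in[OF assms] bisec_eq[OF assms leg_rr] by (auto simp: prodset_def src_inv comp_inv_left)
       (metis comp_inv_left imageI)
  show "ss ` U \<subseteq> prodset (iv ` U) U"
    using bisec_in[OF assms] by (auto simp: prodset_def) (metis comp_inv_left imageI src_inv)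
qed

end

section \<open>Convolution and fibrewise sums\<close>

lemma DG_simps [simp]:
  "carrier (DG G) = CcInf (gtop G)" "f \<otimes>\<^bsub>DG G\<^esub> g = conv G f g" "\<zero>\<^bsub>DG G\<^esub> = (\<lambda>_. 0)"
  "f \<oplus>\<^bsub>DG G\<^esub> g = (\<lambda>x. f x + g x)" "c \<odot>\<^bsub>DG G\<^esub> f = (\<lambda>x. c * f x)"
  by (simp_all add: DG_def Cc_def)

lemma vspace_DG: "vspace (DG G)"
proof -
  interpret module CC "CcG G" by (rule vspace_Cc)
  have "add_monoid (DG G) = add_monoid (CcG G)" by (simp add: DG_def Cc_def)
  then have "abelian_group (DG G)"
    using M.abelian_group_axioms by (simp add: abelian_group_def abelian_monoid_def abelian_group_axioms_def)
  then show ?thesis by (rule vspaceI) (auto simp: CcInf_smult algebra_simps)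
qed

lemma loc_const_cong:
  assumes "loc_const E f" "\<And>x. x \<in> topspace E \<Longrightarrow> g x = f x" shows "loc_const E g"
  using assms openin_subset unfolding loc_const_def by (smt (verit) subsetD)

context ample_groupoid
begin

abbreviation "CG \<equiv> CcInf (gtop G)"
abbreviation "CG0 \<equiv> CcInf (gtop0 G)"

sublocale units: copen_base "gtop0 G" "{K. copen (gtop0 G) K}"
  by unfold_locales (auto intro: copen_empty copen_Int elim: gtop0_copen_nhd)

lemma CG_induct [consumes 1, case_names indicator add]:
  assumes "f \<in> CG" "\<And>c U. bisec U \<Longrightarrow> P (\<lambda>x. c * indicator U x)"
    and "\<And>f g. f \<in> CG \<Longrightarrow> g \<in> CG \<Longrightarrow> P f \<Longrightarrow> P g \<Longrightarrow> P (\<lambda>x. f x + g x)"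
  shows "P f"
  by (rule bisecs.Cc_induct[OF assms(1)]) (use assms in auto)

lemma CG0_CG: "h \<in> CG0 \<Longrightarrow> h \<in> CG"
  by (simp add: CcInf0_iff)

lemma CG_indicator: "bisec U \<Longrightarrow> indicator U \<in> CG"
  by (intro indicator_CcInf bisec_copen)

lemma CG_loc_const_leg: "h \<in> CG0 \<Longrightarrow> leg p \<Longrightarrow> loc_const (gtop G) (h \<circ> p)"
  using loc_const_compose[OF leg_continuous CcInf_loc_const] by (simp add: o_def)

lemma pmult_leg_CG: "f \<in> CG \<Longrightarrow> h \<in> CG0 \<Longrightarrow> leg p \<Longrightarrow> pmult f (h \<circ> p) \<in> CG"
  by (intro CcInf_pmult CG_loc_const_leg)

lemma finite_bisec_fibre: "bisec U \<Longrightarrow> leg p \<Longrightarrow> finite {a \<in> U. p a = x}"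
  by (rule inj_on_finite[of p _ "{x}"]) (auto simp: inj_on_def dest: bisec_eq)

lemma finite_fibre: "f \<in> CG \<Longrightarrow> leg p \<Longrightarrow> finite {a. p a = x \<and> f a \<noteq> 0}"
proof (induction f rule: CG_induct)
  case (indicator c U)
  have "{a. p a = x \<and> c * indicator U a \<noteq> 0} \<subseteq> {a \<in> U. p a = x}" by (auto simp: indicator_def)
  then show ?case using finite_bisec_fibre[OF indicator(1,2)] finite_subset by blast
next
  case (add f g)
  have "{a. p a = x \<and> f a + g a \<noteq> 0} \<subseteq> {a. p a = x \<and> f a \<noteq> 0} \<union> {a. p a = x \<and> g a \<noteq> 0}" by auto
  then show ?case using add by (meson finite_Un finite_subset)
qed

subsection \<open>Summation along the legs\<close>

text \<open>\<open>lam\<close> for an arbitrary leg; for the range it agrees with \<open>lam\<close>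
  on C_c(G) (\<open>lam_eq\<close>). The source version reads off coordinates of elements of C_c(G)
  \<otimes>^s M.\<close>

definition lamp :: "('a \<Rightarrow> 'a) \<Rightarrow> ('a \<Rightarrow> complex) \<Rightarrow> 'a \<Rightarrow> complex"
  where "lamp p f = (\<lambda>x. \<Sum>a | p a = x \<and> f a \<noteq> 0. f a)"

lemma lamp_eq:
  "finite S \<Longrightarrow> (\<And>a. p a = x \<Longrightarrow> f a \<noteq> 0 \<Longrightarrow> a \<in> S) \<Longrightarrow> (\<And>a. a \<in> S \<Longrightarrow> p a = x) \<Longrightarrow> lamp p f x = sum f S"
  unfolding lamp_def by (rule sum.mono_neutral_left) auto

lemma lamp_add:
  assumes "f \<in> CG" "g \<in> CG" "leg p" shows "lamp p (\<lambda>a. f a + g a) = (\<lambda>x. lamp p f x + lamp p g x)"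
proof
  fix x
  let ?S = "{a. p a = x \<and> f a \<noteq> 0} \<union> {a. p a = x \<and> g a \<noteq> 0}"
  have S: "finite ?S" using finite_fibre assms by auto
  have l: "lamp p q x = sum q ?S" if "\<And>a. q a \<noteq> 0 \<Longrightarrow> f a \<noteq> 0 \<or> g a \<noteq> 0" for q
    by (rule lamp_eq[OF S]) (use that in blast)+
  have "lamp p f x = sum f ?S" "lamp p g x = sum g ?S" "lamp p (\<lambda>a. f a + g a) x = (\<Sum>a\<in>?S. f a + g a)"
    by (rule l, force)+
  then show "lamp p (\<lambda>a. f a + g a) x = lamp p f x + lamp p g x" by (simp only: sum.distrib)
qed

lemma lamp_smult: "lamp p (\<lambda>a. c * f a) = (\<lambda>x. c * lamp p f x)"
  by (cases "c = 0") (simp_all add: lamp_def sum_distrib_left)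

lemma lamp_indicator:
  assumes "bisec U" "leg p" shows "lamp p (indicator U) = indicator (p ` U)"
proof
  fix x
  show "lamp p (indicator U) x = indicator (p ` U) x"
  proof (cases "x \<in> p ` U")
    case True
    then obtain a where a: "a \<in> U" "x = p a" by auto
    have "lamp p (indicator U) x = sum (indicator U) {a}"
      by (rule lamp_eq) (use a bisec_eq[OF assms] in \<open>auto simp: indicator_def split: if_splits\<close>)
    then show ?thesis using a by simp
  next
    case False
    have "lamp p (indicator U) x = sum (indicator U) {}"
      by (rule lamp_eq) (use False in \<open>auto simp: indicator_def split: if_splits\<close>)
    then show ?thesis using False by simp
  qed
qed

lemma lamp_closed: "f \<in> CG \<Longrightarrow> leg p \<Longrightarrow> lamp p f \<in> CG0"
  by (induction f rule: CG_induct)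
    (auto simp: lamp_smult lamp_indicator lamp_add intro!: CcInf_smult CcInf_add indicator_CcInf bisec_leg_image)

lemma lamp_pmult: "f \<in> CG \<Longrightarrow> leg p \<Longrightarrow> lamp p (pmult f (h \<circ> p)) = pmult (lamp p f) h"
proof
  fix x assume "f \<in> CG" "leg p"
  then have "lamp p (pmult f (h \<circ> p)) x = sum (pmult f (h \<circ> p)) {a. p a = x \<and> f a \<noteq> 0}"
    by (intro lamp_eq finite_fibre) (auto simp: pmult_def)
  also have "\<dots> = pmult (lamp p f) h x" by (simp add: lamp_def pmult_def sum_distrib_right)
  finally show "lamp p (pmult f (h \<circ> p)) x = pmult (lamp p f) h x" .
qed

lemma lam_eq: "f \<in> CG \<Longrightarrow> lam G f = lamp rr f"
proof
  fix x assume f: "f \<in> CG"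
  have "{a \<in> XX. rr a = x \<and> f a \<noteq> 0} = {a. rr a = x \<and> f a \<noteq> 0}" using CcInf_supp[OF f] by auto
  moreover have "x \<notin> gunits G \<Longrightarrow> {a. rr a = x \<and> f a \<noteq> 0} = {}" using CcInf_supp[OF f] rng_in by auto
  ultimately show "lam G f x = lamp rr f x" by (auto simp: lam_def lamp_def)
qed

subsection \<open>Convolution\<close>

lemma conv_off: "a \<notin> XX \<Longrightarrow> conv G f g a = 0"
  by (simp add: conv_def)

text \<open>The index set is left free, so that it may be a single arrow or a set common to several
  functions.\<close>

lemma conv_eq:
  assumes "f \<in> CG" "a \<in> XX" "finite S" "\<And>b. b \<in> S \<Longrightarrow> b \<in> XX \<and> rr b = rr a"
    and "\<And>b. b \<in> XX \<Longrightarrow> rr b = rr a \<Longrightarrow> f b \<noteq> 0 \<Longrightarrow> g (iv b \<diamond> a) \<noteq> 0 \<Longrightarrow> b \<in> S"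
  shows "conv G f g a = (\<Sum>b\<in>S. f b * g (iv b \<diamond> a))"
proof -
  have fin: "finite {b \<in> XX. rr b = rr a \<and> f b \<noteq> 0}"
    by (rule finite_subset[OF _ finite_fibre[OF assms(1) leg_rr, of "rr a"]]) auto
  have "(\<Sum>b | b \<in> XX \<and> rr b = rr a \<and> f b \<noteq> 0. f b * g (iv b \<diamond> a)) = (\<Sum>b\<in>S. f b * g (iv b \<diamond> a))"
  proof (rule sum.mono_neutral_cong[OF assms(3) fin])
    fix b assume "b \<in> S - {b \<in> XX. rr b = rr a \<and> f b \<noteq> 0}"
    then show "f b * g (iv b \<diamond> a) = 0" using assms(4)[of b] by force
  next
    fix b assume "b \<in> {b \<in> XX. rr b = rr a \<and> f b \<noteq> 0} - S"
    then show "f b * g (iv b \<diamond> a) = 0" using assms(5)[of b] by force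
  qed simp
  then show ?thesis using assms(2) by (simp add: conv_def)
qed

lemma conv_fibre:
  "f \<in> CG \<Longrightarrow> a \<in> XX \<Longrightarrow> finite S \<Longrightarrow> {b. rr b = rr a \<and> f b \<noteq> 0} \<subseteq> S \<Longrightarrow> S \<subseteq> {b \<in> XX. rr b = rr a} \<Longrightarrow>
    conv G f g a = (\<Sum>b\<in>S. f b * g (iv b \<diamond> a))"
  by (rule conv_eq) auto

lemma conv_add_left:
  assumes "f \<in> CG" "f' \<in> CG" shows "conv G (\<lambda>x. f x + f' x) g = (\<lambda>x. conv G f g x + conv G f' g x)"
proof
  fix a
  show "conv G (\<lambda>x. f x + f' x) g a = conv G f g a + conv G f' g a"
  proof (cases "a \<in> XX")
    case True
    let ?S = "{b. rr b = rr a \<and> f b \<noteq> 0} \<union> {b. rr b = rr a \<and> f' b \<noteq> 0}"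
    have S: "finite ?S" "?S \<subseteq> {b \<in> XX. rr b = rr a}"
      using finite_fibre assms leg_rr CcInf_supp[OF assms(1)] CcInf_supp[OF assms(2)] by auto
    have "conv G (\<lambda>x. f x + f' x) g a = (\<Sum>b\<in>?S. (f b + f' b) * g (iv b \<diamond> a))"
      by (rule conv_fibre[OF CcInf_add[OF assms] True S(1) _ S(2)]) auto
    moreover have "conv G f g a = (\<Sum>b\<in>?S. f b * g (iv b \<diamond> a))"
      by (rule conv_fibre[OF assms(1) True S(1) _ S(2)]) auto
    moreover have "conv G f' g a = (\<Sum>b\<in>?S. f' b * g (iv b \<diamond> a))"
      by (rule conv_fibre[OF assms(2) True S(1) _ S(2)]) auto
    ultimately show ?thesis by (simp add: sum.distrib distrib_right)
  qed (simp add: conv_off)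
qed

lemma conv_smult_left: "conv G (\<lambda>x. c * f x) g = (\<lambda>x. c * conv G f g x)"
  by (cases "c = 0") (auto simp: conv_def fun_eq_iff sum_distrib_left mult.assoc)

lemma conv_add_right: "conv G f (\<lambda>x. g x + g' x) = (\<lambda>x. conv G f g x + conv G f g' x)"
  by (auto simp: conv_def fun_eq_iff sum.distrib distrib_left)

lemma conv_smult_right: "conv G f (\<lambda>x. c * g x) = (\<lambda>x. c * conv G f g x)"
  by (auto simp: conv_def fun_eq_iff sum_distrib_left intro!: sum.cong)

lemma conv_indicator:
  assumes U: "bisec U" and a: "a \<in> XX"
  shows "b \<in> U \<Longrightarrow> rr b = rr a \<Longrightarrow> conv G (indicator U) g a = g (iv b \<diamond> a)"
    and "(\<And>b. b \<in> U \<Longrightarrow> rr b \<noteq> rr a) \<Longrightarrow> conv G (indicator U) g a = 0"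
proof -
  show "conv G (indicator U) g a = g (iv b \<diamond> a)" if "b \<in> U" "rr b = rr a"
  proof -
    have "conv G (indicator U) g a = (\<Sum>b\<in>{b}. indicator U b * g (iv b \<diamond> a))"
      by (rule conv_eq[OF CG_indicator[OF U] a])
        (use that bisec_in[OF U] bisec_eq[OF U leg_rr] in \<open>auto simp: indicator_def split: if_splits\<close>)
    then show ?thesis using that by simp
  qed
  show "conv G (indicator U) g a = 0" if "\<And>b. b \<in> U \<Longrightarrow> rr b \<noteq> rr a"
  proof -
    have "conv G (indicator U) g a = (\<Sum>b\<in>{}. indicator U b * g (iv b \<diamond> a))"
      by (rule conv_eq[OF CG_indicator[OF U] a]) (use that in \<open>auto simp: indicator_def split: if_splits\<close>)
    then show ?thesis by simp
  qed
qed

text \<open>The only possible summand at \<open>a\<close> comes from the arrow \<open>b\<close> of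
  \<open>U\<close> with the same range, and \<open>iv b \<diamond> a \<in> V\<close> says exactly
  that \<open>a\<close> factors through \<open>U\<close> and \<open>V\<close>.\<close>

lemma conv_indicators:
  assumes U: "bisec U" and V: "bisec V"
  shows "conv G (indicator U) (indicator V) = indicator (prodset U V)"
proof
  fix a
  show "conv G (indicator U) (indicator V) a = indicator (prodset U V) a"
  proof (cases "a \<in> XX \<and> (\<exists>b\<in>U. rr b = rr a)")
    case True
    then obtain b where b: "a \<in> XX" "b \<in> U" "rr b = rr a" by blast
    have bX: "b \<in> XX" using bisec_in[OF U b(2)] .
    have "a \<in> prodset U V \<longleftrightarrow> iv b \<diamond> a \<in> V"
    proof
      assume "a \<in> prodset U V"
      then obtain b' c where c: "a = b' \<diamond> c" "b' \<in> U" "c \<in> V" "ss b' = rr c" by (auto simp: prodset_def)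
      then have "b' = b" using bisec_eq[OF U leg_rr] b(2,3) rr_mul bisec_in U V by metis
      then show "iv b \<diamond> a \<in> V" using c iv_mul_cancel bX bisec_in[OF V] by simp
    next
      assume "iv b \<diamond> a \<in> V"
      moreover have "b \<diamond> (iv b \<diamond> a) = a" "ss b = rr (iv b \<diamond> a)"
        using mul_iv_cancel rr_iv_mul bX b by auto
      ultimately show "a \<in> prodset U V" using b(2) unfolding prodset_def by force
    qed
    then show ?thesis using conv_indicator(1)[OF U b] by (simp add: indicator_def)
  next
    case False
    have "a \<notin> prodset U V"
      using False bisec_in U V by (auto simp: prodset_def mul_closed rr_mul)
    moreover have "conv G (indicator U) (indicator V) a = 0"
      using False conv_off conv_indicator(2)[OF U] by metis
    ultimately show ?thesis by simp
  qed
qed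

lemma conv_closed: "f \<in> CG \<Longrightarrow> g \<in> CG \<Longrightarrow> conv G f g \<in> CG"
proof (induction f rule: CG_induct)
  case (indicator c U)
  from indicator(2) have "conv G (indicator U) g \<in> CG"
  proof (induction g rule: CG_induct)
    case (indicator d V)
    then show ?case using \<open>bisec U\<close>
      by (simp add: conv_smult_right conv_indicators CcInf_smult CG_indicator bisec_prodset)
  qed (simp add: conv_add_right CcInf_add)
  then show ?case by (simp add: conv_smult_left CcInf_smult)
qed (simp add: conv_add_left CcInf_add)

text \<open>As \<open>h\<close> lives on the units, the summand at \<open>b = rr a\<close> is the
  only one that can be nonzero.\<close>

lemma conv_unit_left:
  assumes "h \<in> CG0" "g \<in> CG" shows "conv G h g = pmult g (h \<circ> rr)"
proof
  fix a
  have hu: "b = rr b" if "h b \<noteq> 0" for b using assms(1) that rng_unit by (metis CcInf0_iff)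
  show "conv G h g a = pmult g (h \<circ> rr) a"
  proof (cases "a \<in> XX")
    case True
    have "conv G h g a = (\<Sum>b\<in>{rr a}. h b * g (iv b \<diamond> a))"
      by (rule conv_eq[OF CG0_CG[OF assms(1)] True])
        (use True rng_in unit_in rr_rr hu in force)+
    then show ?thesis using True rng_in iv_unit rng_comp_left by (simp add: pmult_def)
  next
    case False then show ?thesis using assms(2) by (simp add: conv_off pmult_def CcInf_zero_off)
  qed
qed

subsection \<open>Functions on fibre products\<close>

abbreviation "C2 p \<equiv> CcInf (fibprod G p rr)"
abbreviation "ext \<equiv> ext_prod G"

lemma ext_apply: "ext p f g (a, b) = (if a \<in> XX \<and> b \<in> XX \<and> p a = rr b then f a * g b else 0)"
  by (simp add: ext_prod_def topspace_fibprod)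

lemma ext_closed:
  assumes "leg p" "f \<in> CG" "g \<in> CG" shows "ext p f g \<in> C2 p"
proof (rule CcInfI)
  show "loc_const (fibprod G p rr) (ext p f g)"
    by (rule loc_const_cong[OF loc_const_comp2[where h = "(*)",
          OF loc_const_compose[OF fst_continuous CcInf_loc_const[OF assms(2)]]
             loc_const_compose[OF snd_continuous CcInf_loc_const[OF assms(3)]]]])
       (auto simp: ext_prod_def)
  show "copen (fibprod G p rr) (rect p {a. f a \<noteq> 0} {a. g a \<noteq> 0})"
    by (intro copen_rect assms(1) copen_supp assms(2,3))
qed (auto simp: ext_prod_def rect_def topspace_fibprod split: if_splits)

lemma ext_add_left: "ext p (\<lambda>x. f x + f' x) g = (\<lambda>x. ext p f g x + ext p f' g x)"
  and ext_smult_left: "ext p (\<lambda>x. c * f x) g = (\<lambda>x. c * ext p f g x)"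
  by (auto simp: ext_prod_def fun_eq_iff algebra_simps)

lemma ext_leg: "ext p (pmult f (h \<circ> p)) g = ext p f (pmult g (h \<circ> rr))"
  by (auto simp: ext_prod_def pmult_def topspace_fibprod fun_eq_iff)

lemma ext_indicators: "bisec U \<Longrightarrow> bisec V \<Longrightarrow> ext p (indicator U) (indicator V) = indicator (rect p U V)"
  using bisec_in by (auto simp: ext_prod_def rect_def topspace_fibprod indicator_def fun_eq_iff)

lemma C2_induct [consumes 2, case_names ext add]:
  assumes "k \<in> C2 p" "leg p"
    and "\<And>c U V. bisec U \<Longrightarrow> bisec V \<Longrightarrow> P (ext p (\<lambda>x. c * indicator U x) (indicator V))"
    and "\<And>k k'. k \<in> C2 p \<Longrightarrow> k' \<in> C2 p \<Longrightarrow> P k \<Longrightarrow> P k' \<Longrightarrow> P (\<lambda>x. k x + k' x)"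
  shows "P k"
proof -
  interpret copen_base "fibprod G p rr" "{rect p U V | U V. bisec U \<and> bisec V}"
    by (rule copen_base_rect[OF assms(2)])
  from assms(1) show ?thesis
  proof (induction rule: Cc_induct)
    case (indicator c R)
    then obtain U V where "R = rect p U V" "bisec U" "bisec V" by blast
    then show ?case using assms(3)[of U V c] by (simp add: ext_smult_left ext_indicators)
  qed (rule assms(4))
qed

lemma finite_C2_fibre: "k \<in> C2 p \<Longrightarrow> leg p \<Longrightarrow> finite {c. rr c = x \<and> k (a, c) \<noteq> 0}"
proof (induction k rule: C2_induct)
  case (ext c U V)
  have "{d. rr d = x \<and> ext p (\<lambda>x. c * indicator U x) (indicator V) (a, d) \<noteq> 0} \<subseteq> {d \<in> V. rr d = x}"
    by (auto simp: ext_apply indicator_def split: if_splits)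
  then show ?case using finite_bisec_fibre[OF ext(2) leg_rr] finite_subset by blast
next
  case (add k k')
  have "{c. rr c = x \<and> k (a, c) + k' (a, c) \<noteq> 0} \<subseteq> {c. rr c = x \<and> k (a, c) \<noteq> 0} \<union> {c. rr c = x \<and> k' (a, c) \<noteq> 0}" by auto
  then show ?case using add by (meson finite_Un finite_subset)
qed

lemma rconv_apply:
  "rconv G p k g (a, b) = (if a \<in> XX \<and> b \<in> XX \<and> p a = rr b then
     (\<Sum>c | c \<in> XX \<and> rr c = rr b \<and> k (a, c) \<noteq> 0. k (a, c) * g (iv c \<diamond> b)) else 0)"
  by (simp add: rconv_def topspace_fibprod)

text \<open>Where \<open>f a\<close> is nonzero both sums run over the same arrows, those at which
  \<open>g\<close> does not vanish; elsewhere both sides are zero.\<close>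

lemma rconv_ext: "rconv G p (ext p f g) g' = ext p f (conv G g g')"
proof (rule, safe)
  fix a b
  show "rconv G p (ext p f g) g' (a, b) = ext p f (conv G g g') (a, b)"
  proof (cases "a \<in> XX \<and> b \<in> XX \<and> p a = rr b \<and> f a \<noteq> 0")
    case True
    then have "{c. c \<in> XX \<and> rr c = rr b \<and> ext p f g (a, c) \<noteq> 0} = {c. c \<in> XX \<and> rr c = rr b \<and> g c \<noteq> 0}"
      by (auto simp: ext_apply)
    then have "rconv G p (ext p f g) g' (a, b) =
        (\<Sum>c | c \<in> XX \<and> rr c = rr b \<and> g c \<noteq> 0. ext p f g (a, c) * g' (iv c \<diamond> b))"
      using True by (simp add: rconv_apply)
    also have "\<dots> = (\<Sum>c | c \<in> XX \<and> rr c = rr b \<and> g c \<noteq> 0. f a * (g c * g' (iv c \<diamond> b)))"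
      by (rule sum.cong) (use True in \<open>auto simp: ext_apply\<close>)
    also have "\<dots> = ext p f (conv G g g') (a, b)"
      using True by (simp add: ext_apply conv_def sum_distrib_left)
    finally show ?thesis .
  qed (auto simp: rconv_apply ext_apply intro!: sum.neutral)
qed

lemma rconv_add_left:
  assumes "k \<in> C2 p" "k' \<in> C2 p" "leg p"
  shows "rconv G p (\<lambda>x. k x + k' x) g = (\<lambda>x. rconv G p k g x + rconv G p k' g x)"
proof (rule, safe)
  fix a b
  show "rconv G p (\<lambda>x. k x + k' x) g (a, b) = rconv G p k g (a, b) + rconv G p k' g (a, b)"
  proof (cases "a \<in> XX \<and> b \<in> XX \<and> p a = rr b")
    case True
    let ?S = "{c \<in> XX. rr c = rr b \<and> k (a, c) \<noteq> 0} \<union> {c \<in> XX. rr c = rr b \<and> k' (a, c) \<noteq> 0}"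
    have S: "finite ?S"
      using finite_C2_fibre[OF assms(1,3), of "rr b" a] finite_C2_fibre[OF assms(2,3), of "rr b" a]
      by (auto intro: finite_subset[rotated])
    have *: "(\<Sum>c | c \<in> XX \<and> rr c = rr b \<and> q c \<noteq> 0. q c * g (iv c \<diamond> b)) = (\<Sum>c\<in>?S. q c * g (iv c \<diamond> b))"
      if "\<And>c. q c \<noteq> 0 \<Longrightarrow> k (a, c) \<noteq> 0 \<or> k' (a, c) \<noteq> 0" for q
      by (rule sum.mono_neutral_left[OF S]) (use that in auto)
    have "(\<Sum>c | c \<in> XX \<and> rr c = rr b \<and> k (a, c) + k' (a, c) \<noteq> 0. (k (a, c) + k' (a, c)) * g (iv c \<diamond> b)) =
        (\<Sum>c\<in>?S. (k (a, c) + k' (a, c)) * g (iv c \<diamond> b))"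
      by (rule *[of "\<lambda>c. k (a, c) + k' (a, c)"]) force
    with True *[of "\<lambda>c. k (a, c)"] *[of "\<lambda>c. k' (a, c)"] show ?thesis
      by (simp add: rconv_apply sum.distrib[symmetric] distrib_right)
  qed (auto simp: rconv_apply)
qed

lemma rconv_closed:
  assumes k: "k \<in> C2 p" and p: "leg p" and g: "g \<in> CG" shows "rconv G p k g \<in> C2 p"
  using k p
proof (induction k rule: C2_induct)
  case (ext c U V)
  then show ?case using p g by (auto simp: rconv_ext intro!: ext_closed conv_closed CG_indicator CcInf_smult)
next
  case (add k k')
  then show ?case by (simp add: rconv_add_left[OF _ _ p] CcInf_add)
qed

text \<open>The restriction of \<open>k\<close> to pairs with first entry in \<open>U\<close>, seen
  as a function of the second entry. On a bisection the sum has at most one term, since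
  \<open>b\<close> determines the point of \<open>U\<close> that pairs with it.\<close>

definition slice :: "('a \<Rightarrow> 'a) \<Rightarrow> 'a set \<Rightarrow> ('a \<times> 'a \<Rightarrow> complex) \<Rightarrow> 'a \<Rightarrow> complex"
  where "slice p U k = (\<lambda>b. if b \<in> XX then \<Sum>a | a \<in> U \<and> p a = rr b. k (a, b) else 0)"

lemma slice_in:
  assumes "bisec U" "leg p" "a \<in> U" "b \<in> XX" "p a = rr b" shows "slice p U k b = k (a, b)"
proof -
  have "{a \<in> U. p a = rr b} = {a}" using assms bisec_eq[OF assms(1,2)] by auto
  then show ?thesis using assms(4) by (simp add: slice_def)
qed

lemma slice_out: "(\<And>a. a \<in> U \<Longrightarrow> p a \<noteq> rr b) \<Longrightarrow> slice p U k b = 0"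
  by (auto simp: slice_def intro!: sum.neutral)

lemma slice_add: "slice p U (\<lambda>x. k x + k' x) = (\<lambda>x. slice p U k x + slice p U k' x)"
  by (auto simp: slice_def sum.distrib)

lemma slice_smult: "slice p U (\<lambda>x. c * k x) = (\<lambda>x. c * slice p U k x)"
  by (auto simp: slice_def sum_distrib_left)

text \<open>The point of \<open>U\<close> over \<open>rr b\<close> contributes the factor
  \<open>f a\<close>, which is the value at \<open>rr b\<close> of the fibrewise sum of
  \<open>f\<close> cut down to \<open>U\<close>. Writing the result as a convolution lets its action
  on a module split into two successive actions.\<close>

lemma slice_ext:
  assumes U: "bisec U" and p: "leg p" and f: "f \<in> CG" and g: "g \<in> CG"
  shows "slice p U (ext p f g) = conv G (lamp p (pmult (indicator U) f)) g"
proof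
  fix b
  have Uf: "pmult (indicator U) f \<in> CG" using CcInf_pmult[OF CG_indicator[OF U] CcInf_loc_const[OF f]] .
  have e: "conv G (lamp p (pmult (indicator U) f)) g = pmult g (lamp p (pmult (indicator U) f) \<circ> rr)"
    by (rule conv_unit_left[OF lamp_closed[OF Uf p] g])
  show "slice p U (ext p f g) b = conv G (lamp p (pmult (indicator U) f)) g b"
  proof (cases "b \<in> XX \<and> (\<exists>a\<in>U. p a = rr b)")
    case True
    then obtain a where a: "b \<in> XX" "a \<in> U" "p a = rr b" by blast
    have "lamp p (pmult (indicator U) f) (rr b) = sum (pmult (indicator U) f) {a}"
      by (rule lamp_eq) (use a bisec_eq[OF U p] in \<open>auto simp: pmult_def indicator_def split: if_splits\<close>)
    then show ?thesis using a bisec_in[OF U] unfolding e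
      by (simp add: slice_in[OF U p a(2,1,3)] ext_apply pmult_def mult.commute)
  next
    case False
    have "b \<in> XX \<Longrightarrow> lamp p (pmult (indicator U) f) (rr b) = sum (pmult (indicator U) f) {}"
      by (rule lamp_eq) (use False in \<open>auto simp: pmult_def indicator_def split: if_splits\<close>)
    then show ?thesis unfolding e using False slice_out[of U p b] CcInf_zero_off[OF g]
      by (cases "b \<in> XX") (auto simp: pmult_def slice_def)
  qed
qed

lemma slice_closed:
  assumes k: "k \<in> C2 p" and p: "leg p" and U: "bisec U" shows "slice p U k \<in> CG"
  using k p
proof (induction k rule: C2_induct)
  case (ext c V W)
  have "pmult (indicator U) (\<lambda>x. c * indicator V x) \<in> CG"
    using CcInf_pmult[OF CG_indicator[OF U] CcInf_loc_const[OF CcInf_smult[OF CG_indicator[OF ext(1)]]]] .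
  then show ?case
    unfolding slice_ext[OF U p CcInf_smult[OF CG_indicator[OF ext(1)]] CG_indicator[OF ext(2)]]
    by (intro conv_closed CG_indicator ext(2) CG0_CG[OF lamp_closed[OF _ p]])
qed (simp add: slice_add CcInf_add)

lemma slice_rconv:
  assumes k: "k \<in> C2 p" and p: "leg p" and U: "bisec U"
  shows "slice p U (rconv G p k g) = conv G (slice p U k) g"
proof
  fix b
  show "slice p U (rconv G p k g) b = conv G (slice p U k) g b"
  proof (cases "b \<in> XX")
    case b: True
    show ?thesis
    proof (cases "\<exists>a\<in>U. p a = rr b")
      case True
      then obtain a where a: "a \<in> U" "p a = rr b" by blast
      have s: "c \<in> XX \<Longrightarrow> rr c = rr b \<Longrightarrow> slice p U k c = k (a, c)" for c
        using slice_in[OF U p a(1)] a(2) by simp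
      have "conv G (slice p U k) g b =
          (\<Sum>c | c \<in> XX \<and> rr c = rr b \<and> k (a, c) \<noteq> 0. slice p U k c * g (iv c \<diamond> b))"
        using b s by (auto simp: conv_def intro!: sum.cong)
      also have "\<dots> = rconv G p k g (a, b)" using a b bisec_in[OF U] s by (simp add: rconv_apply)
      finally show ?thesis using slice_in[OF U p a(1) b a(2)] by simp
    next
      case False
      then have "c \<in> XX \<Longrightarrow> rr c = rr b \<Longrightarrow> slice p U k c = 0" for c by (intro slice_out) auto
      then have "conv G (slice p U k) g b = 0" using b by (auto simp: conv_def intro!: sum.neutral)
      then show ?thesis using slice_out[of U p b] False by auto
    qed
  qed (simp add: slice_def conv_off)
qed

subsection \<open>The shear map\<close>

lemma can_map_apply: "can_map G k (a, b) = (if a \<in> XX \<and> b \<in> XX \<and> ss a = rr b then k (a, a \<diamond> b) else 0)"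
  by (simp add: can_map_def topspace_fibprod)

text \<open>Composition with the homeomorphism (a, b) \<mapsto> (a, ab) of fibre products, whose
  inverse is (a, c) \<mapsto> (a, a^{-1}c).\<close>

lemma can_map_closed:
  assumes "k \<in> C2 rr" shows "can_map G k \<in> C2 ss"
proof -
  have "(\<lambda>x. if x \<in> topspace (gtop2 G) then k (fst x, fst x \<diamond> snd x) else 0) \<in> C2 ss"
  proof (rule CcInf_homeomorphic[OF _ _ _ _ assms])
    show "continuous_map (gtop2 G) (fibprod G rr rr) (\<lambda>x. (fst x, fst x \<diamond> snd x))"
      by (intro continuous_fibprodI fst_continuous mul_continuous) (auto simp: topspace_fibprod rr_mul)
    show "continuous_map (fibprod G rr rr) (gtop2 G) (\<lambda>x. (fst x, iv (fst x) \<diamond> snd x))"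
      by (intro continuous_fibprodI fst_continuous iv_mul_continuous) (auto simp: topspace_fibprod rr_iv_mul)
  qed (auto simp: topspace_fibprod iv_mul_cancel mul_iv_cancel)
  also have "(\<lambda>x. if x \<in> topspace (gtop2 G) then k (fst x, fst x \<diamond> snd x) else 0) = can_map G k"
    by (auto simp: can_map_def fun_eq_iff)
  finally show ?thesis .
qed

lemma can_map_add: "can_map G (\<lambda>x. k x + k' x) = (\<lambda>x. can_map G k x + can_map G k' x)"
  and can_map_smult: "can_map G (\<lambda>x. c * k x) = (\<lambda>x. c * can_map G k x)"
  by (auto simp: can_map_def fun_eq_iff)

text \<open>Left multiplication by \<open>a\<close> carries the range fibre over \<open>ss a\<close>
  bijectively to the one over \<open>rr a\<close>, and (ac)^{-1}(ab) = c^{-1}b leaves the second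
  factor of each summand unchanged.\<close>

lemma can_map_rconv: "can_map G (rconv G rr k g) = rconv G ss (can_map G k) g"
proof (rule, safe)
  fix a b
  show "can_map G (rconv G rr k g) (a, b) = rconv G ss (can_map G k) g (a, b)"
  proof (cases "a \<in> XX \<and> b \<in> XX \<and> ss a = rr b")
    case True
    then have ab: "a \<in> XX" "b \<in> XX" "ss a = rr b" by auto
    have e: "iv (a \<diamond> c) \<diamond> (a \<diamond> b) = iv c \<diamond> b" if c: "c \<in> XX" "rr c = rr b" for c
    proof -
      have "a \<diamond> b = (a \<diamond> c) \<diamond> (iv c \<diamond> b)"
        using ab c by (simp add: mul_assoc iv_mul_closed rr_iv_mul mul_iv_cancel)
      then show ?thesis using ab c by (simp add: iv_mul_cancel mul_closed iv_mul_closed ss_mul rr_iv_mul)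
    qed
    have "can_map G (rconv G rr k g) (a, b) =
        (\<Sum>c | c \<in> XX \<and> rr c = rr a \<and> k (a, c) \<noteq> 0. k (a, c) * g (iv c \<diamond> (a \<diamond> b)))"
      using ab by (simp add: can_map_apply rconv_apply mul_closed rr_mul)
    also have "\<dots> = (\<Sum>c | c \<in> XX \<and> rr c = rr b \<and> can_map G k (a, c) \<noteq> 0. can_map G k (a, c) * g (iv c \<diamond> b))"
      by (rule sum.reindex_bij_witness[of _ "\<lambda>c. a \<diamond> c" "\<lambda>c. iv a \<diamond> c"])
         (use ab e in \<open>auto simp: can_map_apply iv_mul_cancel mul_iv_cancel rr_iv_mul iv_mul_closed mul_closed rr_mul\<close>,
          metis e iv_mul_closed mul_iv_cancel rr_iv_mul)
    also have "\<dots> = rconv G ss (can_map G k) g (a, b)" using ab by (simp add: rconv_apply)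
    finally show ?thesis .
  qed (auto simp: can_map_apply rconv_apply)
qed

text \<open>The point where the inverse bisection enters. For \<open>a\<close> in \<open>U\<close>
  with \<open>ss a = rr b\<close>, the arrow of the inverse of \<open>U\<close> with the range of
  \<open>b\<close> is \<open>iv a\<close>, so convolution by its indicator evaluates
  \<open>e\<close> at \<open>a \<diamond> b\<close>.\<close>

lemma can_map_ext:
  assumes U: "bisec U" and e: "e \<in> CG"
  shows "can_map G (ext rr (indicator U) e) = ext ss (indicator U) (conv G (indicator (iv ` U)) e)"
proof (rule, safe)
  fix a b
  show "can_map G (ext rr (indicator U) e) (a, b) = ext ss (indicator U) (conv G (indicator (iv ` U)) e) (a, b)"
  proof (cases "a \<in> U \<and> b \<in> XX \<and> ss a = rr b")
    case True
    then have ab: "a \<in> U" "b \<in> XX" "ss a = rr b" by auto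
    have a: "a \<in> XX" using bisec_in[OF U ab(1)] .
    have "conv G (indicator (iv ` U)) e b = e (iv (iv a) \<diamond> b)"
      by (rule conv_indicator(1)[OF bisec_iv[OF U] ab(2)]) (use ab a in \<open>auto simp: rng_inv\<close>)
    then show ?thesis using ab a by (simp add: can_map_apply ext_apply mul_closed rr_mul iv_iv)
  qed (auto simp: can_map_apply ext_apply)
qed

end

section \<open>Essential modules over algebras with local units\<close>

text \<open>A unit for \<open>a\<close> is required at all sufficiently large \<open>K\<close>, so
  that finitely many elements share one. Both instances take compact open sets of units for
  \<open>K\<close>.\<close>

locale local_units =
  fixes R :: "(complex, 'r, 'z) module_scheme" and \<K> :: "'k set set" and u :: "'k set \<Rightarrow> 'r"
  assumes vsp: "vspace R" and mult_closed: "a \<in> carrier R \<Longrightarrow> b \<in> carrier R \<Longrightarrow> a \<otimes>\<^bsub>R\<^esub> b \<in> carrier R"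
    and u_closed: "K \<in> \<K> \<Longrightarrow> u K \<in> carrier R"
    and \<K>_empty: "{} \<in> \<K>" and \<K>_Un: "K \<in> \<K> \<Longrightarrow> L \<in> \<K> \<Longrightarrow> K \<union> L \<in> \<K>"
    and u_unit: "a \<in> carrier R \<Longrightarrow> \<exists>K0\<in>\<K>. \<forall>K\<in>\<K>. K0 \<subseteq> K \<longrightarrow> u K \<otimes>\<^bsub>R\<^esub> a = a"

lemma alg_moduleD:
  assumes "alg_module R M"
  shows "vspace M"
    and "a \<in> carrier R \<Longrightarrow> x \<in> carrier M \<Longrightarrow> lact M a x \<in> carrier M"
    and "a \<in> carrier R \<Longrightarrow> x \<in> carrier M \<Longrightarrow> y \<in> carrier M \<Longrightarrow>
      lact M a (x \<oplus>\<^bsub>M\<^esub> y) = lact M a x \<oplus>\<^bsub>M\<^esub> lact M a y"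
    and "a \<in> carrier R \<Longrightarrow> b \<in> carrier R \<Longrightarrow> x \<in> carrier M \<Longrightarrow>
      lact M (a \<oplus>\<^bsub>R\<^esub> b) x = lact M a x \<oplus>\<^bsub>M\<^esub> lact M b x"
    and "a \<in> carrier R \<Longrightarrow> x \<in> carrier M \<Longrightarrow> lact M (c \<odot>\<^bsub>R\<^esub> a) x = c \<odot>\<^bsub>M\<^esub> lact M a x"
    and "a \<in> carrier R \<Longrightarrow> x \<in> carrier M \<Longrightarrow> lact M a (c \<odot>\<^bsub>M\<^esub> x) = c \<odot>\<^bsub>M\<^esub> lact M a x"
    and "a \<in> carrier R \<Longrightarrow> b \<in> carrier R \<Longrightarrow> x \<in> carrier M \<Longrightarrow>
      lact M (a \<otimes>\<^bsub>R\<^esub> b) x = lact M a (lact M b x)"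
  using assms by (auto simp: alg_module_def)

lemma bilin_lact: "alg_module R M \<Longrightarrow> bilin R M M (lact M)"
  by (intro bilinI linmapI) (auto simp: alg_moduleD)

context local_units
begin

lemma btens_rtensor: "alg_module R M \<Longrightarrow> btens R M (carrier R) (mult R) (lact M)"
  by (intro btens.intro two_vspaces.intro btens_axioms.intro) (auto simp: alg_moduleD vsp mult_closed)

lemma mult_map:
  assumes "alg_module R M"
  shows "mult_map R M \<in> lin (rtensor R M) M"
    "a \<in> carrier R \<Longrightarrow> x \<in> carrier M \<Longrightarrow> mult_map R M (rpure R M a x) = lact M a x"
  unfolding mult_map_def rtensor_def rpure_def
  using btens.the_lin_btensor[OF btens_rtensor[OF assms] alg_moduleD(1)[OF assms] bilin_lact[OF assms]]
  by (auto simp: alg_moduleD(7)[OF assms])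

text \<open>If u is a left unit for a, then a \<otimes> x = ua \<otimes> x = u \<otimes> ax. A
  tensor is thus recovered from its image under multiplication, although the u that does it depends
  on the tensor.\<close>

lemma rtensor_unit:
  assumes M: "alg_module R M" and t: "t \<in> carrier (rtensor R M)"
  shows "\<exists>K0\<in>\<K>. \<forall>K\<in>\<K>. K0 \<subseteq> K \<longrightarrow> rpure R M (u K) (mult_map R M t) = t \<and> lact M (u K) (mult_map R M t) = mult_map R M t"
proof -
  interpret btens R M "carrier R" "mult R" "lact M" by (rule btens_rtensor[OF M])
  let ?m = "mult_map R M"
  note m = linmapD[OF lin_linmap[OF mult_map(1)[OF M]], unfolded rtensor_def]
  have mp: "?m (bp a x) = lact M a x" if "a \<in> carrier R" "x \<in> carrier M" for a x
    using mult_map(2)[OF M that] by (simp add: rpure_def)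
  from t show ?thesis
    unfolding rtensor_def rpure_def
  proof (induction rule: btensor_induct)
    case (pure a x)
    obtain K0 where K0: "K0 \<in> \<K>" "\<And>K. K \<in> \<K> \<Longrightarrow> K0 \<subseteq> K \<Longrightarrow> u K \<otimes>\<^bsub>R\<^esub> a = a"
      using u_unit[OF pure(1)] by blast
    show ?case
    proof (intro bexI[OF _ K0(1)] ballI impI)
      fix K assume K: "K \<in> \<K>" "K0 \<subseteq> K"
      have "bp (u K) (lact M a x) = bp (u K \<otimes>\<^bsub>R\<^esub> a) x" using bpure_bal[OF u_closed[OF K(1)] pure] by (rule sym)
      moreover have "lact M (u K) (lact M a x) = lact M (u K \<otimes>\<^bsub>R\<^esub> a) x"
        using alg_moduleD(7)[OF M u_closed[OF K(1)] pure] by (rule sym)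
      ultimately show "bp (u K) (?m (bp a x)) = bp a x \<and> lact M (u K) (?m (bp a x)) = ?m (bp a x)"
        unfolding mp[OF pure] K0(2)[OF K] by blast
    qed
  next
    case (add x y)
    obtain K1 where K1: "K1 \<in> \<K>" "\<forall>K\<in>\<K>. K1 \<subseteq> K \<longrightarrow> bp (u K) (?m x) = x \<and> lact M (u K) (?m x) = ?m x"
      using add(3) by (rule bexE)
    obtain K2 where K2: "K2 \<in> \<K>" "\<forall>K\<in>\<K>. K2 \<subseteq> K \<longrightarrow> bp (u K) (?m y) = y \<and> lact M (u K) (?m y) = ?m y"
      using add(4) by (rule bexE)
    show ?case
    proof (intro bexI[of _ "K1 \<union> K2"] ballI impI \<K>_Un K1(1) K2(1))
      fix L assume L: "L \<in> \<K>" "K1 \<union> K2 \<subseteq> L"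
      note c = u_closed[OF L(1)] m(1)[OF add(1)] m(1)[OF add(2)]
      show "bp (u L) (?m (x \<oplus>\<^bsub>BT\<^esub> y)) = x \<oplus>\<^bsub>BT\<^esub> y \<and> lact M (u L) (?m (x \<oplus>\<^bsub>BT\<^esub> y)) = ?m (x \<oplus>\<^bsub>BT\<^esub> y)"
        using K1(2)[rule_format, OF L(1)] K2(2)[rule_format, OF L(1)] L(2)
        unfolding m(2)[OF add(1,2)] bpure_simps(3)[OF c] alg_moduleD(3)[OF M c] by simp
    qed
  qed
qed

text \<open>With local units the multiplication map is injective for every module, by
  \<open>rtensor_unit\<close> with a unit common to two tensors. What remains of being essential is
  surjectivity, and every vector in the image is fixed by some local unit.\<close>

lemma essential_iff:
  assumes M: "alg_module R M"
  shows "essential R M \<longleftrightarrow> (\<forall>x\<in>carrier M. \<exists>K\<in>\<K>. lact M (u K) x = x)"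
proof -
  interpret btens R M "carrier R" "mult R" "lact M" by (rule btens_rtensor[OF M])
  note mm = mult_map[OF M]
  have inj: "inj_on (mult_map R M) (carrier (rtensor R M))"
  proof (rule inj_onI)
    fix s t assume st: "s \<in> carrier (rtensor R M)" "t \<in> carrier (rtensor R M)" "mult_map R M s = mult_map R M t"
    obtain K1 where K1: "K1 \<in> \<K>" "\<forall>K\<in>\<K>. K1 \<subseteq> K \<longrightarrow> rpure R M (u K) (mult_map R M s) = s \<and>
        lact M (u K) (mult_map R M s) = mult_map R M s" using rtensor_unit[OF M st(1)] by (rule bexE)
    obtain K2 where K2: "K2 \<in> \<K>" "\<forall>K\<in>\<K>. K2 \<subseteq> K \<longrightarrow> rpure R M (u K) (mult_map R M t) = t \<and>
        lact M (u K) (mult_map R M t) = mult_map R M t" using rtensor_unit[OF M st(2)] by (rule bexE)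
    have "K1 \<union> K2 \<in> \<K>" using K1(1) K2(1) by (rule \<K>_Un)
    with K1(2) K2(2) st(3) show "s = t" by (metis Un_upper1 Un_upper2)
  qed
  show ?thesis
  proof
    assume "essential R M"
    then have "bij_betw (mult_map R M) (carrier (rtensor R M)) (carrier M)" by (simp add: essential_def)
    then have surj: "mult_map R M ` carrier (rtensor R M) = carrier M" by (rule bij_betw_imp_surj_on)
    show "\<forall>x\<in>carrier M. \<exists>K\<in>\<K>. lact M (u K) x = x"
    proof
      fix x assume "x \<in> carrier M"
      then obtain t where t: "t \<in> carrier (rtensor R M)" "x = mult_map R M t" using surj by (metis imageE)
      show "\<exists>K\<in>\<K>. lact M (u K) x = x" using rtensor_unit[OF M t(1)] unfolding t(2) by blast
    qed
  next
    assume *: "\<forall>x\<in>carrier M. \<exists>K\<in>\<K>. lact M (u K) x = x"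
    have "x \<in> mult_map R M ` carrier (rtensor R M)" if x: "x \<in> carrier M" for x
    proof -
      obtain K where "K \<in> \<K>" "lact M (u K) x = x" using * x by blast
      then show ?thesis using mm(2)[OF u_closed x] bpure_simps(1)[OF u_closed x, folded rpure_def rtensor_def] by force
    qed
    then have "mult_map R M ` carrier (rtensor R M) = carrier M"
      using linmapD(1)[OF lin_linmap[OF mm(1)]] by blast
    then show "essential R M" using M inj by (simp add: essential_def bij_betw_def)
  qed
qed

lemma essential_units:
  assumes "essential R M" "x \<in> carrier M"
  shows "\<exists>K0\<in>\<K>. \<forall>K\<in>\<K>. K0 \<subseteq> K \<longrightarrow> lact M (u K) x = x"
proof -
  have M: "alg_module R M" and "bij_betw (mult_map R M) (carrier (rtensor R M)) (carrier M)"
    using assms by (auto simp: essential_def)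
  then obtain t where t: "t \<in> carrier (rtensor R M)" "x = mult_map R M t" 
    using assms(2) by (metis bij_betw_imp_surj_on imageE)
  show ?thesis using rtensor_unit[OF M t(1)] unfolding t(2) by blast
qed

end

context ample_groupoid
begin

lemma pmult_indicator_supp: "(\<And>x. f x \<noteq> 0 \<Longrightarrow> x \<in> K) \<Longrightarrow> pmult (indicator K) f = f"
  by (auto simp: pmult_def indicator_def fun_eq_iff)

sublocale units0: local_units "CcG0 G" "{K. copen (gtop0 G) K}" indicator
proof (rule local_units.intro)
  fix a assume a: "a \<in> carrier (CcG0 G)"
  show "\<exists>K0\<in>{K. copen (gtop0 G) K}. \<forall>K\<in>{K. copen (gtop0 G) K}. K0 \<subseteq> K \<longrightarrow> indicator K \<otimes>\<^bsub>CcG0 G\<^esub> a = a"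
    using a copen_supp by (intro bexI[of _ "{x. a x \<noteq> 0}"]) (auto intro!: pmult_indicator_supp)
qed (auto simp: vspace_Cc CcInf_pmult CcInf_loc_const indicator_CcInf copen_empty copen_Un)

text \<open>Under convolution, \<open>K\<close> is a left unit for \<open>a\<close> once it contains
  the ranges of the support of \<open>a\<close>. As the family of units is the same as for C_c(G0),
  restricting the action preserves essential modules.\<close>

sublocale unitsD: local_units "DG G" "{K. copen (gtop0 G) K}" indicator
proof (rule local_units.intro)
  fix a assume a: "a \<in> carrier (DG G)"
  have "indicator K \<otimes>\<^bsub>DG G\<^esub> a = a" if "copen (gtop0 G) K" "rr ` {x. a x \<noteq> 0} \<subseteq> K" for K
    using that a by (auto simp: conv_unit_left indicator_CcInf pmult_def indicator_def fun_eq_iff)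
  then show "\<exists>K0\<in>{K. copen (gtop0 G) K}. \<forall>K\<in>{K. copen (gtop0 G) K}. K0 \<subseteq> K \<longrightarrow> indicator K \<otimes>\<^bsub>DG G\<^esub> a = a"
    using a copen_leg_image[OF copen_supp leg_rr] by (intro bexI[of _ "rr ` {x. a x \<noteq> 0}"]) auto
qed (auto simp: vspace_DG conv_closed copen_empty copen_Un CG0_CG indicator_CcInf)

text \<open>On functions supported on units, convolution is the pointwise product.\<close>

lemma alg_module_DG_CcG0:
  assumes "alg_module (DG G) M" shows "alg_module (CcG0 G) M"
proof -
  have *: "pmult h h' = conv G h h'" if "h \<in> CG0" "h' \<in> CG0" for h h'
    using that rng_unit by (auto simp: conv_unit_left[OF that(1) CG0_CG[OF that(2)]] pmult_def fun_eq_iff CcInf0_iff)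
       (metis)
  show ?thesis
    using assms unfolding alg_module_def by (auto simp: CG0_CG *)
qed

lemma essential_DG_CcG0:
  assumes "essential (DG G) M" shows "essential (CcG0 G) M"
proof -
  have M: "alg_module (DG G) M" using assms by (simp add: essential_def)
  then show ?thesis
    using assms unfolding unitsD.essential_iff[OF M] units0.essential_iff[OF alg_module_DG_CcG0[OF M]] by blast
qed

end

section \<open>Pulled-back modules\<close>

text \<open>The record scheme is left open, so that the results apply to modules over D(G) and to
  comodules alike.\<close>

locale unitary_module = ample_groupoid G
  for G :: "'g groupoid" +
  fixes M :: "('g \<Rightarrow> complex, 'm, 'z) alg_mod_scheme"
  assumes ess: "essential (CcG0 G) M"
begin

abbreviation act (infixr "\<rhd>" 75) where "h \<rhd> x \<equiv> lact M h x"

lemma alg_M: "alg_module (CcG0 G) M"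
  using ess by (simp add: essential_def)

lemma vspM: "vspace M"
  using alg_moduleD(1)[OF alg_M] .

lemmas act_simps = alg_moduleD(2-7)[OF alg_M, simplified]
lemmas act_closed = act_simps(1)
lemmas addM_closed = abelian_monoid.a_closed[OF abelian_group.axioms(1)[OF vspaceD(1)[OF vspM]]]

lemma act_unit: "x \<in> carrier M \<Longrightarrow> \<exists>K0. copen (gtop0 G) K0 \<and> (\<forall>K. copen (gtop0 G) K \<longrightarrow> K0 \<subseteq> K \<longrightarrow> indicator K \<rhd> x = x)"
  using units0.essential_units[OF ess] by auto

abbreviation "PT E p \<equiv> ptensor G E p M"
abbreviation "pp E p \<equiv> ppure G E p M"
abbreviation "PG p \<equiv> ptensor G (gtop G) p M"
abbreviation "pg p \<equiv> ppure G (gtop G) p M"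

lemma ptensor_alt: "ptensor G E p M = btensor (Cc E) M CG0 (\<lambda>f h. pmult f (h \<circ> p)) (lact M)"
  and ppure_alt: "ppure G E p M = bpure (Cc E) M CG0 (\<lambda>f h. pmult f (h \<circ> p)) (lact M)"
  by (simp_all add: ptensor_def ppure_def)

lemma btens_ptensor:
  assumes "continuous_map E (gtop0 G) p"
  shows "btens (Cc E) M CG0 (\<lambda>f h. pmult f (h \<circ> p)) (lact M)"
proof -
  have "h \<in> CG0 \<Longrightarrow> loc_const E (h \<circ> p)" for h
    using loc_const_compose[OF assms CcInf_loc_const] by (simp add: o_def)
  then show ?thesis
    by (intro btens.intro two_vspaces.intro btens_axioms.intro) (auto simp: vspace_Cc vspM act_closed CcInf_pmult)
qed

lemmas vspace_PT = btens.vspace_btensor[OF btens_ptensor, folded ptensor_alt]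
lemmas pp_simps = btens.bpure_simps[OF btens_ptensor, folded ptensor_alt ppure_alt, simplified]
lemmas pp_bal = btens.bpure_bal[OF btens_ptensor, folded ptensor_alt ppure_alt, simplified]
lemmas PT_induct = btens.btensor_induct[OF btens_ptensor, folded ptensor_alt ppure_alt, simplified,
    consumes 2, case_names pure add]
lemmas PT_linmap_eqI = btens.linmap_eqI[OF btens_ptensor, folded ptensor_alt ppure_alt, simplified]
lemmas PT_the_lin = btens.the_lin_btensor[OF btens_ptensor, folded ptensor_alt ppure_alt]

lemma PT_add_closed:
  assumes "continuous_map E (gtop0 G) p" "x \<in> carrier (PT E p)" "y \<in> carrier (PT E p)"
  shows "x \<oplus>\<^bsub>PT E p\<^esub> y \<in> carrier (PT E p)"
  by (rule abelian_monoid.a_closed[OF abelian_group.axioms(1)[OF vspaceD(1)[OF vspace_PT[OF assms(1)]]] assms(2,3)])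

lemma cact:
  assumes p: "leg p" and g: "loc_const (gtop G) g"
  shows "cact G p M g \<in> lin (PG p) (PG p)"
    "f \<in> CG \<Longrightarrow> x \<in> carrier M \<Longrightarrow> cact G p M g (pg p f x) = pg p (pmult g f) x"
proof -
  note c = leg_continuous[OF p]
  have gf: "f \<in> CG \<Longrightarrow> pmult g f \<in> CG" for f using CcInf_pmult[OF _ g] pmult_commute by metis
  have e: "pmult g (\<lambda>x. f x + f' x) = (\<lambda>x. pmult g f x + pmult g f' x)"
    "pmult g (\<lambda>x. c * f x) = (\<lambda>x. c * pmult g f x)" for f f' c
    by (auto simp: pmult_def algebra_simps)
  have b: "bilin (CcG G) M (PG p) (\<lambda>f x. pg p (pmult g f) x)"
    by (intro bilinI linmapI) (simp_all add: gf e pp_simps[OF c])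
  have "pg p (pmult g (pmult f (h \<circ> p))) x = pg p (pmult g f) (h \<rhd> x)" if "f \<in> CG" "h \<in> CG0" "x \<in> carrier M" for f h x
    using pp_bal[OF c gf[OF that(1)] that(2,3)] by (simp add: pmult_assoc)
  from PT_the_lin[OF c vspace_PT[OF c] b] this
  show "cact G p M g \<in> lin (PG p) (PG p)"
    "f \<in> CG \<Longrightarrow> x \<in> carrier M \<Longrightarrow> cact G p M g (pg p f x) = pg p (pmult g f) x"
    unfolding cact_def by auto
qed

end

lemma linmap_add:
  assumes W: "vspace W" and f: "linmap V W f" and g: "linmap V W g"
  shows "linmap V W (\<lambda>x. f x \<oplus>\<^bsub>W\<^esub> g x)"
proof -
  interpret W: abelian_group W using W by (rule vspaceD)
  note c = linmapD(1)[OF f] linmapD(1)[OF g]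
  show ?thesis
    by (rule linmapI)
       (simp_all add: c linmapD(2,3)[OF f] linmapD(2,3)[OF g] W.a_ac vspaceD(4)[OF W])
qed

lemma linmap_inv_into:
  assumes V: "vspace V" and f: "linmap V W f" and b: "bij_betw f (carrier V) (carrier W)"
  shows "linmap W V (inv_into (carrier V) f)"
proof (rule linmapI)
  interpret V: abelian_group V using V by (rule vspaceD)
  let ?g = "inv_into (carrier V) f"
  have g: "?g y \<in> carrier V" "f (?g y) = y" if "y \<in> carrier W" for y
    using b that by (auto simp: bij_betw_def inv_into_into f_inv_into_f)
  have gf: "?g (f x) = x" if "x \<in> carrier V" for x using b that by (simp add: bij_betw_def)
  show "?g x \<in> carrier V" if "x \<in> carrier W" for x using g that by blast
  show "?g (x \<oplus>\<^bsub>W\<^esub> y) = ?g x \<oplus>\<^bsub>V\<^esub> ?g y" if "x \<in> carrier W" "y \<in> carrier W" for x y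
    using gf[of "?g x \<oplus>\<^bsub>V\<^esub> ?g y"] linmapD(2)[OF f g(1)[OF that(1)] g(1)[OF that(2)]] g that by simp
  show "?g (c \<odot>\<^bsub>W\<^esub> x) = c \<odot>\<^bsub>V\<^esub> ?g x" if "x \<in> carrier W" for c x
    using gf[of "c \<odot>\<^bsub>V\<^esub> ?g x"] linmapD(3)[OF f g(1)[OF that]] g that vspaceD(2)[OF V] by simp
qed

context ample_groupoid
begin

text \<open>Each fibre of \<open>p\<close> meets \<open>U\<close> at most once, so a function
  supported on \<open>U\<close> is recovered from its fibrewise sums.\<close>

lemma lamp_bisec:
  assumes U: "bisec U" and p: "leg p" and f: "\<And>a. f a \<noteq> 0 \<Longrightarrow> a \<in> U"
  shows "pmult (indicator U) (lamp p f \<circ> p) = f"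
proof
  fix a
  show "pmult (indicator U) (lamp p f \<circ> p) a = f a"
  proof (cases "a \<in> U")
    case True
    have "lamp p f (p a) = sum f {a}"
      by (rule lamp_eq) (use True f bisec_eq[OF U p _ True] in auto)
    then show ?thesis using True by (simp add: pmult_def)
  next
    case False
    then show ?thesis using f[of a] by (auto simp: pmult_def)
  qed
qed

lemma CG_pmult_indicator: "bisec U \<Longrightarrow> f \<in> CG \<Longrightarrow> pmult (indicator U) f \<in> CG"
  by (rule CcInf_pmult[OF CG_indicator CcInf_loc_const])

lemma bisec_loc_const: "bisec U \<Longrightarrow> loc_const (gtop G) (indicator U)"
  by (auto simp: bisec_def copen_def intro: loc_const_indicator)

lemma bisec_Diff: assumes "bisec U" "copen (gtop G) K" shows "bisec (U - K)"
proof (rule bisec_mono[OF assms(1)])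
  have "copen (gtop G) (U \<inter> (XX - K))"
    using assms(2) by (intro copen_clopen_Int bisec_copen assms(1)) (auto simp: copen_def)
  also have "U \<inter> (XX - K) = U - K" using bisec_in[OF assms(1)] by auto
  finally show "copen (gtop G) (U - K)" .
qed auto

end

context unitary_module
begin

lemmas PG_vspace = vspace_PT[OF leg_continuous]
lemmas pg_simps = pp_simps[OF leg_continuous]
lemmas pg_closed = pg_simps(1)
lemmas pg_bal = pp_bal[OF leg_continuous]
lemmas PG_linmap_eqI = PT_linmap_eqI[OF leg_continuous]
lemmas PG_add_closed = PT_add_closed[OF leg_continuous]

lemma PG_induct [consumes 2, case_names pure add]:
  assumes "t \<in> carrier (PG p)" "leg p" "\<And>f x. f \<in> CG \<Longrightarrow> x \<in> carrier M \<Longrightarrow> P (pg p f x)"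
    and "\<And>s t. s \<in> carrier (PG p) \<Longrightarrow> t \<in> carrier (PG p) \<Longrightarrow> P s \<Longrightarrow> P t \<Longrightarrow> P (s \<oplus>\<^bsub>PG p\<^esub> t)"
  shows "P t"
  by (rule PT_induct[OF leg_continuous[OF assms(2)] assms(1,3,4)])

lemmas cact_linmap = lin_linmap[OF cact(1)]
lemmas cact_simps = linmapD[OF cact_linmap]

text \<open>Functions are sums of multiples of indicators of bisections, and the scalar is moved
  into the module.\<close>

lemma PG_bisec_induct [consumes 2, case_names indicator add]:
  assumes t: "t \<in> carrier (PG p)" and p: "leg p"
    and ind: "\<And>U x. bisec U \<Longrightarrow> x \<in> carrier M \<Longrightarrow> P (pg p (indicator U) x)"
    and add: "\<And>s t. s \<in> carrier (PG p) \<Longrightarrow> t \<in> carrier (PG p) \<Longrightarrow> P s \<Longrightarrow> P t \<Longrightarrow> P (s \<oplus>\<^bsub>PG p\<^esub> t)"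
  shows "P t"
  using t p
proof (induction rule: PG_induct)
  case (pure f x)
  then show ?case
  proof (induction f rule: CG_induct)
    case (indicator c U)
    have "pg p (\<lambda>a. c * indicator U a) x = pg p (indicator U) (c \<odot>\<^bsub>M\<^esub> x)"
      using pg_simps(4)[OF p CG_indicator[OF indicator(1)] indicator(2)]
        pg_simps(5)[OF p CG_indicator[OF indicator(1)] indicator(2)] by simp
    then show ?case using ind[OF indicator(1) vspaceD(2)[OF vspM indicator(2)]] by simp
  next
    case (add f g)
    then show ?case unfolding pg_simps(2)[OF p add(1,2,5)]
      by (intro assms(4) pg_closed p add)
  qed
qed (rule add)

lemma cact_add:
  assumes p: "leg p" and g: "loc_const (gtop G) g" "loc_const (gtop G) g'" and t: "t \<in> carrier (PG p)"
  shows "cact G p M (\<lambda>x. g x + g' x) t = cact G p M g t \<oplus>\<^bsub>PG p\<^esub> cact G p M g' t"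
proof (rule PG_linmap_eqI[OF p PG_vspace[OF p] _ _ _ t])
  have s: "loc_const (gtop G) (\<lambda>x. g x + g' x)" by (rule loc_const_comp2[OF g])
  show "linmap (PG p) (PG p) (cact G p M (\<lambda>x. g x + g' x))" by (rule cact_linmap[OF p s])
  show "linmap (PG p) (PG p) (\<lambda>t. cact G p M g t \<oplus>\<^bsub>PG p\<^esub> cact G p M g' t)"
    by (intro linmap_add PG_vspace p cact_linmap g)
  fix f x assume fx: "f \<in> CG" "x \<in> carrier M"
  have e: "pmult (\<lambda>x. g x + g' x) f = (\<lambda>x. pmult g f x + pmult g' f x)" by (auto simp: pmult_def algebra_simps)
  have "pmult g f \<in> CG" "pmult g' f \<in> CG" using CcInf_pmult[OF fx(1)] g by (simp_all add: pmult_commute[of _ f])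
  then show "cact G p M (\<lambda>x. g x + g' x) (pg p f x) = cact G p M g (pg p f x) \<oplus>\<^bsub>PG p\<^esub> cact G p M g' (pg p f x)"
    unfolding cact(2)[OF p s fx] cact(2)[OF p g(1) fx] cact(2)[OF p g(2) fx] e using fx by (intro pg_simps(2) p)
qed

lemma cact_unit:
  assumes t: "t \<in> carrier (PG p)" and p: "leg p"
  shows "\<exists>K0. copen (gtop G) K0 \<and> (\<forall>K. copen (gtop G) K \<longrightarrow> K0 \<subseteq> K \<longrightarrow> cact G p M (indicator K) t = t)"
  using t p
proof (induction rule: PG_induct)
  case (pure f x)
  show ?case
  proof (intro exI conjI allI impI)
    show "copen (gtop G) {a. f a \<noteq> 0}" using pure(1) by (rule copen_supp)
    fix K assume K: "copen (gtop G) K" "{a. f a \<noteq> 0} \<subseteq> K"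
    have "pmult (indicator K) f = f" by (rule pmult_indicator_supp) (use K(2) in auto)
    then show "cact G p M (indicator K) (pg p f x) = pg p f x"
      using cact(2)[OF p CcInf_loc_const[OF indicator_CcInf[OF K(1)]] pure] by simp
  qed
next
  case (add s t)
  from add(3) obtain K1 where K1: "copen (gtop G) K1"
    "\<forall>K. copen (gtop G) K \<longrightarrow> K1 \<subseteq> K \<longrightarrow> cact G p M (indicator K) s = s" by (elim exE conjE)
  from add(4) obtain K2 where K2: "copen (gtop G) K2"
    "\<forall>K. copen (gtop G) K \<longrightarrow> K2 \<subseteq> K \<longrightarrow> cact G p M (indicator K) t = t" by (elim exE conjE)
  show ?case
  proof (intro exI conjI allI impI)
    show "copen (gtop G) (K1 \<union> K2)" by (rule copen_Un[OF K1(1) K2(1)])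
    fix K assume K: "copen (gtop G) K" "K1 \<union> K2 \<subseteq> K"
    show "cact G p M (indicator K) (s \<oplus>\<^bsub>PG p\<^esub> t) = s \<oplus>\<^bsub>PG p\<^esub> t"
      unfolding cact_simps(2)[OF p CcInf_loc_const[OF indicator_CcInf[OF K(1)]] add(1,2)]
      using K1(2)[rule_format, OF K(1)] K2(2)[rule_format, OF K(1)] K(2) by simp
  qed
qed

text \<open>The coordinate map: on tensors supported on a bisection it gives the element of the
  corner of \<open>M\<close> representing them (\<open>cact_bisec\<close>). For the range it is the
  map used by the functor B (\<open>lam_tensor_ptrace\<close>).\<close>

definition ptrace :: "('g \<Rightarrow> 'g) \<Rightarrow> ('g \<Rightarrow> complex, 'm) btens \<Rightarrow> 'm"
  where "ptrace p = the_lin (PG p) M (\<lambda>F. \<forall>f\<in>carrier (CcG G). \<forall>x\<in>carrier M. F (pg p f x) = lamp p f \<rhd> x)"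

lemma ptrace:
  assumes p: "leg p"
  shows "ptrace p \<in> lin (PG p) M"
    "f \<in> CG \<Longrightarrow> x \<in> carrier M \<Longrightarrow> ptrace p (pg p f x) = lamp p f \<rhd> x"
proof -
  have b: "bilin (CcG G) M M (\<lambda>f x. lamp p f \<rhd> x)"
    by (intro bilinI linmapI) (simp_all add: lamp_add[OF _ _ p] lamp_smult lamp_closed[OF _ p] act_simps)
  have "lamp p (pmult f (h \<circ> p)) \<rhd> x = lamp p f \<rhd> h \<rhd> x" if "f \<in> CG" "h \<in> CG0" "x \<in> carrier M" for f h x
    using that by (simp add: lamp_pmult[OF _ p] lamp_closed[OF _ p] act_simps)
  from PT_the_lin[OF leg_continuous[OF p] vspM b] this
  show "ptrace p \<in> lin (PG p) M"
    "f \<in> CG \<Longrightarrow> x \<in> carrier M \<Longrightarrow> ptrace p (pg p f x) = lamp p f \<rhd> x"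
    unfolding ptrace_def by auto
qed

lemmas ptrace_linmap = lin_linmap[OF ptrace(1)]
lemmas ptrace_simps = linmapD[OF ptrace_linmap]

lemma ptrace_indicator:
  "leg p \<Longrightarrow> bisec U \<Longrightarrow> x \<in> carrier M \<Longrightarrow> ptrace p (pg p (indicator U) x) = indicator (p ` U) \<rhd> x"
  by (simp add: ptrace(2) CG_indicator lamp_indicator)

lemma pg_indicator_range:
  assumes "leg p" "bisec U" "x \<in> carrier M"
  shows "pg p (indicator U) (indicator (p ` U) \<rhd> x) = pg p (indicator U) x"
proof -
  have "pmult (indicator U) (indicator (p ` U) \<circ> p) = indicator U"
    by (auto simp: pmult_def indicator_def fun_eq_iff)
  then show ?thesis
    using pg_bal[OF assms(1) CG_indicator[OF assms(2)] indicator_CcInf[OF bisec_leg_image[OF assms(2,1)]] assms(3)] by simp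
qed

text \<open>A function supported on \<open>U\<close> is the indicator of \<open>U\<close> times the
  pullback of its fibrewise sum, and balancing moves that pullback over to the module.\<close>

lemma cact_bisec:
  assumes U: "bisec U" and p: "leg p" and t: "t \<in> carrier (PG p)"
  shows "cact G p M (indicator U) t = pg p (indicator U) (ptrace p (cact G p M (indicator U) t))"
proof (rule PG_linmap_eqI[OF p PG_vspace[OF p] cact_linmap[OF p bisec_loc_const[OF U]] _ _ t])
  have "linmap M (PG p) (pg p (indicator U))"
    using btens.bilin_bpure[OF btens_ptensor[OF leg_continuous[OF p]]] CG_indicator[OF U]
    by (simp add: bilin_def ptensor_alt ppure_alt)
  from linmap_comp[OF linmap_comp[OF cact_linmap[OF p bisec_loc_const[OF U]] ptrace_linmap[OF p]] this]
  show "linmap (PG p) (PG p) (\<lambda>t. pg p (indicator U) (ptrace p (cact G p M (indicator U) t)))"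
    by (simp add: o_def)
  fix f x assume fx: "f \<in> CG" "x \<in> carrier M"
  let ?f = "pmult (indicator U) f"
  have f: "?f \<in> CG" by (rule CG_pmult_indicator[OF U fx(1)])
  have "pg p (indicator U) (lamp p ?f \<rhd> x) = pg p (pmult (indicator U) (lamp p ?f \<circ> p)) x"
    using pg_bal[OF p CG_indicator[OF U] lamp_closed[OF f p] fx(2)] by simp
  also have "pmult (indicator U) (lamp p ?f \<circ> p) = ?f"
    by (rule lamp_bisec[OF U p]) (auto simp: pmult_def indicator_def split: if_splits)
  finally show "cact G p M (indicator U) (pg p f x) =
      pg p (indicator U) (ptrace p (cact G p M (indicator U) (pg p f x)))"
    unfolding cact(2)[OF p bisec_loc_const[OF U] fx] ptrace(2)[OF p f fx(2)] by simp
qed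

text \<open>Coordinates over bisections determine all restrictions to bisections, hence those to
  compact open sets: the union of \<open>U\<close> and \<open>K\<close> splits into
  \<open>U - K\<close>, again a bisection, and \<open>K\<close>. Restriction to a large enough
  compact open set fixes both elements.\<close>

lemma PG_eqI:
  assumes p: "leg p" and st: "s \<in> carrier (PG p)" "t \<in> carrier (PG p)"
    and e: "\<And>U. bisec U \<Longrightarrow> ptrace p (cact G p M (indicator U) s) = ptrace p (cact G p M (indicator U) t)"
  shows "s = t"
proof -
  have b: "cact G p M (indicator U) s = cact G p M (indicator U) t" if "bisec U" for U
    using cact_bisec[OF that p st(1)] cact_bisec[OF that p st(2)] e[OF that] by simp
  have K: "cact G p M (indicator K) s = cact G p M (indicator K) t" if "copen (gtop G) K" for K
    using that
  proof (induction rule: bisecs.copen_induct)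
    case (base U) then show ?case using b by simp
  next
    case (Un U K)
    have D: "bisec (U - K)" using bisec_Diff Un(1,2) by auto
    have "indicator (U \<union> K) = (\<lambda>x. indicator (U - K) x + indicator K x :: complex)"
      by (auto simp: indicator_def fun_eq_iff)
    then show ?case
      using cact_add[OF p bisec_loc_const[OF D] CcInf_loc_const[OF indicator_CcInf[OF Un(2)]] st(1)]
        cact_add[OF p bisec_loc_const[OF D] CcInf_loc_const[OF indicator_CcInf[OF Un(2)]] st(2)] b[OF D] Un(3)
      by simp
  qed
  obtain K1 where K1: "copen (gtop G) K1"
    "\<forall>K. copen (gtop G) K \<longrightarrow> K1 \<subseteq> K \<longrightarrow> cact G p M (indicator K) s = s" using cact_unit[OF st(1) p] by (elim exE conjE)
  obtain K2 where K2: "copen (gtop G) K2"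
    "\<forall>K. copen (gtop G) K \<longrightarrow> K2 \<subseteq> K \<longrightarrow> cact G p M (indicator K) t = t" using cact_unit[OF st(2) p] by (elim exE conjE)
  have "copen (gtop G) (K1 \<union> K2)" by (rule copen_Un[OF K1(1) K2(1)])
  then show ?thesis using K1(2) K2(2) K by (metis Un_upper1 Un_upper2)
qed

end

section \<open>The coaction of a module over the convolution algebra\<close>

locale groupoid_module = ample_groupoid G
  for G :: "'g groupoid" +
  fixes M :: "('g \<Rightarrow> complex, 'm, 'z) alg_mod_scheme"
  assumes essD: "essential (DG G) M"

sublocale groupoid_module \<subseteq> unitary_module
  by unfold_locales (rule essential_DG_CcG0[OF essD])

context groupoid_module
begin

lemma algD: "alg_module (DG G) M"
  using essD by (simp add: essential_def)

lemmas D_simps = alg_moduleD(2-7)[OF algD, simplified]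
lemmas D_closed = D_simps(1)

section \<open>Functions on fibre products, tensored over the convolution algebra\<close>

abbreviation "CT p \<equiv> ctensor G p M"
abbreviation "cp p \<equiv> cpure G p M"

lemma ctensor_alt: "ctensor G p M = btensor (Cc (fibprod G p rr)) M CG (rconv G p) (lact M)"
  and cpure_alt: "cpure G p M = bpure (Cc (fibprod G p rr)) M CG (rconv G p) (lact M)"
  by (simp_all add: ctensor_def cpure_def)

lemma btens_ctensor: "leg p \<Longrightarrow> btens (Cc (fibprod G p rr)) M CG (rconv G p) (lact M)"
  by (intro btens.intro two_vspaces.intro btens_axioms.intro) (auto simp: vspace_Cc vspM D_closed rconv_closed)

lemmas vspace_CT = btens.vspace_btensor[OF btens_ctensor, folded ctensor_alt]
lemmas cp_simps = btens.bpure_simps[OF btens_ctensor, folded ctensor_alt cpure_alt, simplified]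
lemmas cp_bal = btens.bpure_bal[OF btens_ctensor, folded ctensor_alt cpure_alt, simplified]
lemmas CT_induct_pure = btens.btensor_induct[OF btens_ctensor, folded ctensor_alt cpure_alt, simplified,
    consumes 2, case_names pure add]
lemmas CT_lift = btens.btensor_lift[OF btens_ctensor, folded ctensor_alt cpure_alt]
lemmas CT_the_lin = btens.the_lin_btensor[OF btens_ctensor, folded ctensor_alt cpure_alt]

lemma CT_induct [consumes 2, case_names ext add]:
  assumes t: "t \<in> carrier (CT p)" and p: "leg p"
    and ext: "\<And>f g x. f \<in> CG \<Longrightarrow> g \<in> CG \<Longrightarrow> x \<in> carrier M \<Longrightarrow> P (cp p (ext p f g) x)"
    and add: "\<And>s t. s \<in> carrier (CT p) \<Longrightarrow> t \<in> carrier (CT p) \<Longrightarrow> P s \<Longrightarrow> P t \<Longrightarrow> P (s \<oplus>\<^bsub>CT p\<^esub> t)"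
  shows "P t"
  using p t
proof (induction rule: CT_induct_pure)
  case (pure k x)
  from pure(1) p show ?case
  proof (induction k rule: C2_induct)
    case (ext c U V)
    then show ?case by (intro assms(3) CcInf_smult CG_indicator pure(2))
  next
    case (add k k')
    then show ?case unfolding cp_simps(2)[OF p add(1,2) pure(2)] by (intro assms(4) cp_simps(1) p pure(2))
  qed
qed (use p add in auto)

text \<open>Existence is by induction over \<open>k\<close> and uniqueness is \<open>PG_eqI\<close>.
  Since the condition sees \<open>k\<close> only through its slices, different decompositions of
  \<open>k\<close> into elementary functions cannot give different elements.\<close>

lemma ext_tensor_ex1:
  assumes p: "leg p" and k: "k \<in> C2 p" and x: "x \<in> carrier M"
  shows "\<exists>!t. t \<in> carrier (PG p) \<and> (\<forall>U. bisec U \<longrightarrow> ptrace p (cact G p M (indicator U) t) = slice p U k \<rhd> x)"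
proof (rule ex_ex1I)
  show "\<exists>t. t \<in> carrier (PG p) \<and> (\<forall>U. bisec U \<longrightarrow> ptrace p (cact G p M (indicator U) t) = slice p U k \<rhd> x)"
    using k p
  proof (induction k rule: C2_induct)
    case (ext c U V)
    let ?f = "\<lambda>a. c * indicator U a" and ?g = "indicator V"
    have f: "?f \<in> CG" and g: "?g \<in> CG" using ext by (auto intro: CcInf_smult CG_indicator)
    have gx: "?g \<rhd> x \<in> carrier M" by (rule D_closed[OF g x])
    show ?case
    proof (intro exI[of _ "pg p ?f (?g \<rhd> x)"] conjI allI impI)
      show "pg p ?f (?g \<rhd> x) \<in> carrier (PG p)" by (rule pg_closed[OF p f gx])
      fix W assume W: "bisec W"
      have Wf: "pmult (indicator W) ?f \<in> CG" by (rule CG_pmult_indicator[OF W f])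
      show "ptrace p (cact G p M (indicator W) (pg p ?f (?g \<rhd> x))) = slice p W (ext p ?f ?g) \<rhd> x"
        unfolding cact(2)[OF p bisec_loc_const[OF W] f gx] ptrace(2)[OF p Wf gx] slice_ext[OF W p f g]
        using D_simps(6)[OF CG0_CG[OF lamp_closed[OF Wf p]] g x] by simp
    qed
  next
    case (add k k')
    obtain s where s: "s \<in> carrier (PG p)" "\<forall>U. bisec U \<longrightarrow> ptrace p (cact G p M (indicator U) s) = slice p U k \<rhd> x"
      using add(3) by (elim exE conjE)
    obtain t where t: "t \<in> carrier (PG p)" "\<forall>U. bisec U \<longrightarrow> ptrace p (cact G p M (indicator U) t) = slice p U k' \<rhd> x"
      using add(4) by (elim exE conjE)
    show ?case
    proof (intro exI[of _ "s \<oplus>\<^bsub>PG p\<^esub> t"] conjI allI impI)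
      show "s \<oplus>\<^bsub>PG p\<^esub> t \<in> carrier (PG p)" by (rule PG_add_closed[OF p s(1) t(1)])
      fix W assume W: "bisec W"
      note l = bisec_loc_const[OF W]
      show "ptrace p (cact G p M (indicator W) (s \<oplus>\<^bsub>PG p\<^esub> t)) = slice p W (\<lambda>x. k x + k' x) \<rhd> x"
        unfolding cact_simps(2)[OF p l s(1) t(1)] slice_add
          ptrace_simps(2)[OF p cact_simps(1)[OF p l s(1)] cact_simps(1)[OF p l t(1)]]
        using D_simps(3)[OF slice_closed[OF add(1) p W] slice_closed[OF add(2) p W] x] s(2) t(2) W by simp
    qed
  qed
  fix s t
  assume s: "s \<in> carrier (PG p) \<and> (\<forall>U. bisec U \<longrightarrow> ptrace p (cact G p M (indicator U) s) = slice p U k \<rhd> x)"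
    and t: "t \<in> carrier (PG p) \<and> (\<forall>U. bisec U \<longrightarrow> ptrace p (cact G p M (indicator U) t) = slice p U k \<rhd> x)"
  show "s = t" by (rule PG_eqI[OF p]) (use s t in auto)
qed

text \<open>The element of \<open>C\<^sub>c\<^sup>\<infinity>(G) \<otimes>\<^sup>p M\<close> represented by \<open>k \<otimes> x\<close>; the slices of \<open>k\<close> along bisections determine it.\<close>

definition ext_tensor :: "('g \<Rightarrow> 'g) \<Rightarrow> ('g \<times> 'g \<Rightarrow> complex) \<Rightarrow> 'm \<Rightarrow> ('g \<Rightarrow> complex, 'm) btens"
  where "ext_tensor p k x = (THE t. t \<in> carrier (PG p) \<and>
     (\<forall>U. bisec U \<longrightarrow> ptrace p (cact G p M (indicator U) t) = slice p U k \<rhd> x))"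

lemma ext_tensor:
  assumes "leg p" "k \<in> C2 p" "x \<in> carrier M"
  shows "ext_tensor p k x \<in> carrier (PG p)"
    "bisec U \<Longrightarrow> ptrace p (cact G p M (indicator U) (ext_tensor p k x)) = slice p U k \<rhd> x"
  using theI'[OF ext_tensor_ex1[OF assms]] unfolding ext_tensor_def by auto

lemma ext_tensor_eqI:
  assumes "leg p" "k \<in> C2 p" "x \<in> carrier M" "t \<in> carrier (PG p)"
    "\<And>U. bisec U \<Longrightarrow> ptrace p (cact G p M (indicator U) t) = slice p U k \<rhd> x"
  shows "ext_tensor p k x = t"
  unfolding ext_tensor_def by (rule the1_equality[OF ext_tensor_ex1[OF assms(1-3)]]) (use assms(4,5) in auto)

lemma ext_tensor_ext:
  assumes p: "leg p" and f: "f \<in> CG" and g: "g \<in> CG" and x: "x \<in> carrier M"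
  shows "ext_tensor p (ext p f g) x = pg p f (g \<rhd> x)"
proof (rule ext_tensor_eqI[OF p ext_closed[OF p f g] x])
  have gx: "g \<rhd> x \<in> carrier M" by (rule D_closed[OF g x])
  show "pg p f (g \<rhd> x) \<in> carrier (PG p)" by (rule pg_closed[OF p f gx])
  fix W assume W: "bisec W"
  have Wf: "pmult (indicator W) f \<in> CG" by (rule CG_pmult_indicator[OF W f])
  show "ptrace p (cact G p M (indicator W) (pg p f (g \<rhd> x))) = slice p W (ext p f g) \<rhd> x"
    unfolding cact(2)[OF p bisec_loc_const[OF W] f gx] ptrace(2)[OF p Wf gx] slice_ext[OF W p f g]
    using D_simps(6)[OF CG0_CG[OF lamp_closed[OF Wf p]] g x] by simp
qed

text \<open>Each identity is tested on the traces over bisections, where it becomes linearity of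
  slices and of the action.\<close>

lemma bilin_ext_tensor:
  assumes p: "leg p" shows "bilin (Cc (fibprod G p rr)) M (PG p) (ext_tensor p)"
proof (intro bilinI linmapI, simp_all)
  fix k x assume k: "k \<in> C2 p" and x: "x \<in> carrier M"
  note e = ext_tensor[OF p k]
  show "ext_tensor p k x \<in> carrier (PG p)" by (rule e(1)[OF x])
  show "ext_tensor p k (x \<oplus>\<^bsub>M\<^esub> y) = ext_tensor p k x \<oplus>\<^bsub>PG p\<^esub> ext_tensor p k y" if y: "y \<in> carrier M" for y
  proof (rule ext_tensor_eqI[OF p k addM_closed[OF x y] PG_add_closed[OF p e(1)[OF x] e(1)[OF y]]])
    fix U assume U: "bisec U"
    note c = cact_simps[OF p bisec_loc_const[OF U]]
    show "ptrace p (cact G p M (indicator U) (ext_tensor p k x \<oplus>\<^bsub>PG p\<^esub> ext_tensor p k y)) = slice p U k \<rhd> (x \<oplus>\<^bsub>M\<^esub> y)"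
      unfolding c(2)[OF e(1)[OF x] e(1)[OF y]] ptrace_simps(2)[OF p c(1)[OF e(1)[OF x]] c(1)[OF e(1)[OF y]]]
        e(2)[OF x U] e(2)[OF y U] D_simps(2)[OF slice_closed[OF k p U] x y] ..
  qed
  show "ext_tensor p k (d \<odot>\<^bsub>M\<^esub> x) = d \<odot>\<^bsub>PG p\<^esub> ext_tensor p k x" for d
  proof (rule ext_tensor_eqI[OF p k vspaceD(2)[OF vspM x] vspaceD(2)[OF PG_vspace[OF p] e(1)[OF x]]])
    fix U assume U: "bisec U"
    note c = cact_simps[OF p bisec_loc_const[OF U]]
    show "ptrace p (cact G p M (indicator U) (d \<odot>\<^bsub>PG p\<^esub> ext_tensor p k x)) = slice p U k \<rhd> (d \<odot>\<^bsub>M\<^esub> x)"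
      unfolding c(3)[OF e(1)[OF x]] ptrace_simps(3)[OF p c(1)[OF e(1)[OF x]]] e(2)[OF x U]
        D_simps(5)[OF slice_closed[OF k p U] x] ..
  qed
  show "ext_tensor p (\<lambda>a. k a + k' a) x = ext_tensor p k x \<oplus>\<^bsub>PG p\<^esub> ext_tensor p k' x" if k': "k' \<in> C2 p" for k'
  proof (rule ext_tensor_eqI[OF p CcInf_add[OF k k'] x])
    note e' = ext_tensor[OF p k']
    show "ext_tensor p k x \<oplus>\<^bsub>PG p\<^esub> ext_tensor p k' x \<in> carrier (PG p)"
      by (rule PG_add_closed[OF p e(1)[OF x] e'(1)[OF x]])
    fix U assume U: "bisec U"
    note c = cact_simps[OF p bisec_loc_const[OF U]]
    show "ptrace p (cact G p M (indicator U) (ext_tensor p k x \<oplus>\<^bsub>PG p\<^esub> ext_tensor p k' x)) = slice p U (\<lambda>a. k a + k' a) \<rhd> x"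
      unfolding c(2)[OF e(1)[OF x] e'(1)[OF x]] ptrace_simps(2)[OF p c(1)[OF e(1)[OF x]] c(1)[OF e'(1)[OF x]]]
        e(2)[OF x U] e'(2)[OF x U] slice_add D_simps(3)[OF slice_closed[OF k p U] slice_closed[OF k' p U] x] ..
  qed
  show "ext_tensor p (\<lambda>a. d * k a) x = d \<odot>\<^bsub>PG p\<^esub> ext_tensor p k x" for d
  proof (rule ext_tensor_eqI[OF p CcInf_smult[OF k] x vspaceD(2)[OF PG_vspace[OF p] e(1)[OF x]]])
    fix U assume U: "bisec U"
    note c = cact_simps[OF p bisec_loc_const[OF U]]
    show "ptrace p (cact G p M (indicator U) (d \<odot>\<^bsub>PG p\<^esub> ext_tensor p k x)) = slice p U (\<lambda>a. d * k a) \<rhd> x"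
      unfolding c(3)[OF e(1)[OF x]] ptrace_simps(3)[OF p c(1)[OF e(1)[OF x]]] e(2)[OF x U]
        slice_smult D_simps(4)[OF slice_closed[OF k p U] x] ..
  qed
qed (rule ext_tensor(1)[OF p])

lemma ext_tensor_rconv:
  assumes p: "leg p" and k: "k \<in> C2 p" and g: "g \<in> CG" and x: "x \<in> carrier M"
  shows "ext_tensor p (rconv G p k g) x = ext_tensor p k (g \<rhd> x)"
proof (rule ext_tensor_eqI[OF p rconv_closed[OF k p g] x])
  have gx: "g \<rhd> x \<in> carrier M" by (rule D_closed[OF g x])
  show "ext_tensor p k (g \<rhd> x) \<in> carrier (PG p)" by (rule ext_tensor(1)[OF p k gx])
  fix U assume U: "bisec U"
  show "ptrace p (cact G p M (indicator U) (ext_tensor p k (g \<rhd> x))) = slice p U (rconv G p k g) \<rhd> x"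
    unfolding ext_tensor(2)[OF p k gx U] slice_rconv[OF k p U] D_simps(6)[OF slice_closed[OF k p U] g x] ..
qed

text \<open>The description fixes values on elementary functions only. \<open>ext_tensor\<close>
  gives a balanced bilinear map on all functions with these values, and elementary functions
  generate, so the map described is its lift.\<close>

lemma cident:
  assumes p: "leg p"
  shows "cident G p M \<in> lin (CT p) (PG p)"
    "f \<in> CG \<Longrightarrow> g \<in> CG \<Longrightarrow> x \<in> carrier M \<Longrightarrow> cident G p M (cp p (ext p f g) x) = pg p f (g \<rhd> x)"
proof -
  obtain F where F: "F \<in> lin (CT p) (PG p)"
    "\<And>k x. k \<in> carrier (Cc (fibprod G p rr)) \<Longrightarrow> x \<in> carrier M \<Longrightarrow> F (cp p k x) = ext_tensor p k x"
    using CT_lift[OF p PG_vspace[OF p] bilin_ext_tensor[OF p]] ext_tensor_rconv[OF p] by auto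
  have e: "F (cp p (ext p f g) x) = pg p f (g \<rhd> x)" if "f \<in> CG" "g \<in> CG" "x \<in> carrier M" for f g x
    using F(2)[of "ext p f g" x] ext_closed[OF p that(1,2)] ext_tensor_ext[OF p that] that(3) by simp
  have "cident G p M = F"
    unfolding cident_def
  proof (rule the_linI[OF F(1)])
    show "\<forall>f\<in>carrier (CcG G). \<forall>g\<in>carrier (DG G). \<forall>x\<in>carrier M. F (cp p (ext p f g) x) = pg p f (g \<rhd> x)"
      using e by simp
    fix F' assume F': "F' \<in> lin (CT p) (PG p)"
      "\<forall>f\<in>carrier (CcG G). \<forall>g\<in>carrier (DG G). \<forall>x\<in>carrier M. F' (cp p (ext p f g) x) = pg p f (g \<rhd> x)"
    show "F' = F"
    proof (rule lin_eqI[OF F'(1) F(1)])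
      fix t assume "t \<in> carrier (CT p)"
      then show "F' t = F t" using p
      proof (induction rule: CT_induct)
        case (ext f g x) then show ?case using e F'(2) by simp
      next
        case (add s t)
        then show ?case
          unfolding linmapD(2)[OF lin_linmap[OF F'(1)] add(1,2)] linmapD(2)[OF lin_linmap[OF F(1)] add(1,2)] by simp
      qed
    qed
  qed
  with F(1) e show "cident G p M \<in> lin (CT p) (PG p)"
    "f \<in> CG \<Longrightarrow> g \<in> CG \<Longrightarrow> x \<in> carrier M \<Longrightarrow> cident G p M (cp p (ext p f g) x) = pg p f (g \<rhd> x)" by auto
qed

lemmas cident_linmap = lin_linmap[OF cident(1)]
lemmas cident_simps = linmapD[OF cident_linmap]

text \<open>The maps \<open>f \<otimes> x \<mapsto> (f \<otimes> 1\<^sub>K) \<otimes> x\<close> are inverse to \<open>cident\<close> for large \<open>K\<close>.\<close>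

lemma cident_section:
  assumes p: "leg p" and K: "copen (gtop0 G) K"
  obtains J where "J \<in> lin (PG p) (CT p)"
    "\<And>f x. f \<in> CG \<Longrightarrow> x \<in> carrier M \<Longrightarrow> J (pg p f x) = cp p (ext p f (indicator K)) x"
proof -
  let ?e = "indicator K :: 'g \<Rightarrow> complex"
  have e: "?e \<in> CG0" "?e \<in> CG" using K by (auto intro: indicator_CcInf CG0_CG)
  have b: "bilin (CcG G) M (CT p) (\<lambda>f x. cp p (ext p f ?e) x)"
    by (intro bilinI linmapI) (simp_all add: ext_add_left ext_smult_left cp_simps[OF p] ext_closed[OF p _ e(2)])
  have "cp p (ext p (pmult f (h \<circ> p)) ?e) x = cp p (ext p f ?e) (h \<rhd> x)"
    if "f \<in> CG" "h \<in> CG0" "x \<in> carrier M" for f h x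
  proof -
    \<comment> \<open>Since \<open>?e\<close> lives on units, multiplying it by
      \<open>h \<circ> rr\<close> is the same as convolving it with \<open>h\<close> on the right;
      balancing over D(G) can then move \<open>h\<close> to the module.\<close>
    have "pmult ?e (h \<circ> rr) = conv G ?e h"
      unfolding conv_unit_left[OF e(1) CG0_CG[OF that(2)]] using that(2) copen_subset[OF K] rng_unit
      by (auto simp: pmult_def fun_eq_iff CcInf0_iff indicator_def topspace_gtop0) (metis subsetD)+
    then show ?thesis
      unfolding ext_leg by (simp add: cp_bal[OF p ext_closed[OF p that(1) e(2)] CG0_CG[OF that(2)] that(3), symmetric] rconv_ext)
  qed
  with btens.btensor_lift[OF btens_ptensor[OF leg_continuous[OF p]] vspace_CT[OF p] b] that show ?thesis
    by (simp add: ptensor_alt ppure_alt) metis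
qed

lemma cident_inj:
  assumes p: "leg p" shows "inj_on (cident G p M) (carrier (CT p))"
proof -
  define J where "J K = (SOME J. J \<in> lin (PG p) (CT p) \<and>
    (\<forall>f\<in>CG. \<forall>x\<in>carrier M. J (pg p f x) = cp p (ext p f (indicator K)) x))" for K
  have J: "J K \<in> lin (PG p) (CT p)" "\<And>f x. f \<in> CG \<Longrightarrow> x \<in> carrier M \<Longrightarrow> J K (pg p f x) = cp p (ext p f (indicator K)) x"
    if K: "copen (gtop0 G) K" for K
  proof -
    have "\<exists>J. J \<in> lin (PG p) (CT p) \<and> (\<forall>f\<in>CG. \<forall>x\<in>carrier M. J (pg p f x) = cp p (ext p f (indicator K)) x)"
      using cident_section[OF p K] by metis
    from someI_ex[OF this]
    show "J K \<in> lin (PG p) (CT p)" "\<And>f x. f \<in> CG \<Longrightarrow> x \<in> carrier M \<Longrightarrow> J K (pg p f x) = cp p (ext p f (indicator K)) x"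
      unfolding J_def by auto
  qed
  \<comment> \<open>(f \<otimes> g) \<otimes> x goes to f \<otimes> gx and then to (f \<otimes> 1_K)
    \<otimes> gx, which by balancing is (f \<otimes> 1_K * g) \<otimes> x; for large K the indicator
    is a left unit for g.\<close>
  have JF: "\<exists>K0. copen (gtop0 G) K0 \<and> (\<forall>K. copen (gtop0 G) K \<longrightarrow> K0 \<subseteq> K \<longrightarrow> J K (cident G p M t) = t)"
    if "t \<in> carrier (CT p)" for t
    using that p
  proof (induction rule: CT_induct)
    case (ext f g x)
    obtain K0 where K0: "copen (gtop0 G) K0" "\<forall>K. copen (gtop0 G) K \<longrightarrow> K0 \<subseteq> K \<longrightarrow> conv G (indicator K) g = g"
      using unitsD.u_unit[of g] ext(2) by auto
    show ?case
    proof (intro exI[of _ K0] conjI allI impI K0(1))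
      fix K assume K: "copen (gtop0 G) K" "K0 \<subseteq> K"
      have e: "indicator K \<in> CG" using K(1) by (intro CG0_CG indicator_CcInf)
      show "J K (cident G p M (cp p (ext p f g) x)) = cp p (ext p f g) x"
        unfolding cident(2)[OF p ext] J(2)[OF K(1) ext(1) D_closed[OF ext(2,3)]]
          cp_bal[OF p ext_closed[OF p ext(1) e] ext(2,3), symmetric] rconv_ext
        using K0(2) K by simp
    qed
  next
    case (add s t)
    obtain K1 where K1: "copen (gtop0 G) K1" "\<forall>K. copen (gtop0 G) K \<longrightarrow> K1 \<subseteq> K \<longrightarrow> J K (cident G p M s) = s"
      using add(3) by (elim exE conjE)
    obtain K2 where K2: "copen (gtop0 G) K2" "\<forall>K. copen (gtop0 G) K \<longrightarrow> K2 \<subseteq> K \<longrightarrow> J K (cident G p M t) = t"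
      using add(4) by (elim exE conjE)
    show ?case
    proof (intro exI[of _ "K1 \<union> K2"] conjI allI impI copen_Un K1(1) K2(1))
      fix K assume K: "copen (gtop0 G) K" "K1 \<union> K2 \<subseteq> K"
      show "J K (cident G p M (s \<oplus>\<^bsub>CT p\<^esub> t)) = s \<oplus>\<^bsub>CT p\<^esub> t"
        unfolding cident_simps(2)[OF p add(1,2)]
          linmapD(2)[OF lin_linmap[OF J(1)[OF K(1)]] cident_simps(1)[OF p add(1)] cident_simps(1)[OF p add(2)]]
        using K1(2) K2(2) K by simp
    qed
  qed
  show ?thesis
  proof (rule inj_onI)
    fix s t assume st: "s \<in> carrier (CT p)" "t \<in> carrier (CT p)" "cident G p M s = cident G p M t"
    obtain K1 where K1: "copen (gtop0 G) K1" "\<forall>K. copen (gtop0 G) K \<longrightarrow> K1 \<subseteq> K \<longrightarrow> J K (cident G p M s) = s"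
      using JF[OF st(1)] by (elim exE conjE)
    obtain K2 where K2: "copen (gtop0 G) K2" "\<forall>K. copen (gtop0 G) K \<longrightarrow> K2 \<subseteq> K \<longrightarrow> J K (cident G p M t) = t"
      using JF[OF st(2)] by (elim exE conjE)
    have "copen (gtop0 G) (K1 \<union> K2)" by (rule copen_Un[OF K1(1) K2(1)])
    then show "s = t" using K1(2) K2(2) st(3) by (metis Un_upper1 Un_upper2)
  qed
qed

lemma cident_bij:
  assumes p: "leg p" shows "bij_betw (cident G p M) (carrier (CT p)) (carrier (PG p))"
proof -
  have "t \<in> cident G p M ` carrier (CT p)" if "t \<in> carrier (PG p)" for t
    using that p
  proof (induction rule: PG_induct)
    case (pure f x)
    \<comment> \<open>A local unit of \<open>x\<close> supplies the second function: f \<otimes> x =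
      f \<otimes> 1_K x.\<close>
    obtain K where K: "copen (gtop0 G) K" "indicator K \<rhd> x = x" using act_unit[OF pure(2)] by blast
    have e: "indicator K \<in> CG" using K(1) by (intro CG0_CG indicator_CcInf)
    have "pg p f x = cident G p M (cp p (ext p f (indicator K)) x)"
      unfolding cident(2)[OF p pure(1) e pure(2)] K(2) ..
    then show ?case using cp_simps(1)[OF p ext_closed[OF p pure(1) e] pure(2)] by blast
  next
    case (add s t)
    obtain s' where s': "s = cident G p M s'" "s' \<in> carrier (CT p)" using add(3) by (rule imageE)
    obtain t' where t': "t = cident G p M t'" "t' \<in> carrier (CT p)" using add(4) by (rule imageE)
    have "s \<oplus>\<^bsub>PG p\<^esub> t = cident G p M (s' \<oplus>\<^bsub>CT p\<^esub> t')"
      unfolding cident_simps(2)[OF p s'(2) t'(2)] s'(1) t'(1) ..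
    moreover have "s' \<oplus>\<^bsub>CT p\<^esub> t' \<in> carrier (CT p)"
      using s'(2) t'(2) by (intro abelian_monoid.a_closed[OF abelian_group.axioms(1)[OF vspaceD(1)[OF vspace_CT[OF p]]]])
    ultimately show ?case by (rule image_eqI)
  qed
  then show ?thesis using cident_inj[OF p] cident_simps(1)[OF p] by (auto simp: bij_betw_def)
qed

section \<open>The shear map on tensor products and the coaction of a module\<close>

lemma can_map_tensor:
  shows "can_map_tensor G M \<in> lin (CT rr) (CT ss)"
    "k \<in> C2 rr \<Longrightarrow> x \<in> carrier M \<Longrightarrow> can_map_tensor G M (cp rr k x) = cp ss (can_map G k) x"
proof -
  have b: "bilin (Cc (fibprod G rr rr)) M (CT ss) (\<lambda>k x. cp ss (can_map G k) x)"
    by (intro bilinI linmapI) (simp_all add: can_map_add can_map_smult cp_simps[OF leg_ss] can_map_closed)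
  have "cp ss (can_map G (rconv G rr k g)) x = cp ss (can_map G k) (g \<rhd> x)"
    if "k \<in> C2 rr" "g \<in> CG" "x \<in> carrier M" for k g x
    unfolding can_map_rconv by (rule cp_bal[OF leg_ss can_map_closed[OF that(1)] that(2,3)])
  from CT_the_lin[OF leg_rr vspace_CT[OF leg_ss] b] this
  show "can_map_tensor G M \<in> lin (CT rr) (CT ss)"
    "k \<in> C2 rr \<Longrightarrow> x \<in> carrier M \<Longrightarrow> can_map_tensor G M (cp rr k x) = cp ss (can_map G k) x"
    unfolding can_map_tensor_def by auto
qed

lemma TM_lin: "TM G M \<in> lin (PG rr) (PG ss)"
  unfolding TM_def
  by (rule restrict_in_lin[OF PG_vspace[OF leg_rr] linmap_comp[OF
        linmap_inv_into[OF vspace_CT[OF leg_rr] cident_linmap[OF leg_rr] cident_bij[OF leg_rr]]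
        linmap_comp[OF lin_linmap[OF can_map_tensor(1)] cident_linmap[OF leg_ss]]]])

text \<open>With x = 1_K x, the tensor 1_U \<otimes> x comes from (1_U \<otimes> 1_K) \<otimes> x.
  The shear map convolves the second function with the indicator of the inverse of U, and the
  identification on the source side turns this into an action on x.\<close>

lemma TM_indicator:
  assumes U: "bisec U" and x: "x \<in> carrier M"
  shows "TM G M (pg rr (indicator U) x) = pg ss (indicator U) (indicator (iv ` U) \<rhd> x)"
proof -
  obtain K where K: "copen (gtop0 G) K" "indicator K \<rhd> x = x" using act_unit[OF x] by blast
  let ?e = "indicator K :: 'g \<Rightarrow> complex" and ?u = "indicator U :: 'g \<Rightarrow> complex" and ?v = "indicator (iv ` U) :: 'g \<Rightarrow> complex"
  have m: "?e \<in> CG" "?u \<in> CG" "?v \<in> CG" by (rule CG0_CG[OF indicator_CcInf[OF K(1)]] CG_indicator[OF U] CG_indicator[OF bisec_iv[OF U]])+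
  have k: "ext rr ?u ?e \<in> C2 rr" by (rule ext_closed[OF leg_rr m(2,1)])
  have "cident G rr M (cp rr (ext rr ?u ?e) x) = pg rr ?u x"
    unfolding cident(2)[OF leg_rr m(2,1) x] K(2) ..
  then have "inv_into (carrier (CT rr)) (cident G rr M) (pg rr ?u x) = cp rr (ext rr ?u ?e) x"
    using inv_into_f_f[OF cident_inj[OF leg_rr] cp_simps(1)[OF leg_rr k x]] by simp
  moreover have "cident G ss M (can_map_tensor G M (cp rr (ext rr ?u ?e) x)) = pg ss ?u (?v \<rhd> x)"
    unfolding can_map_tensor(2)[OF k x] can_map_ext[OF U m(1)] cident(2)[OF leg_ss m(2) conv_closed[OF m(3,1)] x]
      D_simps(6)[OF m(3,1) x] K(2) ..
  ultimately show ?thesis using pg_closed[OF leg_rr m(2) x] by (simp add: TM_def)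
qed

end

section \<open>Pullbacks along the face maps and the cocycle identity\<close>

context copen_base
begin

lemma compactin_subset_copen:
  assumes "compactin E C" obtains K where "copen E K" "C \<subseteq> K"
proof -
  have "\<And>U. U \<in> B \<Longrightarrow> openin E U" using base_copen by (auto simp: copen_def)
  moreover have "C \<subseteq> \<Union>B"
    using compactin_subset_topspace[OF assms] base_nhd[OF openin_topspace] by blast
  ultimately obtain \<F> where \<F>: "finite \<F>" "\<F> \<subseteq> B" "C \<subseteq> \<Union>\<F>"
    using assms unfolding compactin_def by meson
  then show ?thesis using that copen_Union[OF \<F>(1)] base_copen by blast
qed

end

context ample_groupoid
begin

lemma face_continuous:
  "continuous_map (gtop2 G) (gtop G) (face0 G)"
  "continuous_map (gtop2 G) (gtop G) (face1 G)"
  "continuous_map (gtop2 G) (gtop G) (face2 G)"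
  using snd_continuous[of ss rr] fst_continuous[of ss rr] mul_continuous
  by (simp_all add: face0_def face1_def face2_def case_prod_unfold)

lemma iv_mul: "a \<in> XX \<Longrightarrow> b \<in> XX \<Longrightarrow> ss a = rr b \<Longrightarrow> iv (a \<diamond> b) = iv b \<diamond> iv a"
proof -
  assume ab: "a \<in> XX" "b \<in> XX" "ss a = rr b"
  have "(a \<diamond> b) \<diamond> (iv b \<diamond> iv a) = a \<diamond> (b \<diamond> (iv b \<diamond> iv a))"
    using ab by (simp add: mul_assoc inv_in src_inv rng_inv mul_closed rr_mul)
  also have "\<dots> = rr a" using ab by (simp add: mul_iv_cancel inv_in rng_inv comp_inv_right)
  finally have "(a \<diamond> b) \<diamond> (iv b \<diamond> iv a) = rr a" .
  moreover have c: "a \<diamond> b \<in> XX" "ss (a \<diamond> b) = ss b" "rr (a \<diamond> b) = rr a" "iv b \<diamond> iv a \<in> XX" "rr (iv b \<diamond> iv a) = ss b"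
    using ab by (simp_all add: mul_closed ss_mul rr_mul inv_in src_inv rng_inv)
  ultimately have "iv b \<diamond> iv a = iv (a \<diamond> b) \<diamond> rr a" using iv_mul_cancel[OF c(1,4)] by metis
  also have "\<dots> = iv (a \<diamond> b)" using comp_src[OF inv_in[OF c(1)]] src_inv[OF c(1)] c(3) by simp
  finally show ?thesis by simp
qed

lemma iv_prodset:
  assumes U: "bisec U" and V: "bisec V" shows "iv ` prodset U V = prodset (iv ` V) (iv ` U)"
proof (intro equalityI subsetI)
  fix c assume "c \<in> iv ` prodset U V"
  then obtain a b where ab: "c = iv (a \<diamond> b)" "a \<in> U" "b \<in> V" "ss a = rr b" by (auto simp: prodset_def)
  have X: "a \<in> XX" "b \<in> XX" using bisec_in U V ab by auto
  show "c \<in> prodset (iv ` V) (iv ` U)"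
    unfolding prodset_def ab(1) using ab X
    by (intro CollectI exI[of _ "iv b"] exI[of _ "iv a"]) (simp add: iv_mul src_inv rng_inv)
next
  fix c assume "c \<in> prodset (iv ` V) (iv ` U)"
  then obtain a b where ab: "c = iv b \<diamond> iv a" "a \<in> U" "b \<in> V" "ss (iv b) = rr (iv a)" by (auto simp: prodset_def)
  have X: "a \<in> XX" "b \<in> XX" using bisec_in U V ab by auto
  have s: "ss a = rr b" using ab(4) X by (simp add: src_inv rng_inv)
  show "c \<in> iv ` prodset U V"
    unfolding ab(1) iv_mul[OF X s, symmetric] using ab s by (intro imageI) (auto simp: prodset_def)
qed

end

section \<open>Tensor products along the face maps\<close>

context unitary_module
begin

abbreviation "G2 \<equiv> gtop2 G"
abbreviation "DT d p \<equiv> dtensor G d p M"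
abbreviation "dp d p \<equiv> dpure G d p M"
abbreviation "P2 q \<equiv> ptensor G G2 q M"
abbreviation "p2 q \<equiv> ppure G G2 q M"

lemma dtensor_alt: "dtensor G d p M = btensor (Cc G2) (PG p) CG (\<lambda>k g. pmult k (g \<circ> d)) (cact G p M)"
  and dpure_alt: "dpure G d p M = bpure (Cc G2) (PG p) CG (\<lambda>k g. pmult k (g \<circ> d)) (cact G p M)"
  by (simp_all add: dtensor_def dpure_def)

lemma CcInf_face:
  assumes d: "continuous_map G2 (gtop G) d" and k: "k \<in> C2 ss" and g: "loc_const (gtop G) g"
  shows "pmult k (g \<circ> d) \<in> C2 ss"
  using CcInf_pmult[OF k loc_const_compose[OF d g]] by (simp add: o_def)

lemma btens_dtensor:
  assumes d: "continuous_map G2 (gtop G) d" and p: "leg p"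
  shows "btens (Cc G2) (PG p) CG (\<lambda>k g. pmult k (g \<circ> d)) (cact G p M)"
  by (intro btens.intro two_vspaces.intro btens_axioms.intro)
     (simp_all add: vspace_Cc PG_vspace[OF p] CcInf_face[OF d] CcInf_loc_const cact_simps(1)[OF p])

lemmas vspace_DT = btens.vspace_btensor[OF btens_dtensor, folded dtensor_alt]
lemmas dp_simps = btens.bpure_simps[OF btens_dtensor, folded dtensor_alt dpure_alt, simplified]
lemmas dp_bal = btens.bpure_bal[OF btens_dtensor, folded dtensor_alt dpure_alt, simplified]
lemmas DT_induct_pure = btens.btensor_induct[OF btens_dtensor, folded dtensor_alt dpure_alt, simplified,
    consumes 3, case_names pure add]
lemmas DT_lift = btens.btensor_lift[OF btens_dtensor, folded dtensor_alt dpure_alt]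
lemmas DT_the_lin = btens.the_lin_btensor[OF btens_dtensor, folded dtensor_alt dpure_alt]

lemma DT_add_closed:
  assumes "continuous_map G2 (gtop G) d" "leg p" "s \<in> carrier (DT d p)" "t \<in> carrier (DT d p)"
  shows "s \<oplus>\<^bsub>DT d p\<^esub> t \<in> carrier (DT d p)"
  by (rule abelian_monoid.a_closed[OF abelian_group.axioms(1)[OF vspaceD(1)[OF vspace_DT[OF assms(1,2)]]] assms(3,4)])

lemma DT_induct [consumes 3, case_names pure add]:
  assumes t: "t \<in> carrier (DT d p)" and d: "continuous_map G2 (gtop G) d" and p: "leg p"
    and pure: "\<And>k f x. k \<in> C2 ss \<Longrightarrow> f \<in> CG \<Longrightarrow> x \<in> carrier M \<Longrightarrow> P (dp d p k (pg p f x))"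
    and add: "\<And>s t. s \<in> carrier (DT d p) \<Longrightarrow> t \<in> carrier (DT d p) \<Longrightarrow> P s \<Longrightarrow> P t \<Longrightarrow> P (s \<oplus>\<^bsub>DT d p\<^esub> t)"
  shows "P t"
  using d p t
proof (induction rule: DT_induct_pure)
  case (pure k u)
  from pure(2) p show ?case
  proof (induction u rule: PG_induct)
    case (pure f x) then show ?case by (intro assms(4) \<open>k \<in> C2 ss\<close>)
  next
    case (add s t)
    then show ?case unfolding dp_simps(3)[OF d p pure(1) add(1,2)] by (intro assms(5) dp_simps(1) d p pure(1))
  qed
qed (rule add)

lemma P2_continuous: "continuous_map G2 (gtop G) d \<Longrightarrow> leg p \<Longrightarrow> continuous_map G2 (gtop0 G) (p \<circ> d)"
  by (rule continuous_map_compose[OF _ leg_continuous])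

lemma dident_fibre:
  assumes d: "continuous_map G2 (gtop G) d" and p: "leg p" and k: "k \<in> C2 ss"
  obtains F where "F \<in> lin (PG p) (P2 (p \<circ> d))"
    "\<And>f x. f \<in> CG \<Longrightarrow> x \<in> carrier M \<Longrightarrow> F (pg p f x) = p2 (p \<circ> d) (pmult k (f \<circ> d)) x"
proof -
  note c = P2_continuous[OF d p]
  note m = CcInf_face[OF d k CcInf_loc_const]
  have e: "pmult k ((\<lambda>x. f x + f' x) \<circ> d) = (\<lambda>x. pmult k (f \<circ> d) x + pmult k (f' \<circ> d) x)"
    "pmult k ((\<lambda>x. z * f x) \<circ> d) = (\<lambda>x. z * pmult k (f \<circ> d) x)" for f f' z
    by (auto simp: pmult_def algebra_simps)
  have b: "bilin (CcG G) M (P2 (p \<circ> d)) (\<lambda>f x. p2 (p \<circ> d) (pmult k (f \<circ> d)) x)"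
    by (intro bilinI linmapI) (simp_all add: m e pp_simps[OF c])
  have "p2 (p \<circ> d) (pmult k (pmult f (h \<circ> p) \<circ> d)) x = p2 (p \<circ> d) (pmult k (f \<circ> d)) (h \<rhd> x)"
    if "f \<in> CG" "h \<in> CG0" "x \<in> carrier M" for f h x
  proof -
    have "pmult k (pmult f (h \<circ> p) \<circ> d) = pmult (pmult k (f \<circ> d)) (h \<circ> (p \<circ> d))"
      by (auto simp: pmult_def)
    then show ?thesis using pp_bal[OF c m[OF that(1)] that(2,3)] by simp
  qed
  with btens.btensor_lift[OF btens_ptensor[OF leg_continuous[OF p]] vspace_PT[OF c] b] that show ?thesis
    by (simp add: ptensor_alt ppure_alt) metis
qed

text \<open>The second factor is itself a tensor product, so the lift takes two stages: for each
  \<open>k\<close> a map \<open>\<psi> k\<close> out of \<open>PG p\<close>, then bilinearity and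
  balancing of \<open>\<psi>\<close>, both checked on generators of \<open>PG p\<close>.\<close>

lemma dident:
  assumes d: "continuous_map G2 (gtop G) d" and p: "leg p"
  shows "dident G d p M \<in> lin (DT d p) (P2 (p \<circ> d))"
    "k \<in> C2 ss \<Longrightarrow> f \<in> CG \<Longrightarrow> x \<in> carrier M \<Longrightarrow>
      dident G d p M (dp d p k (pg p f x)) = p2 (p \<circ> d) (pmult k (f \<circ> d)) x"
proof -
  note c = P2_continuous[OF d p]
  define \<psi> where "\<psi> k = (SOME F. F \<in> lin (PG p) (P2 (p \<circ> d)) \<and>
    (\<forall>f\<in>CG. \<forall>x\<in>carrier M. F (pg p f x) = p2 (p \<circ> d) (pmult k (f \<circ> d)) x))" for k
  have \<psi>: "linmap (PG p) (P2 (p \<circ> d)) (\<psi> k)"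
    "\<And>f x. f \<in> CG \<Longrightarrow> x \<in> carrier M \<Longrightarrow> \<psi> k (pg p f x) = p2 (p \<circ> d) (pmult k (f \<circ> d)) x" if k: "k \<in> C2 ss" for k
  proof -
    have "\<exists>F. F \<in> lin (PG p) (P2 (p \<circ> d)) \<and>
      (\<forall>f\<in>CG. \<forall>x\<in>carrier M. F (pg p f x) = p2 (p \<circ> d) (pmult k (f \<circ> d)) x)"
      using dident_fibre[OF d p k] by metis
    from someI_ex[OF this] show "linmap (PG p) (P2 (p \<circ> d)) (\<psi> k)"
      "\<And>f x. f \<in> CG \<Longrightarrow> x \<in> carrier M \<Longrightarrow> \<psi> k (pg p f x) = p2 (p \<circ> d) (pmult k (f \<circ> d)) x"
      unfolding \<psi>_def by (auto simp: lin_iff)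
  qed
  have m: "pmult k (f \<circ> d) \<in> C2 ss" if "k \<in> C2 ss" "f \<in> CG" for k f
    by (rule CcInf_face[OF d that(1) CcInf_loc_const[OF that(2)]])
  note V = vspace_PT[OF c]
  have add: "\<psi> (\<lambda>x. k x + k' x) t = \<psi> k t \<oplus>\<^bsub>P2 (p \<circ> d)\<^esub> \<psi> k' t"
    if k: "k \<in> C2 ss" "k' \<in> C2 ss" and t: "t \<in> carrier (PG p)" for k k' t
  proof (rule PG_linmap_eqI[OF p V \<psi>(1)[OF CcInf_add[OF k]] linmap_add[OF V \<psi>(1)[OF k(1)] \<psi>(1)[OF k(2)]] _ t])
    fix f x assume fx: "f \<in> CG" "x \<in> carrier M"
    have "pmult (\<lambda>x. k x + k' x) (f \<circ> d) = (\<lambda>x. pmult k (f \<circ> d) x + pmult k' (f \<circ> d) x)"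
      by (auto simp: pmult_def algebra_simps)
    then show "\<psi> (\<lambda>x. k x + k' x) (pg p f x) = \<psi> k (pg p f x) \<oplus>\<^bsub>P2 (p \<circ> d)\<^esub> \<psi> k' (pg p f x)"
      unfolding \<psi>(2)[OF CcInf_add[OF k] fx] \<psi>(2)[OF k(1) fx] \<psi>(2)[OF k(2) fx]
      using pp_simps(2)[OF c m[OF k(1) fx(1)] m[OF k(2) fx(1)] fx(2)] by simp
  qed
  have smult: "\<psi> (\<lambda>x. z * k x) t = z \<odot>\<^bsub>P2 (p \<circ> d)\<^esub> \<psi> k t" if k: "k \<in> C2 ss" and t: "t \<in> carrier (PG p)" for z k t
    using t p
  proof (induction rule: PG_induct)
    case (pure f x)
    have "pmult (\<lambda>x. z * k x) (f \<circ> d) = (\<lambda>x. z * pmult k (f \<circ> d) x)"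
      by (auto simp: pmult_def algebra_simps)
    then show ?case unfolding \<psi>(2)[OF CcInf_smult[OF k] pure] \<psi>(2)[OF k pure]
      by (simp only: pp_simps(4)[OF c m[OF k pure(1)] pure(2)])
  next
    case (add s t)
    show ?case
      unfolding linmapD(2)[OF \<psi>(1)[OF CcInf_smult[OF k]] add(1,2)] linmapD(2)[OF \<psi>(1)[OF k] add(1,2)] add(3,4)
        vspaceD(4)[OF V linmapD(1)[OF \<psi>(1)[OF k] add(1)] linmapD(1)[OF \<psi>(1)[OF k] add(2)]] ..
  qed
  have b: "bilin (Cc G2) (PG p) (P2 (p \<circ> d)) \<psi>"
    by (intro bilinI linmapI) (simp_all add: add smult \<psi>(1) linmapD[OF \<psi>(1)])
  have bal: "\<psi> (pmult k (g \<circ> d)) t = \<psi> k (cact G p M g t)"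
    if k: "k \<in> C2 ss" and g: "g \<in> CG" and t: "t \<in> carrier (PG p)" for k g t
  proof (rule PG_linmap_eqI[OF p V \<psi>(1)[OF m[OF k g]] linmap_comp[OF cact_linmap[OF p CcInf_loc_const[OF g]] \<psi>(1)[OF k], unfolded o_def[of "\<psi> k"]] _ t])
    fix f x assume fx: "f \<in> CG" "x \<in> carrier M"
    have "pmult (pmult k (g \<circ> d)) (f \<circ> d) = pmult k (pmult g f \<circ> d)" by (auto simp: pmult_def)
    then show "\<psi> (pmult k (g \<circ> d)) (pg p f x) = \<psi> k (cact G p M g (pg p f x))"
      unfolding \<psi>(2)[OF m[OF k g] fx] cact(2)[OF p CcInf_loc_const[OF g] fx]
        \<psi>(2)[OF k CcInf_pmult[OF g CcInf_loc_const[OF fx(1)]] fx(2)] by simp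
  qed
  obtain F where F: "F \<in> lin (DT d p) (P2 (p \<circ> d))" "\<And>k t. k \<in> C2 ss \<Longrightarrow> t \<in> carrier (PG p) \<Longrightarrow> F (dp d p k t) = \<psi> k t"
    using DT_lift[OF d p V b] bal by auto
  have e: "F (dp d p k (pg p f x)) = p2 (p \<circ> d) (pmult k (f \<circ> d)) x" if "k \<in> C2 ss" "f \<in> CG" "x \<in> carrier M" for k f x
    unfolding F(2)[OF that(1) pg_closed[OF p that(2,3)]] by (rule \<psi>(2)[OF that])
  have "dident G d p M = F"
    unfolding dident_def
  proof (rule the_linI[OF F(1)])
    show "\<forall>k\<in>carrier (Cc G2). \<forall>f\<in>carrier (CcG G). \<forall>x\<in>carrier M.
        F (dp d p k (pg p f x)) = p2 (p \<circ> d) (pmult k (f \<circ> d)) x" using e by simp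
    fix F' assume F': "F' \<in> lin (DT d p) (P2 (p \<circ> d))"
      "\<forall>k\<in>carrier (Cc G2). \<forall>f\<in>carrier (CcG G). \<forall>x\<in>carrier M.
        F' (dp d p k (pg p f x)) = p2 (p \<circ> d) (pmult k (f \<circ> d)) x"
    show "F' = F"
    proof (rule lin_eqI[OF F'(1) F(1)])
      fix t assume "t \<in> carrier (DT d p)"
      then show "F' t = F t" using d p
      proof (induction rule: DT_induct)
        case (pure k f x) then show ?case using e F'(2) by simp
      next
        case (add s t)
        then show ?case
          unfolding linmapD(2)[OF lin_linmap[OF F'(1)] add(1,2)] linmapD(2)[OF lin_linmap[OF F(1)] add(1,2)] by simp
      qed
    qed
  qed
  with F(1) e show "dident G d p M \<in> lin (DT d p) (P2 (p \<circ> d))"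
    "k \<in> C2 ss \<Longrightarrow> f \<in> CG \<Longrightarrow> x \<in> carrier M \<Longrightarrow>
      dident G d p M (dp d p k (pg p f x)) = p2 (p \<circ> d) (pmult k (f \<circ> d)) x" by auto
qed

lemmas dident_linmap = lin_linmap[OF dident(1)]
lemmas dident_simps = linmapD[OF dident_linmap]

text \<open>The support of \<open>k\<close> has compact image under \<open>d\<close>, which lies in
  some compact open \<open>K\<close>; the pullback of its indicator is then 1 on the
  support.\<close>

lemma face_unit:
  assumes d: "continuous_map G2 (gtop G) d" and k: "k \<in> C2 ss"
  obtains K where "copen (gtop G) K" "pmult k (indicator K \<circ> d) = k"
proof -
  have "compactin (gtop G) (d ` {x. k x \<noteq> 0})"
    by (rule image_compactin[OF _ d]) (use k in \<open>simp add: CcInf_iff\<close>)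
  then obtain K where K: "copen (gtop G) K" "d ` {x. k x \<noteq> 0} \<subseteq> K" by (rule bisecs.compactin_subset_copen)
  then have "pmult k (indicator K \<circ> d) = k" by (auto simp: pmult_def indicator_def fun_eq_iff)
  with K that show ?thesis by blast
qed

text \<open>The maps \<open>k \<otimes> x \<mapsto> k \<otimes> (1\<^sub>K \<otimes> x)\<close> are inverse to \<open>dident\<close> for large \<open>K\<close>.\<close>

lemma dident_section:
  assumes d: "continuous_map G2 (gtop G) d" and p: "leg p" and K: "copen (gtop G) K"
  obtains J where "J \<in> lin (P2 (p \<circ> d)) (DT d p)"
    "\<And>k x. k \<in> C2 ss \<Longrightarrow> x \<in> carrier M \<Longrightarrow> J (p2 (p \<circ> d) k x) = dp d p k (pg p (indicator K) x)"
proof -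
  note c = P2_continuous[OF d p]
  let ?e = "indicator K :: 'g \<Rightarrow> complex"
  have e: "?e \<in> CG" using K by (rule indicator_CcInf)
  have b: "bilin (Cc G2) M (DT d p) (\<lambda>k x. dp d p k (pg p ?e x))"
    by (intro bilinI linmapI) (simp_all add: pg_simps(1,3,5)[OF p e] dp_simps[OF d p])
  have "dp d p (pmult k (h \<circ> (p \<circ> d))) (pg p ?e x) = dp d p k (pg p ?e (h \<rhd> x))"
    if k: "k \<in> C2 ss" and h: "h \<in> CG0" and x: "x \<in> carrier M" for k h x
  proof -
    \<comment> \<open>\<open>h \<circ> p\<close> is locally constant but need not lie in C_c(G), so
      it cannot be moved across the tensor sign by itself. Cut down by the indicator of
      \<open>L\<close> it can, and the cut is invisible to \<open>k\<close>.\<close>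
    obtain L where L: "copen (gtop G) L" "pmult k (indicator L \<circ> d) = k" using face_unit[OF d k] .
    let ?g = "indicator L :: 'g \<Rightarrow> complex"
    have g: "?g \<in> CG" using L(1) by (rule indicator_CcInf)
    have gh: "pmult ?g (h \<circ> p) \<in> CG" and eh: "pmult ?e (h \<circ> p) \<in> CG" using pmult_leg_CG[OF _ h p] g e by auto
    have "pmult k (h \<circ> (p \<circ> d)) = pmult (pmult k (?g \<circ> d)) (h \<circ> (p \<circ> d))" by (simp add: L(2))
    also have "\<dots> = pmult k (pmult ?g (h \<circ> p) \<circ> d)" by (auto simp: pmult_def)
    finally have "dp d p (pmult k (h \<circ> (p \<circ> d))) (pg p ?e x) = dp d p k (cact G p M (pmult ?g (h \<circ> p)) (pg p ?e x))"
      using dp_bal[OF d p k gh pg_closed[OF p e x]] by simp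
    also have "cact G p M (pmult ?g (h \<circ> p)) (pg p ?e x) = cact G p M ?g (pg p (pmult ?e (h \<circ> p)) x)"
      unfolding cact(2)[OF p CcInf_loc_const[OF gh] e x] cact(2)[OF p CcInf_loc_const[OF g] eh x]
      by (simp add: pmult_assoc pmult_commute[of ?e])
    also have "dp d p k \<dots> = dp d p (pmult k (?g \<circ> d)) (pg p (pmult ?e (h \<circ> p)) x)"
      using dp_bal[OF d p k g pg_closed[OF p eh x]] by simp
    also have "\<dots> = dp d p k (pg p ?e (h \<rhd> x))" unfolding L(2) pg_bal[OF p e h x] ..
    finally show ?thesis .
  qed
  with btens.btensor_lift[OF btens_ptensor[OF c] vspace_DT[OF d p] b] that show ?thesis
    by (simp add: ptensor_alt ppure_alt) metis
qed

lemma dident_inj: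
  assumes d: "continuous_map G2 (gtop G) d" and p: "leg p" shows "inj_on (dident G d p M) (carrier (DT d p))"
proof -
  define J where "J K = (SOME J. J \<in> lin (P2 (p \<circ> d)) (DT d p) \<and>
    (\<forall>k\<in>C2 ss. \<forall>x\<in>carrier M. J (p2 (p \<circ> d) k x) = dp d p k (pg p (indicator K) x)))" for K
  have J: "J K \<in> lin (P2 (p \<circ> d)) (DT d p)"
    "\<And>k x. k \<in> C2 ss \<Longrightarrow> x \<in> carrier M \<Longrightarrow> J K (p2 (p \<circ> d) k x) = dp d p k (pg p (indicator K) x)"
    if K: "copen (gtop G) K" for K
  proof -
    have "\<exists>J. J \<in> lin (P2 (p \<circ> d)) (DT d p) \<and>
      (\<forall>k\<in>C2 ss. \<forall>x\<in>carrier M. J (p2 (p \<circ> d) k x) = dp d p k (pg p (indicator K) x))"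
      using dident_section[OF d p K] by metis
    from someI_ex[OF this]
    show "J K \<in> lin (P2 (p \<circ> d)) (DT d p)"
      "\<And>k x. k \<in> C2 ss \<Longrightarrow> x \<in> carrier M \<Longrightarrow> J K (p2 (p \<circ> d) k x) = dp d p k (pg p (indicator K) x)"
      unfolding J_def by auto
  qed
  \<comment> \<open>k \<otimes> (f \<otimes> x) goes to k (f \<circ> d) \<otimes> x and back to k (f
    \<circ> d) \<otimes> (1_K \<otimes> x), which by balancing is k \<otimes> (f 1_K \<otimes> x);
    for large K, f 1_K = f.\<close>
  have JF: "\<exists>K0. copen (gtop G) K0 \<and> (\<forall>K. copen (gtop G) K \<longrightarrow> K0 \<subseteq> K \<longrightarrow> J K (dident G d p M t) = t)"
    if "t \<in> carrier (DT d p)" for t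
    using that d p
  proof (induction rule: DT_induct)
    case (pure k f x)
    show ?case
    proof (intro exI[of _ "{a. f a \<noteq> 0}"] conjI allI impI copen_supp pure(2))
      fix K assume K: "copen (gtop G) K" "{a. f a \<noteq> 0} \<subseteq> K"
      have e: "indicator K \<in> CG" using K(1) by (rule indicator_CcInf)
      have "pmult f (indicator K) = f"
        using pmult_indicator_supp[of f K] K(2) by (auto simp: pmult_commute)
      then show "J K (dident G d p M (dp d p k (pg p f x))) = dp d p k (pg p f x)"
        unfolding dident(2)[OF d p pure] J(2)[OF K(1) CcInf_face[OF d pure(1) CcInf_loc_const[OF pure(2)]] pure(3)]
          dp_bal[OF d p pure(1,2) pg_closed[OF p e pure(3)]] cact(2)[OF p CcInf_loc_const[OF pure(2)] e pure(3)] by simp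
    qed
  next
    case (add s t)
    obtain K1 where K1: "copen (gtop G) K1" "\<forall>K. copen (gtop G) K \<longrightarrow> K1 \<subseteq> K \<longrightarrow> J K (dident G d p M s) = s"
      using add(3) by (elim exE conjE)
    obtain K2 where K2: "copen (gtop G) K2" "\<forall>K. copen (gtop G) K \<longrightarrow> K2 \<subseteq> K \<longrightarrow> J K (dident G d p M t) = t"
      using add(4) by (elim exE conjE)
    show ?case
    proof (intro exI[of _ "K1 \<union> K2"] conjI allI impI copen_Un K1(1) K2(1))
      fix K assume K: "copen (gtop G) K" "K1 \<union> K2 \<subseteq> K"
      show "J K (dident G d p M (s \<oplus>\<^bsub>DT d p\<^esub> t)) = s \<oplus>\<^bsub>DT d p\<^esub> t"
        unfolding dident_simps(2)[OF d p add(1,2)]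
          linmapD(2)[OF lin_linmap[OF J(1)[OF K(1)]] dident_simps(1)[OF d p add(1)] dident_simps(1)[OF d p add(2)]]
        using K1(2) K2(2) K by simp
    qed
  qed
  show ?thesis
  proof (rule inj_onI)
    fix s t assume st: "s \<in> carrier (DT d p)" "t \<in> carrier (DT d p)" "dident G d p M s = dident G d p M t"
    obtain K1 where K1: "copen (gtop G) K1" "\<forall>K. copen (gtop G) K \<longrightarrow> K1 \<subseteq> K \<longrightarrow> J K (dident G d p M s) = s"
      using JF[OF st(1)] by (elim exE conjE)
    obtain K2 where K2: "copen (gtop G) K2" "\<forall>K. copen (gtop G) K \<longrightarrow> K2 \<subseteq> K \<longrightarrow> J K (dident G d p M t) = t"
      using JF[OF st(2)] by (elim exE conjE)
    have "copen (gtop G) (K1 \<union> K2)" by (rule copen_Un[OF K1(1) K2(1)])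
    then show "s = t" using K1(2) K2(2) st(3) by (metis Un_upper1 Un_upper2)
  qed
qed

lemma P2_induct [consumes 2, case_names rect add]:
  assumes t: "t \<in> carrier (P2 q)" and q: "continuous_map G2 (gtop0 G) q"
    and rect: "\<And>U V x. bisec U \<Longrightarrow> bisec V \<Longrightarrow> x \<in> carrier M \<Longrightarrow> P (p2 q (indicator (rect ss U V)) x)"
    and add: "\<And>s t. s \<in> carrier (P2 q) \<Longrightarrow> t \<in> carrier (P2 q) \<Longrightarrow> P s \<Longrightarrow> P t \<Longrightarrow> P (s \<oplus>\<^bsub>P2 q\<^esub> t)"
  shows "P t"
  using q t
proof (induction rule: PT_induct)
  case (pure k x)
  from pure(1) leg_ss show ?case
  proof (induction k rule: C2_induct)
    case (ext c U V)
    have r: "indicator (rect ss U V) \<in> C2 ss" using copen_rect[OF leg_ss] ext by (intro indicator_CcInf) (simp add: bisec_copen)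
    have "p2 q (ext ss (\<lambda>a. c * indicator U a) (indicator V)) x = p2 q (indicator (rect ss U V)) (c \<odot>\<^bsub>M\<^esub> x)"
      unfolding ext_smult_left ext_indicators[OF ext] pp_simps(4)[OF q r pure(2)] pp_simps(5)[OF q r pure(2)] ..
    then show ?case using assms(3)[OF ext vspaceD(2)[OF vspM pure(2)]] by simp
  next
    case (add k k')
    then show ?case unfolding pp_simps(2)[OF q add(1,2) pure(2)] by (intro assms(4) pp_simps(1) q pure(2))
  qed
qed (rule add)

lemma dident_bij:
  assumes d: "continuous_map G2 (gtop G) d" and p: "leg p"
  shows "bij_betw (dident G d p M) (carrier (DT d p)) (carrier (P2 (p \<circ> d)))"
proof -
  note c = P2_continuous[OF d p]
  have "t \<in> dident G d p M ` carrier (DT d p)" if "t \<in> carrier (P2 (p \<circ> d))" for t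
    using c that
  proof (induction rule: PT_induct)
    case (pure k x)
    obtain K where K: "copen (gtop G) K" "pmult k (indicator K \<circ> d) = k" using face_unit[OF d pure(1)] .
    have e: "indicator K \<in> CG" using K(1) by (rule indicator_CcInf)
    have "p2 (p \<circ> d) k x = dident G d p M (dp d p k (pg p (indicator K) x))"
      unfolding dident(2)[OF d p pure(1) e pure(2)] K(2) ..
    then show ?case using dp_simps(1)[OF d p pure(1) pg_closed[OF p e pure(2)]] by blast
  next
    case (add s t)
    obtain s' where s': "s = dident G d p M s'" "s' \<in> carrier (DT d p)" using add(3) by (rule imageE)
    obtain t' where t': "t = dident G d p M t'" "t' \<in> carrier (DT d p)" using add(4) by (rule imageE)
    have "s \<oplus>\<^bsub>P2 (p \<circ> d)\<^esub> t = dident G d p M (s' \<oplus>\<^bsub>DT d p\<^esub> t')"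
      unfolding dident_simps(2)[OF d p s'(2) t'(2)] s'(1) t'(1) ..
    then show ?case using DT_add_closed[OF d p s'(2) t'(2)] by (rule image_eqI)
  qed
  then show ?thesis using dident_inj[OF d p] dident_simps(1)[OF d p] by (auto simp: bij_betw_def)
qed

section \<open>Pullbacks of a linear map and the cocycle identity on rectangles\<close>

lemma clinear_iff:
  "T \<in> clinear G M \<longleftrightarrow> T \<in> lin (PG rr) (PG ss) \<and>
    (\<forall>g\<in>CG. \<forall>t\<in>carrier (PG rr). T (cact G rr M g t) = cact G ss M g (T t))"
  by (simp add: clinear_def)

lemma id_tensor:
  assumes d: "continuous_map G2 (gtop G) d" and T: "T \<in> clinear G M"
  shows "id_tensor G d M T \<in> lin (DT d rr) (DT d ss)"
    "k \<in> C2 ss \<Longrightarrow> t \<in> carrier (PG rr) \<Longrightarrow> id_tensor G d M T (dp d rr k t) = dp d ss k (T t)"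
proof -
  have T': "linmap (PG rr) (PG ss) T" using T by (simp add: clinear_iff lin_iff)
  note Ts = linmapD[OF T']
  have b: "bilin (Cc G2) (PG rr) (DT d ss) (\<lambda>k t. dp d ss k (T t))"
    by (intro bilinI linmapI) (simp_all add: Ts dp_simps[OF d leg_ss])
  have "dp d ss (pmult k (g \<circ> d)) (T t) = dp d ss k (T (cact G rr M g t))"
    if "k \<in> C2 ss" "g \<in> CG" "t \<in> carrier (PG rr)" for k g t
    using dp_bal[OF d leg_ss that(1,2) Ts(1)[OF that(3)]] T that(2,3) by (simp add: clinear_iff)
  from DT_the_lin[OF d leg_rr vspace_DT[OF d leg_ss] b] this
  show "id_tensor G d M T \<in> lin (DT d rr) (DT d ss)"
    "k \<in> C2 ss \<Longrightarrow> t \<in> carrier (PG rr) \<Longrightarrow> id_tensor G d M T (dp d rr k t) = dp d ss k (T t)"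
    unfolding id_tensor_def by auto
qed

lemma dstar_lin:
  assumes d: "continuous_map G2 (gtop G) d" and T: "T \<in> clinear G M"
  shows "dstar G d M T \<in> lin (P2 (rr \<circ> d)) (P2 (ss \<circ> d))"
  unfolding dstar_def
  by (rule restrict_in_lin[OF vspace_PT[OF P2_continuous[OF d leg_rr]] linmap_comp[OF
        linmap_inv_into[OF vspace_DT[OF d leg_rr] dident_linmap[OF d leg_rr] dident_bij[OF d leg_rr]]
        linmap_comp[OF lin_linmap[OF id_tensor(1)[OF d T]] dident_linmap[OF d leg_ss]]]])

text \<open>Under the identification, k \<otimes> x comes from k \<otimes> (f \<otimes> x) for any f
  whose pullback is 1 on the support of k. With f the indicator of a bisection, one value of T
  suffices.\<close>

lemma dstar_pure:
  assumes d: "continuous_map G2 (gtop G) d" and T: "T \<in> clinear G M"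
    and k: "k \<in> C2 ss" and x: "x \<in> carrier M" and y: "y \<in> carrier M" and f: "f \<in> CG"
    and kf: "pmult k (f \<circ> d) = k" and Tf: "T (pg rr f x) = pg ss f y"
  shows "dstar G d M T (p2 (rr \<circ> d) k x) = p2 (ss \<circ> d) k y"
proof -
  have fx: "pg rr f x \<in> carrier (PG rr)" by (rule pg_closed[OF leg_rr f x])
  have "dident G d rr M (dp d rr k (pg rr f x)) = p2 (rr \<circ> d) k x"
    unfolding dident(2)[OF d leg_rr k f x] kf ..
  then have "inv_into (carrier (DT d rr)) (dident G d rr M) (p2 (rr \<circ> d) k x) = dp d rr k (pg rr f x)"
    using inv_into_f_f[OF dident_inj[OF d leg_rr] dp_simps(1)[OF d leg_rr k fx]] by simp
  moreover have "dident G d ss M (id_tensor G d M T (dp d rr k (pg rr f x))) = p2 (ss \<circ> d) k y"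
    unfolding id_tensor(2)[OF d T k fx] Tf dident(2)[OF d leg_ss k f y] kf ..
  ultimately show ?thesis
    using pp_simps(1)[OF P2_continuous[OF d leg_rr] k x] by (simp add: dstar_def)
qed

lemma ptensor_cong_leg:
  assumes "\<And>x. x \<in> topspace E \<Longrightarrow> p x = q x"
  shows "ptensor G E p M = ptensor G E q M" "ppure G E p M = ppure G E q M"
proof -
  have e: "pmult f (h \<circ> p) = pmult f (h \<circ> q)" if "f \<in> CcInf E" for f h
    unfolding pmult_def using assms CcInf_zero_off[OF that] by (intro ext) (metis comp_apply mult_zero_left)
  have "bal_rels (Cc E) M CG0 (\<lambda>f h. pmult f (h \<circ> p)) (lact M) = bal_rels (Cc E) M CG0 (\<lambda>f h. pmult f (h \<circ> q)) (lact M)"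
    unfolding bal_rels_def by (intro Collect_cong ex_cong1) (auto simp: e)
  then show "ptensor G E p M = ptensor G E q M" "ppure G E p M = ppure G E q M"
    by (simp_all add: ptensor_def ppure_def btensor_def bpure_def fun_eq_iff)
qed

text \<open>The simplicial identities hold on composable pairs and may fail elsewhere. As only
  values on composable pairs enter the balancing relations, the tensor products are nevertheless
  literally equal, and the three pullbacks can be composed and compared.\<close>

lemma face_legs:
  "ptensor G G2 (rr \<circ> face2 G) M = ptensor G G2 (rr \<circ> face1 G) M"
  "ppure G G2 (rr \<circ> face2 G) M = ppure G G2 (rr \<circ> face1 G) M"
  "ptensor G G2 (rr \<circ> face0 G) M = ptensor G G2 (ss \<circ> face2 G) M"
  "ppure G G2 (rr \<circ> face0 G) M = ppure G G2 (ss \<circ> face2 G) M"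
  "ptensor G G2 (ss \<circ> face1 G) M = ptensor G G2 (ss \<circ> face0 G) M"
  "ppure G G2 (ss \<circ> face1 G) M = ppure G G2 (ss \<circ> face0 G) M"
  by (rule ptensor_cong_leg; auto simp: topspace_fibprod face0_def face1_def face2_def rr_mul ss_mul)+

text \<open>The indicator of a rectangle over U and V is unchanged by multiplication with the
  pullbacks of 1_U, 1_V and 1_{UV} along the respective faces, so the three pullbacks of T act on it
  through \<open>\<tau> U\<close>, \<open>\<tau> V\<close> and \<open>\<tau> (prodset U V)\<close>.
  Such tensors generate.\<close>

lemma cocycle_iff:
  assumes T: "T \<in> clinear G M"
    and \<tau>: "\<And>U x. bisec U \<Longrightarrow> x \<in> carrier M \<Longrightarrow> \<tau> U x \<in> carrier M"
      "\<And>U x. bisec U \<Longrightarrow> x \<in> carrier M \<Longrightarrow> T (pg rr (indicator U) x) = pg ss (indicator U) (\<tau> U x)"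
  shows "(\<forall>t\<in>carrier (P2 (rr \<circ> face1 G)). dstar G (face0 G) M T (dstar G (face2 G) M T t) = dstar G (face1 G) M T t) \<longleftrightarrow>
    (\<forall>U V. \<forall>x\<in>carrier M. bisec U \<longrightarrow> bisec V \<longrightarrow>
      p2 (ss \<circ> face0 G) (indicator (rect ss U V)) (\<tau> V (\<tau> U x)) =
      p2 (ss \<circ> face0 G) (indicator (rect ss U V)) (\<tau> (prodset U V) x))"
proof -
  note c = face_continuous
  have D2: "linmap (P2 (rr \<circ> face1 G)) (P2 (ss \<circ> face2 G)) (dstar G (face2 G) M T)"
    using lin_linmap[OF dstar_lin[OF c(3) T]] by (simp add: face_legs)
  have D0: "linmap (P2 (ss \<circ> face2 G)) (P2 (ss \<circ> face0 G)) (dstar G (face0 G) M T)"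
    using lin_linmap[OF dstar_lin[OF c(1) T]] by (simp add: face_legs)
  have D1: "linmap (P2 (rr \<circ> face1 G)) (P2 (ss \<circ> face0 G)) (dstar G (face1 G) M T)"
    using lin_linmap[OF dstar_lin[OF c(2) T]] by (simp add: face_legs)
  note D02 = linmap_comp[OF D2 D0]
  let ?p = "p2 (rr \<circ> face1 G)"
  note q = P2_continuous[OF c(2) leg_rr]
  have vals: "?p (indicator (rect ss U V)) x \<in> carrier (P2 (rr \<circ> face1 G))"
    "dstar G (face0 G) M T (dstar G (face2 G) M T (?p (indicator (rect ss U V)) x)) =
      p2 (ss \<circ> face0 G) (indicator (rect ss U V)) (\<tau> V (\<tau> U x))"
    "dstar G (face1 G) M T (?p (indicator (rect ss U V)) x) =
      p2 (ss \<circ> face0 G) (indicator (rect ss U V)) (\<tau> (prodset U V) x)"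
    if U: "bisec U" and V: "bisec V" and x: "x \<in> carrier M" for U V x
  proof -
    let ?k = "indicator (rect ss U V) :: 'g \<times> 'g \<Rightarrow> complex"
    have k: "?k \<in> C2 ss" using copen_rect[OF leg_ss] U V by (intro indicator_CcInf) (simp add: bisec_copen)
    have UV: "bisec (prodset U V)" by (rule bisec_prodset[OF U V])
    show "?p ?k x \<in> carrier (P2 (rr \<circ> face1 G))" by (rule pp_simps(1)[OF q k x])
    have "pmult ?k (indicator U \<circ> face2 G) = ?k"
      by (auto simp: pmult_def face2_def rect_def indicator_def fun_eq_iff)
    from dstar_pure[OF c(3) T k x \<tau>(1)[OF U x] CG_indicator[OF U] this \<tau>(2)[OF U x]]
    have 2: "dstar G (face2 G) M T (?p ?k x) = p2 (ss \<circ> face2 G) ?k (\<tau> U x)" by (simp add: face_legs)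
    have "pmult ?k (indicator V \<circ> face0 G) = ?k"
      by (auto simp: pmult_def face0_def rect_def indicator_def fun_eq_iff)
    from dstar_pure[OF c(1) T k \<tau>(1)[OF U x] \<tau>(1)[OF V \<tau>(1)[OF U x]] CG_indicator[OF V] this \<tau>(2)[OF V \<tau>(1)[OF U x]]]
    show "dstar G (face0 G) M T (dstar G (face2 G) M T (?p ?k x)) = p2 (ss \<circ> face0 G) ?k (\<tau> V (\<tau> U x))"
      unfolding 2 by (simp add: face_legs)
    have "pmult ?k (indicator (prodset U V) \<circ> face1 G) = ?k"
      by (auto simp: pmult_def face1_def rect_def prodset_def indicator_def fun_eq_iff)
    from dstar_pure[OF c(2) T k x \<tau>(1)[OF UV x] CG_indicator[OF UV] this \<tau>(2)[OF UV x]]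
    show "dstar G (face1 G) M T (?p ?k x) = p2 (ss \<circ> face0 G) ?k (\<tau> (prodset U V) x)"
      by (simp add: face_legs)
  qed
  show ?thesis
  proof
    assume *: "\<forall>t\<in>carrier (P2 (rr \<circ> face1 G)). dstar G (face0 G) M T (dstar G (face2 G) M T t) = dstar G (face1 G) M T t"
    show "\<forall>U V. \<forall>x\<in>carrier M. bisec U \<longrightarrow> bisec V \<longrightarrow>
      p2 (ss \<circ> face0 G) (indicator (rect ss U V)) (\<tau> V (\<tau> U x)) =
      p2 (ss \<circ> face0 G) (indicator (rect ss U V)) (\<tau> (prodset U V) x)"
      using * vals by metis
  next
    assume *: "\<forall>U V. \<forall>x\<in>carrier M. bisec U \<longrightarrow> bisec V \<longrightarrow>
      p2 (ss \<circ> face0 G) (indicator (rect ss U V)) (\<tau> V (\<tau> U x)) =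
      p2 (ss \<circ> face0 G) (indicator (rect ss U V)) (\<tau> (prodset U V) x)"
    show "\<forall>t\<in>carrier (P2 (rr \<circ> face1 G)). dstar G (face0 G) M T (dstar G (face2 G) M T t) = dstar G (face1 G) M T t"
    proof
      fix t assume "t \<in> carrier (P2 (rr \<circ> face1 G))"
      then show "dstar G (face0 G) M T (dstar G (face2 G) M T t) = dstar G (face1 G) M T t"
        using q
      proof (induction rule: P2_induct)
        case (rect U V x)
        then show ?case unfolding vals(2)[OF rect] vals(3)[OF rect] using * by blast
      next
        case (add s t)
        then show ?case
          using linmapD(2)[OF D02 add(1,2)] linmapD(2)[OF D1 add(1,2)] by simp
      qed
    qed
  qed
qed

text \<open>Slicing along \<open>U\<close> and summing along the source defines a map back to the
  module. If all of \<open>V\<close> is composable with \<open>U\<close>, the slice of the rectangle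
  is the indicator of \<open>V\<close>, so the whole corner over the sources of \<open>V\<close> is
  recovered.\<close>

lemma rect_trace:
  assumes U: "bisec U" and V: "bisec V" and sub: "rr ` V \<subseteq> ss ` U" and xy: "x \<in> carrier M" "y \<in> carrier M"
    and e: "p2 (ss \<circ> face0 G) (indicator (rect ss U V)) x = p2 (ss \<circ> face0 G) (indicator (rect ss U V)) y"
  shows "indicator (ss ` V) \<rhd> x = indicator (ss ` V) \<rhd> y"
proof -
  note c = P2_continuous[OF face_continuous(1) leg_ss]
  let ?\<beta> = "\<lambda>k x. lamp ss (slice ss U k) \<rhd> x"
  have s: "slice ss U k \<in> CG" if "k \<in> C2 ss" for k by (rule slice_closed[OF that leg_ss U])
  have l: "lamp ss (slice ss U k) \<in> CG0" if "k \<in> C2 ss" for k by (rule lamp_closed[OF s[OF that] leg_ss])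
  have b: "bilin (Cc G2) M M ?\<beta>"
    by (intro bilinI linmapI) (simp_all add: slice_add slice_smult lamp_add[OF s s leg_ss] lamp_smult l act_simps)
  have bal: "?\<beta> (pmult k (h \<circ> (ss \<circ> face0 G))) x = ?\<beta> k (h \<rhd> x)"
    if "k \<in> C2 ss" "h \<in> CG0" "x \<in> carrier M" for k h x
  proof -
    have "slice ss U (pmult k (h \<circ> (ss \<circ> face0 G))) = pmult (slice ss U k) (h \<circ> ss)"
      by (auto simp: slice_def pmult_def face0_def fun_eq_iff sum_distrib_right)
    then show ?thesis using lamp_pmult[OF s[OF that(1)] leg_ss] act_simps(6)[OF l[OF that(1)] that(2,3)] by simp
  qed
  obtain F where F: "\<And>k x. k \<in> C2 ss \<Longrightarrow> x \<in> carrier M \<Longrightarrow> F (p2 (ss \<circ> face0 G) k x) = ?\<beta> k x"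
    by (rule btens.btensor_lift[OF btens_ptensor[OF c] vspM b], simp add: bal, rule that, simp add: ppure_alt)
  have k: "indicator (rect ss U V) \<in> C2 ss" using copen_rect[OF leg_ss] U V by (intro indicator_CcInf) (simp add: bisec_copen)
  have "pmult (indicator U) (indicator U) = (indicator U :: 'g \<Rightarrow> complex)" by (auto simp: pmult_def indicator_def)
  then have "slice ss U (indicator (rect ss U V)) = conv G (indicator (ss ` U)) (indicator V)"
    using slice_ext[OF U leg_ss CG_indicator[OF U] CG_indicator[OF V]] lamp_indicator[OF U leg_ss]
    by (simp add: ext_indicators[OF U V])
  also have "\<dots> = indicator (prodset (ss ` U) V)"
    by (rule conv_indicators[OF bisec_unit[OF bisec_leg_image[OF U leg_ss]] V])
  also have "prodset (ss ` U) V = V"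
    using prodset_unit[OF bisec_leg_image[OF U leg_ss] V] sub by auto
  finally have "lamp ss (slice ss U (indicator (rect ss U V))) = indicator (ss ` V)"
    using lamp_indicator[OF V leg_ss] by simp
  then show ?thesis using F[OF k xy(1)] F[OF k xy(2)] e by simp
qed

end

section \<open>Modules define comodules\<close>

context ample_groupoid
begin

lemma iv_iv_image: "bisec U \<Longrightarrow> iv ` iv ` U = U"
  using bisec_in iv_iv by (force simp: image_iff)

lemma prodset_iv2: "bisec U \<Longrightarrow> prodset U (iv ` U) = rr ` U"
  using prodset_iv[OF bisec_iv] iv_iv_image leg_iv_image(2) by metis

lemma leg_units: "copen (gtop0 G) K \<Longrightarrow> leg p \<Longrightarrow> p ` K = K"
  using leg_unit by (force simp: copen0_iff image_iff subset_iff)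

lemma indicator_leg_subset:
  assumes U: "bisec U" and p: "leg p" and W: "W \<subseteq> U"
  shows "pmult (indicator U) (indicator (p ` W) \<circ> p) = indicator W"
proof
  fix a
  have "a \<in> U \<Longrightarrow> p a \<in> p ` W \<Longrightarrow> a \<in> W" using bisec_eq[OF U p] W by (metis imageE subsetD)
  then show "pmult (indicator U) (indicator (p ` W) \<circ> p) a = indicator W a"
    using W by (auto simp: pmult_def indicator_def)
qed

lemma prodset_range:
  assumes U: "bisec U" and W: "W \<subseteq> U" "copen (gtop G) W"
  shows "prodset (rr ` W) U = W"
proof -
  have "prodset (rr ` W) U = {a \<in> U. rr a \<in> rr ` W}"
    using prodset_unit[OF copen_leg_image[OF W(2) leg_rr] U] .
  also have "\<dots> = W" using bisec_eq[OF U leg_rr] W(1) by (auto simp: subset_iff)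
  finally show ?thesis .
qed

end

context unitary_module
begin

lemma indicator_act_Int:
  "copen (gtop0 G) K \<Longrightarrow> copen (gtop0 G) L \<Longrightarrow> x \<in> carrier M \<Longrightarrow>
    indicator K \<rhd> indicator L \<rhd> x = indicator (K \<inter> L) \<rhd> x"
proof -
  assume *: "copen (gtop0 G) K" "copen (gtop0 G) L" "x \<in> carrier M"
  have "pmult (indicator K) (indicator L) = (indicator (K \<inter> L) :: 'g \<Rightarrow> complex)"
    by (auto simp: pmult_def indicator_def)
  then show ?thesis using act_simps(6)[OF indicator_CcInf[OF *(1)] indicator_CcInf[OF *(2)] *(3)] by simp
qed

lemma indicator_act_closed: "copen (gtop0 G) K \<Longrightarrow> x \<in> carrier M \<Longrightarrow> indicator K \<rhd> x \<in> carrier M"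
  by (intro act_closed indicator_CcInf)

lemma cact_smult:
  assumes p: "leg p" and g: "g \<in> CG" and t: "t \<in> carrier (PG p)"
  shows "cact G p M (\<lambda>x. c * g x) t = c \<odot>\<^bsub>PG p\<^esub> cact G p M g t"
  using t p
proof (induction rule: PG_induct)
  case (pure f x)
  have "pmult (\<lambda>x. c * g x) f = (\<lambda>x. c * pmult g f x)" by (auto simp: pmult_def)
  then show ?case
    unfolding cact(2)[OF p CcInf_loc_const[OF CcInf_smult[OF g]] pure] cact(2)[OF p CcInf_loc_const[OF g] pure]
    using pg_simps(4)[OF p CcInf_pmult[OF g CcInf_loc_const[OF pure(1)]] pure(2)] by simp
next
  case (add s t)
  note c = cact_simps[OF p CcInf_loc_const[OF CcInf_smult[OF g]]] and c' = cact_simps[OF p CcInf_loc_const[OF g]]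
  show ?case unfolding c(2)[OF add(1,2)] c'(2)[OF add(1,2)] add(3,4)
    by (rule vspaceD(4)[OF PG_vspace[OF p] c'(1)[OF add(1)] c'(1)[OF add(2)], symmetric])
qed

lemma cact_indicator:
  assumes p: "leg p" and U: "bisec U" and V: "bisec V" and x: "x \<in> carrier M"
  shows "cact G p M (indicator V) (pg p (indicator U) x) = pg p (indicator (V \<inter> U)) x"
proof -
  have "pmult (indicator V) (indicator U) = (indicator (V \<inter> U) :: 'g \<Rightarrow> complex)"
    by (auto simp: pmult_def indicator_def)
  then show ?thesis using cact(2)[OF p bisec_loc_const[OF V] CG_indicator[OF U] x] by simp
qed

lemma pg_indicator_subset:
  assumes p: "leg p" and U: "bisec U" and W: "bisec W" "W \<subseteq> U" and x: "x \<in> carrier M"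
  shows "pg p (indicator U) (indicator (p ` W) \<rhd> x) = pg p (indicator W) x"
  using pg_bal[OF p CG_indicator[OF U] indicator_CcInf[OF bisec_leg_image[OF W(1) p]] x]
    indicator_leg_subset[OF U p W(2)] by simp

text \<open>Indicators of bisections generate both C_c(G) and C_c(G) \<otimes>^r M, and two of them
  multiply to the indicator of the intersection.\<close>

lemma clinearI:
  assumes T: "T \<in> lin (PG rr) (PG ss)"
    and ind: "\<And>U V x. bisec U \<Longrightarrow> bisec V \<Longrightarrow> x \<in> carrier M \<Longrightarrow>
      T (pg rr (indicator (V \<inter> U)) x) = cact G ss M (indicator V) (T (pg rr (indicator U) x))"
  shows "T \<in> clinear G M"
proof -
  note Ts = linmapD[OF lin_linmap[OF T]]
  have "T (cact G rr M g t) = cact G ss M g (T t)" if g: "g \<in> CG" and t: "t \<in> carrier (PG rr)" for g t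
    using g
  proof (induction g rule: CG_induct)
    case (indicator c V)
    note v = CG_indicator[OF indicator(1)]
    have *: "T (cact G rr M (indicator V) t) = cact G ss M (indicator V) (T t)"
      using t leg_rr
    proof (induction rule: PG_bisec_induct)
      case (indicator U x)
      then show ?case using ind[OF indicator(1) \<open>bisec V\<close> indicator(2)] \<open>bisec V\<close>
        by (simp add: cact_indicator[OF leg_rr])
    next
      case (add s t)
      note c = cact_simps[OF leg_rr CcInf_loc_const[OF v]] and c' = cact_simps[OF leg_ss CcInf_loc_const[OF v]]
      show ?case
        unfolding c(2)[OF add(1,2)] Ts(2)[OF c(1)[OF add(1)] c(1)[OF add(2)]] Ts(2)[OF add(1,2)]
          c'(2)[OF Ts(1)[OF add(1)] Ts(1)[OF add(2)]] add(3,4) ..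
    qed
    show ?case
      unfolding cact_smult[OF leg_rr v t] cact_smult[OF leg_ss v Ts(1)[OF t]]
        Ts(3)[OF cact_simps(1)[OF leg_rr CcInf_loc_const[OF v] t]] * ..
  next
    case (add f g)
    note l = CcInf_loc_const[OF add(1)] CcInf_loc_const[OF add(2)]
    show ?case
      unfolding cact_add[OF leg_rr l t] cact_add[OF leg_ss l Ts(1)[OF t]]
        Ts(2)[OF cact_simps(1)[OF leg_rr l(1) t] cact_simps(1)[OF leg_rr l(2) t]] add(3,4) ..
  qed
  then show ?thesis using T by (simp add: clinear_iff)
qed

end

context groupoid_module
begin

lemma indicator_lact:
  "bisec U \<Longrightarrow> bisec V \<Longrightarrow> x \<in> carrier M \<Longrightarrow>
    indicator U \<rhd> indicator V \<rhd> x = indicator (prodset U V) \<rhd> x"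
  using D_simps(6)[OF CG_indicator CG_indicator] conv_indicators by metis

lemma indicator_lact_closed: "bisec U \<Longrightarrow> x \<in> carrier M \<Longrightarrow> indicator U \<rhd> x \<in> carrier M"
  by (intro D_closed CG_indicator)

lemma indicator_range_lact:
  assumes U: "bisec U" and W: "W \<subseteq> U" "copen (gtop G) W" and x: "x \<in> carrier M"
  shows "indicator (rr ` W) \<rhd> indicator U \<rhd> x = indicator W \<rhd> x"
  using indicator_lact[OF bisec_unit[OF copen_leg_image[OF W(2) leg_rr]] U x] prodset_range[OF U W] by simp

text \<open>A tensor with the indicator of \<open>V \<inter> U\<close> sees only the corner over the
  sources of \<open>V \<inter> U\<close>. Projected to it, the action of the inverse of
  \<open>U\<close> becomes that of the inverse of \<open>V \<inter> U\<close>.\<close>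

lemma TM_clinear: "TM G M \<in> clinear G M"
proof (rule clinearI[OF TM_lin])
  fix U V x assume U: "bisec U" and V: "bisec V" and x: "x \<in> carrier M"
  have W: "bisec (V \<inter> U)" "bisec (iv ` U)" "bisec (iv ` (V \<inter> U))" using U V bisec_Int bisec_iv by auto
  note y = indicator_lact_closed[OF W(2) x] indicator_lact_closed[OF W(3) x]
  have "indicator (rr ` iv ` (V \<inter> U)) \<rhd> indicator (iv ` U) \<rhd> x = indicator (iv ` (V \<inter> U)) \<rhd> x"
    by (rule indicator_range_lact[OF W(2) _ bisec_copen[OF W(3)] x]) auto
  then have "indicator (ss ` (V \<inter> U)) \<rhd> indicator (iv ` U) \<rhd> x = indicator (iv ` (V \<inter> U)) \<rhd> x"
    by (simp add: leg_iv_image(1)[OF W(1)])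
  then have "pg ss (indicator (V \<inter> U)) (indicator (iv ` (V \<inter> U)) \<rhd> x) = pg ss (indicator (V \<inter> U)) (indicator (iv ` U) \<rhd> x)"
    using pg_indicator_range[OF leg_ss W(1) y(1)] by simp
  then show "TM G M (pg rr (indicator (V \<inter> U)) x) = cact G ss M (indicator V) (TM G M (pg rr (indicator U) x))"
    unfolding TM_indicator[OF W(1) x] TM_indicator[OF U x] cact_indicator[OF leg_ss U V y(1)] .
qed

lemma TM_surj_indicator:
  assumes U: "bisec U" and x: "x \<in> carrier M"
  shows "TM G M (pg rr (indicator U) (indicator U \<rhd> x)) = pg ss (indicator U) x"
  unfolding TM_indicator[OF U indicator_lact_closed[OF U x]] indicator_lact[OF bisec_iv[OF U] U x] prodset_iv[OF U]
  by (rule pg_indicator_range[OF leg_ss U x])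

lemma TM_bij: "bij_betw (TM G M) (carrier (PG rr)) (carrier (PG ss))"
proof -
  note Ts = linmapD[OF lin_linmap[OF TM_lin]]
  have "inj_on (TM G M) (carrier (PG rr))"
  proof (rule inj_onI)
    fix s t assume st: "s \<in> carrier (PG rr)" "t \<in> carrier (PG rr)" "TM G M s = TM G M t"
    show "s = t"
    proof (rule PG_eqI[OF leg_rr st(1,2)])
      fix U assume U: "bisec U"
      let ?y = "\<lambda>t. ptrace rr (cact G rr M (indicator U) t)"
      \<comment> \<open>\<open>TM\<close> multiplies the coordinate of \<open>t\<close> over
        \<open>U\<close> by the indicator of the inverse of \<open>U\<close>. Acting with the
        indicator of \<open>U\<close> afterwards amounts to the projection to the corner over the
        ranges of \<open>U\<close>, where the coordinate already lies.\<close>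
      have y: "?y t = indicator U \<rhd> ptrace ss (cact G ss M (indicator U) (TM G M t))" if t: "t \<in> carrier (PG rr)" for t
      proof -
        note l = bisec_loc_const[OF U]
        have y: "?y t \<in> carrier M" by (rule ptrace_simps(1)[OF leg_rr cact_simps(1)[OF leg_rr l t]])
        note iy = indicator_lact_closed[OF bisec_iv[OF U] y]
        have ry: "?y t = indicator (rr ` U) \<rhd> ?y t"
          using ptrace_indicator[OF leg_rr U y] cact_bisec[OF U leg_rr t] by simp
        have "cact G ss M (indicator U) (TM G M t) = TM G M (cact G rr M (indicator U) t)"
          using TM_clinear t CG_indicator[OF U] by (simp add: clinear_iff)
        then have "cact G ss M (indicator U) (TM G M t) = pg ss (indicator U) (indicator (iv ` U) \<rhd> ?y t)"
          using cact_bisec[OF U leg_rr t] TM_indicator[OF U y] by simp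
        then have "ptrace ss (cact G ss M (indicator U) (TM G M t)) = indicator (ss ` U) \<rhd> indicator (iv ` U) \<rhd> ?y t"
          using ptrace_indicator[OF leg_ss U iy] by simp
        also have "\<dots> = indicator (iv ` U) \<rhd> ?y t"
          using indicator_range_lact[OF bisec_iv[OF U] order_refl bisec_copen[OF bisec_iv[OF U]] y] leg_iv_image(1)[OF U] by simp
        finally have "indicator U \<rhd> ptrace ss (cact G ss M (indicator U) (TM G M t)) = indicator (rr ` U) \<rhd> ?y t"
          using indicator_lact[OF U bisec_iv[OF U] y] prodset_iv2[OF U] by simp
        with ry show ?thesis by simp
      qed
      show "?y s = ?y t" unfolding y[OF st(1)] y[OF st(2)] st(3) ..
    qed
  qed
  moreover have "t \<in> TM G M ` carrier (PG rr)" if "t \<in> carrier (PG ss)" for t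
    using that leg_ss
  proof (induction rule: PG_bisec_induct)
    case (indicator U x)
    then show ?case
      using TM_surj_indicator pg_closed[OF leg_rr CG_indicator indicator_lact_closed] by (metis imageI)
  next
    case (add s t)
    obtain s' where s': "s = TM G M s'" "s' \<in> carrier (PG rr)" using add(3) by (rule imageE)
    obtain t' where t': "t = TM G M t'" "t' \<in> carrier (PG rr)" using add(4) by (rule imageE)
    have "s \<oplus>\<^bsub>PG ss\<^esub> t = TM G M (s' \<oplus>\<^bsub>PG rr\<^esub> t')" unfolding Ts(2)[OF s'(2) t'(2)] s'(1) t'(1) ..
    then show ?case using PG_add_closed[OF leg_rr s'(2) t'(2)] by (rule image_eqI)
  qed
  ultimately show ?thesis using Ts(1) by (auto simp: bij_betw_def)
qed

text \<open>Inversion reverses products, so acting by the inverse of U and then by the inverse of V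
  is acting by the inverse of UV.\<close>

lemma TM_cocycle:
  "\<forall>t\<in>carrier (P2 (rr \<circ> face1 G)). dstar G (face0 G) M (TM G M) (dstar G (face2 G) M (TM G M) t) = dstar G (face1 G) M (TM G M) t"
  using indicator_lact_closed[OF bisec_iv] TM_indicator indicator_lact[OF bisec_iv bisec_iv]
  by (subst cocycle_iff[OF TM_clinear, where \<tau> = "\<lambda>U x. indicator (iv ` U) \<rhd> x"]) (simp_all add: iv_prodset)

end

section \<open>Comodules define modules\<close>

locale groupoid_comodule = ample_groupoid G
  for G :: "'g groupoid" +
  fixes M :: "('g, 'm) comod"
  assumes comod: "comodule G M"

sublocale groupoid_comodule \<subseteq> unitary_module
  by unfold_locales (use comod in \<open>simp add: comodule_def\<close>)

context groupoid_comodule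
begin

abbreviation "T \<equiv> coT M"
abbreviation "S \<equiv> inv_into (carrier (PG rr)) T"

lemma T_clinear: "T \<in> clinear G M" and T_bij: "bij_betw T (carrier (PG rr)) (carrier (PG ss))"
  and T_cocycle: "\<forall>t\<in>carrier (P2 (rr \<circ> face1 G)). dstar G (face0 G) M T (dstar G (face2 G) M T t) = dstar G (face1 G) M T t"
  using comod by (auto simp: comodule_def)

lemma T_lin: "T \<in> lin (PG rr) (PG ss)" and T_cact: "g \<in> CG \<Longrightarrow> t \<in> carrier (PG rr) \<Longrightarrow> T (cact G rr M g t) = cact G ss M g (T t)"
  using T_clinear by (auto simp: clinear_iff)

lemmas T_simps = linmapD[OF lin_linmap[OF T_lin]]

lemma S_linmap: "linmap (PG ss) (PG rr) S"
  by (rule linmap_inv_into[OF PG_vspace[OF leg_rr] lin_linmap[OF T_lin] T_bij])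

lemmas S_simps = linmapD[OF S_linmap]

lemma TS: "t \<in> carrier (PG ss) \<Longrightarrow> T (S t) = t" and ST: "t \<in> carrier (PG rr) \<Longrightarrow> S (T t) = t"
  using T_bij by (auto simp: bij_betw_def f_inv_into_f)

lemma S_cact: "g \<in> CG \<Longrightarrow> t \<in> carrier (PG ss) \<Longrightarrow> S (cact G ss M g t) = cact G rr M g (S t)"
  using T_cact[OF _ S_simps(1)] TS ST[OF cact_simps(1)[OF leg_rr CcInf_loc_const S_simps(1)]] by metis

text \<open>The action prescribed by the functor B without the detour through the tensor product
  over C_c(G0); the two are matched in \<open>muM_pure\<close>.\<close>

definition mu :: "('g \<Rightarrow> complex) \<Rightarrow> 'm \<Rightarrow> 'm"
  where "mu f x = ptrace rr (S (pg ss f x))"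

definition tau :: "'g set \<Rightarrow> 'm \<Rightarrow> 'm"
  where "tau U x = ptrace ss (T (pg rr (indicator U) x))"

text \<open>The action is defined through pure tensors over \<open>DG G\<close>, the quotient map
  through those over \<open>CcG G\<close>. The two records differ in their product only, which the
  bilinearity relations do not mention.\<close>

lemma pquot_pure: "pquot G (gtop G) ss M (pure (DG G) M f x) = pg ss f x"
proof -
  have "bilin_rels (DG G) M = bilin_rels (CcG G) M" by (simp add: bilin_rels_def)
  then show ?thesis by (simp add: pquot_def pure_def ppure_def bpure_def)
qed

text \<open>Both sides are linear and send f \<otimes> x to the fibrewise sum of f acting on
  x.\<close>

lemma lam_tensor_ptrace:
  assumes t: "t \<in> carrier (PG rr)" shows "mult_map (CcG0 G) M (lam_tensor G M t) = ptrace rr t"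
proof -
  interpret R: btens "CcG0 G" M "carrier (CcG0 G)" "mult (CcG0 G)" "lact M"
    by (rule units0.btens_rtensor[OF alg_M])
  note r = R.bpure_simps[folded rtensor_def rpure_def, simplified]
  note rb = R.bpure_bal[folded rtensor_def rpure_def, simplified]
  note m = units0.mult_map[OF alg_M]
  have b: "bilin (CcG G) M (rtensor (CcG0 G) M) (\<lambda>f x. rpure (CcG0 G) M (lam G f) x)"
    by (intro bilinI linmapI)
       (simp_all add: lam_eq CcInf_add CcInf_smult lamp_add[OF _ _ leg_rr] lamp_smult lamp_closed[OF _ leg_rr] r)
  have bal: "rpure (CcG0 G) M (lam G (pmult f (h \<circ> rr))) x = rpure (CcG0 G) M (lam G f) (h \<rhd> x)"
    if "f \<in> CG" "h \<in> CG0" "x \<in> carrier M" for f h x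
    using that rb[OF lamp_closed[OF that(1) leg_rr] that(2,3)]
    by (simp add: lam_eq pmult_leg_CG[OF _ _ leg_rr] lamp_pmult[OF _ leg_rr])
  note l = PT_the_lin[OF leg_continuous[OF leg_rr] R.vspace_btensor[folded rtensor_def] b, folded lam_tensor_def]
  have l1: "linmap (PG rr) (rtensor (CcG0 G) M) (lam_tensor G M)"
    and l2: "f \<in> CG \<Longrightarrow> x \<in> carrier M \<Longrightarrow> lam_tensor G M (pg rr f x) = rpure (CcG0 G) M (lam G f) x" for f x
    using l bal by (auto simp: lin_iff)
  have "(mult_map (CcG0 G) M \<circ> lam_tensor G M) t = ptrace rr t"
  proof (rule PG_linmap_eqI[OF leg_rr vspM linmap_comp[OF l1 lin_linmap[OF m(1)]] ptrace_linmap[OF leg_rr] _ t])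
    fix f x assume fx: "f \<in> CG" "x \<in> carrier M"
    show "(mult_map (CcG0 G) M \<circ> lam_tensor G M) (pg rr f x) = ptrace rr (pg rr f x)"
      using m(2)[of "lam G f" x] fx lamp_closed[OF fx(1) leg_rr]
      by (simp add: l2 ptrace(2)[OF leg_rr] lam_eq)
  qed
  then show ?thesis by simp
qed

lemma muM_pure: "f \<in> CG \<Longrightarrow> x \<in> carrier M \<Longrightarrow> muM G M (pure (DG G) M f x) = mu f x"
  using lam_tensor_ptrace[OF S_simps(1)[OF pg_closed[OF leg_ss]]] by (simp add: muM_def pquot_pure mu_def)

lemma bilin_mu: "bilin (DG G) M M mu"
proof -
  have "bilin (CcG G) M M mu"
    unfolding mu_def
    by (intro bilinI linmapI)
       (simp_all add: pg_simps[OF leg_ss] S_simps ptrace_simps[OF leg_rr])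
  then show ?thesis by (simp add: bilin_def linmap_def)
qed

lemmas mu_simps = bilinD[OF bilin_mu, simplified]

lemma mu_closed: "bisec U \<Longrightarrow> x \<in> carrier M \<Longrightarrow> mu (indicator U) x \<in> carrier M"
  by (intro mu_simps(1) CG_indicator)

text \<open>\<open>S\<close> commutes with multiplication by the indicator of \<open>U\<close>, so
  the image remains supported on \<open>U\<close> and is determined by its trace.\<close>

lemma S_indicator:
  assumes U: "bisec U" and x: "x \<in> carrier M"
  shows "S (pg ss (indicator U) x) = pg rr (indicator U) (mu (indicator U) x)"
proof -
  note c = pg_closed[OF leg_ss CG_indicator[OF U] x]
  have "S (pg ss (indicator U) x) = cact G rr M (indicator U) (S (pg ss (indicator U) x))"
    using S_cact[OF CG_indicator[OF U] c] cact_indicator[OF leg_ss U U x] by simp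
  then show ?thesis using cact_bisec[OF U leg_rr S_simps(1)[OF c]] by (simp add: mu_def)
qed

lemma mu_range:
  assumes U: "bisec U" and x: "x \<in> carrier M"
  shows "indicator (rr ` U) \<rhd> mu (indicator U) x = mu (indicator U) x"
proof -
  have "ptrace rr (S (pg ss (indicator U) x)) = indicator (rr ` U) \<rhd> mu (indicator U) x"
    unfolding S_indicator[OF U x] by (rule ptrace_indicator[OF leg_rr U mu_closed[OF U x]])
  then have "mu (indicator U) x = indicator (rr ` U) \<rhd> mu (indicator U) x" unfolding mu_def[symmetric] .
  then show ?thesis by (rule sym)
qed

lemma tau_closed: "bisec U \<Longrightarrow> x \<in> carrier M \<Longrightarrow> tau U x \<in> carrier M"
  unfolding tau_def by (intro ptrace_simps(1) leg_ss T_simps(1) pg_closed leg_rr CG_indicator)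

lemma T_indicator:
  assumes U: "bisec U" and x: "x \<in> carrier M"
  shows "T (pg rr (indicator U) x) = pg ss (indicator U) (tau U x)"
proof -
  note c = pg_closed[OF leg_rr CG_indicator[OF U] x]
  have "T (pg rr (indicator U) x) = cact G ss M (indicator U) (T (pg rr (indicator U) x))"
    using T_cact[OF CG_indicator[OF U] c] cact_indicator[OF leg_rr U U x] by simp
  then show ?thesis using cact_bisec[OF U leg_ss T_simps(1)[OF c]] by (simp add: tau_def)
qed

lemma tau_range:
  assumes U: "bisec U" and x: "x \<in> carrier M"
  shows "indicator (ss ` U) \<rhd> tau U x = tau U x"
proof -
  have "ptrace ss (T (pg rr (indicator U) x)) = indicator (ss ` U) \<rhd> tau U x"
    unfolding T_indicator[OF U x] by (rule ptrace_indicator[OF leg_ss U tau_closed[OF U x]])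
  then have "tau U x = indicator (ss ` U) \<rhd> tau U x" unfolding tau_def[symmetric] .
  then show ?thesis by (rule sym)
qed

text \<open>\<open>S\<close> inverts \<open>T\<close>, read in coordinates over \<open>U\<close>.
  The two maps are inverse to each other only between the corners over the ranges and the sources of
  \<open>U\<close>, whence the projection on the right.\<close>

lemma mu_tau:
  assumes U: "bisec U" and x: "x \<in> carrier M"
  shows "mu (indicator U) (tau U x) = indicator (rr ` U) \<rhd> x"
proof -
  have "pg rr (indicator U) (mu (indicator U) (tau U x)) = pg rr (indicator U) x"
    using ST[OF pg_closed[OF leg_rr CG_indicator[OF U] x]] T_indicator[OF U x] S_indicator[OF U tau_closed[OF U x]] by simp
  then show ?thesis
    using ptrace_indicator[OF leg_rr U x] ptrace_indicator[OF leg_rr U mu_closed[OF U tau_closed[OF U x]]]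
      mu_range[OF U tau_closed[OF U x]] by simp
qed

lemma tau_mu:
  assumes U: "bisec U" and x: "x \<in> carrier M"
  shows "tau U (mu (indicator U) x) = indicator (ss ` U) \<rhd> x"
proof -
  have "pg ss (indicator U) (tau U (mu (indicator U) x)) = pg ss (indicator U) x"
    using TS[OF pg_closed[OF leg_ss CG_indicator[OF U] x]] T_indicator[OF U mu_closed[OF U x]] S_indicator[OF U x] by simp
  then show ?thesis
    using ptrace_indicator[OF leg_ss U x] ptrace_indicator[OF leg_ss U tau_closed[OF U mu_closed[OF U x]]]
      tau_range[OF U mu_closed[OF U x]] by simp
qed

text \<open>A bisection can be trimmed on either side: on the source by balancing, on the range
  because \<open>S\<close> commutes with the pointwise action.\<close>

lemma mu_subset:
  assumes U: "bisec U" and W: "bisec W" "W \<subseteq> U" and x: "x \<in> carrier M"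
  shows "mu (indicator W) x = mu (indicator U) (indicator (ss ` W) \<rhd> x)"
    "mu (indicator W) x = indicator (rr ` W) \<rhd> mu (indicator U) x"
proof -
  show "mu (indicator W) x = mu (indicator U) (indicator (ss ` W) \<rhd> x)"
    unfolding mu_def pg_indicator_subset[OF leg_ss U W x] ..
  have WU: "W \<inter> U = W" using W(2) by auto
  have "S (pg ss (indicator W) x) = cact G rr M (indicator W) (S (pg ss (indicator U) x))"
    using S_cact[OF CG_indicator[OF W(1)] pg_closed[OF leg_ss CG_indicator[OF U] x]] cact_indicator[OF leg_ss U W(1) x] WU by simp
  also have "\<dots> = pg rr (indicator W) (mu (indicator U) x)"
    unfolding S_indicator[OF U x] cact_indicator[OF leg_rr U W(1) mu_closed[OF U x]] WU ..
  finally have "ptrace rr (S (pg ss (indicator W) x)) = indicator (rr ` W) \<rhd> mu (indicator U) x"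
    using ptrace_indicator[OF leg_rr W(1) mu_closed[OF U x]] by simp
  then show "mu (indicator W) x = indicator (rr ` W) \<rhd> mu (indicator U) x" unfolding mu_def[symmetric] .
qed

text \<open>The cocycle identity gives equality after tensoring with the indicator of the rectangle.
  By the inclusion, every arrow of \<open>V\<close> occurs in the rectangle, so tracing back yields
  equality on the corner over the sources of \<open>V\<close>, and both sides lie in that
  corner.\<close>

lemma tau_prodset:
  assumes U: "bisec U" and V: "bisec V" and sub: "rr ` V \<subseteq> ss ` U" and x: "x \<in> carrier M"
  shows "tau V (tau U x) = tau (prodset U V) x"
proof -
  note UV = bisec_prodset[OF U V]
  note c = tau_closed[OF V tau_closed[OF U x]] tau_closed[OF UV x]
  have "p2 (ss \<circ> face0 G) (indicator (rect ss U V)) (tau V (tau U x)) =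
      p2 (ss \<circ> face0 G) (indicator (rect ss U V)) (tau (prodset U V) x)"
    using T_cocycle cocycle_iff[OF T_clinear tau_closed T_indicator] U V x by blast
  from rect_trace[OF U V sub c this]
  have "indicator (ss ` V) \<rhd> tau V (tau U x) = indicator (ss ` V) \<rhd> tau (prodset U V) x" .
  moreover have "ss ` prodset U V = ss ` V"
  proof (intro equalityI subsetI)
    fix y assume "y \<in> ss ` prodset U V"
    then show "y \<in> ss ` V" using bisec_in[OF U] bisec_in[OF V] by (auto simp: prodset_def ss_mul)
  next
    fix y assume "y \<in> ss ` V"
    then obtain b where b: "b \<in> V" "y = ss b" by blast
    then have "rr b \<in> ss ` U" using sub by blast
    then obtain a where a: "a \<in> U" "ss a = rr b" by (metis imageE)
    then have "a \<diamond> b \<in> prodset U V" "ss (a \<diamond> b) = y"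
      using b bisec_in[OF U] bisec_in[OF V] by (auto simp: prodset_def ss_mul)
    then show "y \<in> ss ` prodset U V" by (metis imageI)
  qed
  ultimately show ?thesis using tau_range[OF V tau_closed[OF U x]] tau_range[OF UV x] by simp
qed

lemma mu_prodset_eq:
  assumes U: "bisec U" and V: "bisec V" and eq: "ss ` U = rr ` V" and x: "x \<in> carrier M"
  shows "mu (indicator U) (mu (indicator V) x) = mu (indicator (prodset U V)) x"
proof -
  note UV = bisec_prodset[OF U V]
  let ?z = "mu (indicator V) x" and ?y = "mu (indicator U) (mu (indicator V) x)"
  note z = mu_closed[OF V x] and y = mu_closed[OF U mu_closed[OF V x]]
  have rUV: "rr ` prodset U V = rr ` U"
  proof (intro equalityI subsetI)
    fix y assume "y \<in> rr ` prodset U V"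
    then show "y \<in> rr ` U" using bisec_in[OF U] bisec_in[OF V] by (auto simp: prodset_def rr_mul)
  next
    fix y assume "y \<in> rr ` U"
    then obtain a where a: "a \<in> U" "y = rr a" by blast
    then obtain b where b: "b \<in> V" "ss a = rr b" using eq by blast
    then have "a \<diamond> b \<in> prodset U V" "rr (a \<diamond> b) = y"
      using a bisec_in[OF U] bisec_in[OF V] by (auto simp: prodset_def rr_mul)
    then show "y \<in> rr ` prodset U V" by (metis imageI)
  qed
  \<comment> \<open>Because the ranges of \<open>V\<close> are the sources of \<open>U\<close>, the
    maps tau of \<open>U\<close> and \<open>V\<close> cancel the two applications of
    \<open>mu\<close> down to the projection to the corner over the sources of \<open>V\<close>.
    Applying \<open>mu\<close> at the product bisection to both sides gives the claim.\<close>
  have sUV: "indicator (ss ` V) \<rhd> x = tau (prodset U V) ?y"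
    using tau_prodset[OF U V _ y] eq tau_mu[OF U z] mu_range[OF V x] tau_mu[OF V x] by simp
  have "mu (indicator (prodset U V)) (tau (prodset U V) ?y) = ?y"
    using mu_tau[OF UV y] rUV mu_range[OF U z] by simp
  moreover have "mu (indicator (prodset U V)) (indicator (ss ` V) \<rhd> x) = mu (indicator (prodset U V)) x"
  proof -
    have "ss ` prodset U V \<subseteq> ss ` V" using bisec_in[OF U] bisec_in[OF V] by (auto simp: prodset_def ss_mul)
    then have "ss ` prodset U V \<inter> ss ` V = ss ` prodset U V" by auto
    then show ?thesis
      using mu_subset(1)[OF UV UV order_refl x] mu_subset(1)[OF UV UV order_refl indicator_act_closed[OF bisec_leg_image[OF V leg_ss] x]]
        indicator_act_Int[OF bisec_leg_image[OF UV leg_ss] bisec_leg_image[OF V leg_ss] x] by simp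
  qed
  ultimately show ?thesis using sUV by simp
qed

lemma mu_prodset:
  assumes U: "bisec U" and V: "bisec V" and x: "x \<in> carrier M"
  shows "mu (indicator U) (mu (indicator V) x) = mu (indicator (prodset U V)) x"
proof -
  \<comment> \<open>Discarding arrows without a partner leaves the product set unchanged and makes
    the sources of the first factor equal to the ranges of the second. Afterwards
    \<open>mu_subset\<close> turns the trimming into projections, which are absorbed.\<close>
  let ?U = "{a \<in> U. ss a \<in> rr ` V}" and ?V = "{b \<in> V. rr b \<in> ss ` U}"
  note lU = bisec_leg_image[OF U leg_ss] and lV = bisec_leg_image[OF V leg_rr]
  have U': "bisec ?U" and V': "bisec ?V"
    using bisec_restrict[OF U leg_ss lV] bisec_restrict[OF V leg_rr lU] by auto
  have *: "f ` {a \<in> A. f a \<in> B} = B \<inter> f ` A" for f :: "'g \<Rightarrow> 'g" and A B by auto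
  have D: "ss ` ?U = ss ` U \<inter> rr ` V" "rr ` ?V = ss ` U \<inter> rr ` V" using *[of ss U] *[of rr V] by auto
  have P: "prodset ?U ?V = prodset U V"
    unfolding prodset_def by (intro Collect_cong ex_cong1) (auto, metis imageI)
  note z = mu_closed[OF V x]
  have "mu (indicator (prodset U V)) x = mu (indicator ?U) (mu (indicator ?V) x)"
    using mu_prodset_eq[OF U' V' _ x] D P by simp
  also have "\<dots> = mu (indicator U) (indicator (ss ` ?U) \<rhd> indicator (rr ` ?V) \<rhd> mu (indicator V) x)"
    using mu_subset(1)[OF U U' _ mu_closed[OF V' x]] mu_subset(2)[OF V V' _ x] by auto
  also have "\<dots> = mu (indicator U) (indicator (ss ` U) \<rhd> indicator (rr ` V) \<rhd> mu (indicator V) x)"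
    unfolding D using indicator_act_Int[OF lU lV z]
      indicator_act_Int[OF copen_Int[OF lU lV] copen_Int[OF lU lV] z] by simp
  also have "\<dots> = mu (indicator U) (mu (indicator V) x)"
    using mu_subset(1)[OF U U order_refl z] mu_range[OF V x] by simp
  finally show ?thesis by simp
qed

text \<open>As KK = K, \<open>mu\<close> at \<open>K\<close> is idempotent; since
  \<open>tau K\<close> inverts it on the corner over \<open>K\<close>, it is the identity there. Off
  the corner both sides depend only on the projection.\<close>

lemma mu_unit_indicator:
  assumes K: "copen (gtop0 G) K" and x: "x \<in> carrier M"
  shows "mu (indicator K) x = indicator K \<rhd> x"
proof -
  note B = bisec_unit[OF K]
  note y = mu_closed[OF B x]
  have i: "rr ` K = K" "ss ` K = K" using leg_units[OF K] leg_rr leg_ss by auto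
  have "prodset K K = K" using prodset_unit[OF K B] i(1) by auto
  then have "mu (indicator K) (mu (indicator K) x) = mu (indicator K) x" using mu_prodset[OF B B x] by simp
  then have "tau K (mu (indicator K) x) = indicator K \<rhd> mu (indicator K) x" using tau_mu[OF B y] i by simp
  then show ?thesis using tau_mu[OF B x] mu_range[OF B x] i by simp
qed

lemma mu_unit:
  assumes h: "h \<in> CG0" and x: "x \<in> carrier M" shows "mu h x = h \<rhd> x"
  using h
proof (induction h rule: units.Cc_induct)
  case (indicator c K)
  then have K: "copen (gtop0 G) K" by simp
  show ?case
    using mu_simps(4)[OF CG_indicator[OF bisec_unit[OF K]] x] act_simps(4)[OF indicator_CcInf[OF K] x]
      mu_unit_indicator[OF K x] by simp
next
  case (add f g)
  then show ?case using mu_simps(2)[OF CG0_CG CG0_CG x] act_simps(3)[OF _ _ x] by simp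
qed

text \<open>Both sides are bilinear in \<open>f\<close> and \<open>g\<close>, and the convolution of
  two indicators is the indicator of the product bisection.\<close>

lemma mu_conv:
  assumes f: "f \<in> CG" and g: "g \<in> CG" and x: "x \<in> carrier M"
  shows "mu (conv G f g) x = mu f (mu g x)"
  using f
proof (induction f rule: CG_induct)
  case (indicator c U)
  note u = CG_indicator[OF indicator]
  have "mu (conv G (indicator U) g) x = mu (indicator U) (mu g x)"
    using g
  proof (induction g rule: CG_induct)
    case (indicator d V)
    note v = CG_indicator[OF indicator]
    show ?case
      unfolding conv_smult_right mu_simps(4)[OF conv_closed[OF u v] x] mu_simps(4)[OF v x]
        mu_simps(5)[OF u mu_simps(1)[OF v x]] conv_indicators[OF \<open>bisec U\<close> indicator]
        mu_simps(4)[OF CG_indicator[OF bisec_prodset[OF \<open>bisec U\<close> indicator]] x] mu_prodset[OF \<open>bisec U\<close> indicator x] ..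
  next
    case (add g g')
    show ?case
      unfolding conv_add_right mu_simps(2)[OF conv_closed[OF u add(1)] conv_closed[OF u add(2)] x] mu_simps(2)[OF add(1,2) x]
        mu_simps(3)[OF u mu_simps(1)[OF add(1) x] mu_simps(1)[OF add(2) x]] add(3,4) ..
  qed
  then show ?case
    unfolding conv_smult_left mu_simps(4)[OF conv_closed[OF u g] x] mu_simps(4)[OF u mu_simps(1)[OF g x]] by simp
next
  case (add f f')
  show ?case
    unfolding conv_add_left[OF add(1,2)] mu_simps(2)[OF conv_closed[OF add(1) g] conv_closed[OF add(2) g] x]
      mu_simps(2)[OF add(1,2) mu_simps(1)[OF g x]] add(3,4) ..
qed

text \<open>By multiplicativity, \<open>mu\<close> at the inverse of \<open>U\<close> after
  \<open>mu\<close> at \<open>U\<close> is the projection to the corner over the sources of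
  \<open>U\<close>. So \<open>mu\<close> at the inverse of \<open>U\<close> inverts
  \<open>mu\<close> at \<open>U\<close> between the corners, as \<open>tau U\<close> does.\<close>

lemma tau_eq_mu:
  assumes U: "bisec U" and x: "x \<in> carrier M" shows "tau U x = mu (indicator (iv ` U)) x"
proof -
  note I = bisec_iv[OF U] and t = tau_closed[OF U x]
  have "mu (indicator (iv ` U)) (mu (indicator U) (tau U x)) = indicator (ss ` U) \<rhd> tau U x"
    using mu_prodset[OF I U t] mu_unit_indicator[OF bisec_leg_image[OF U leg_ss] t] prodset_iv[OF U] by simp
  also have "\<dots> = tau U x" by (rule tau_range[OF U x])
  finally show ?thesis
    using mu_tau[OF U x] mu_subset(1)[OF I I order_refl x] leg_iv_image(2)[OF U] by simp
qed

end

section \<open>Invariance under change of the ambient record\<close>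

lemma vspace_cong:
  assumes "vspace W" "carrier W' = carrier W" "add W' = add W" "zero W' = zero W" "smult W' = smult W"
  shows "vspace W'"
proof -
  interpret W: abelian_group W by (rule vspaceD(1)[OF assms(1)])
  have "abelian_group W'"
  proof (rule abelian_groupI)
    show "\<exists>y\<in>carrier W'. y \<oplus>\<^bsub>W'\<^esub> x = \<zero>\<^bsub>W'\<^esub>" if "x \<in> carrier W'" for x
      using that W.l_neg[of x] W.a_inv_closed[of x] unfolding assms(2-5) by blast
  qed (simp_all add: assms(2-5) W.a_ac)
  then show ?thesis
    by (rule vspaceI) (simp_all add: assms(2-5) vspaceD[OF assms(1)])
qed

lemma tensor_cong:
  assumes "carrier W' = carrier W" "add W' = add W" "smult W' = smult W"
  shows "tensor V W' = tensor V W" "pure V W' = pure V W"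
proof -
  have "bilin_rels V W' = bilin_rels V W" by (simp add: bilin_rels_def assms)
  then show "tensor V W' = tensor V W" "pure V W' = pure V W"
    by (simp_all add: tensor_def pure_def fun_eq_iff assms(1))
qed

lemma btensor_cong:
  assumes "carrier W' = carrier W" "add W' = add W" "smult W' = smult W"
    and "\<And>r w. r \<in> R \<Longrightarrow> w \<in> carrier W \<Longrightarrow> la' r w = la r w"
  shows "btensor V W' R ra la' = btensor V W R ra la" "bpure V W' R ra la' = bpure V W R ra la"
proof -
  have "bal_rels V W' R ra la' = bal_rels V W R ra la"
    unfolding bal_rels_def tensor_cong[OF assms(1-3)] assms(1)
    by (intro Collect_cong ex_cong1) (auto simp: assms(4))
  then show "btensor V W' R ra la' = btensor V W R ra la" "bpure V W' R ra la' = bpure V W R ra la"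
    by (simp_all add: btensor_def bpure_def fun_eq_iff tensor_cong[OF assms(1-3)])
qed

lemma lin_cong:
  assumes "carrier W' = carrier W" "add W' = add W" "smult W' = smult W"
    and "carrier V' = carrier V" "add V' = add V" "smult V' = smult V"
  shows "lin V' W' = lin V W"
  by (simp add: lin_def assms)

text \<open>The pulled-back tensor products see a module only through its linear structure and the
  action of functions on units. Both functors keep these, so the spaces for an object and for its
  image are literally equal.\<close>

locale same_module =
  fixes G :: "'g groupoid" and N :: "('g \<Rightarrow> complex, 'm, 'y) alg_mod_scheme" and M :: "('g \<Rightarrow> complex, 'm, 'z) alg_mod_scheme"
  assumes same: "carrier N = carrier M" "add N = add M" "smult N = smult M" "zero N = zero M"
    and same_lact: "h \<in> CcInf (gtop0 G) \<Longrightarrow> x \<in> carrier M \<Longrightarrow> lact N h x = lact M h x"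
begin

lemma ptensor_same: "ptensor G E p N = ptensor G E p M" "ppure G E p N = ppure G E p M"
  unfolding ptensor_def ppure_def by (rule btensor_cong[OF same(1-3)], simp add: same_lact)+

lemma cact_same: "cact G p N = cact G p M"
  by (simp add: cact_def ptensor_same same fun_eq_iff)

lemma clinear_same: "clinear G N = clinear G M"
  by (simp add: clinear_def ptensor_same cact_same)

lemma dtensor_same: "dtensor G d p N = dtensor G d p M" "dpure G d p N = dpure G d p M"
  by (simp_all add: dtensor_def dpure_def ptensor_same cact_same)

lemma dstar_same: "dstar G d N = dstar G d M"
  by (simp add: dstar_def dident_def id_tensor_def ptensor_same dtensor_same same fun_eq_iff)

lemma rtensor_same: "rtensor (CcG0 G) N = rtensor (CcG0 G) M" "rpure (CcG0 G) N = rpure (CcG0 G) M"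
  unfolding rtensor_def rpure_def by (rule btensor_cong[OF same(1-3)], simp add: same_lact)+

lemma mult_map_same: "mult_map (CcG0 G) N = mult_map (CcG0 G) M"
proof -
  have e: "(\<forall>a\<in>carrier (CcG0 G). \<forall>x\<in>carrier N. F (rpure (CcG0 G) N a x) = lact N a x) \<longleftrightarrow>
      (\<forall>a\<in>carrier (CcG0 G). \<forall>x\<in>carrier M. F (rpure (CcG0 G) M a x) = lact M a x)" for F
    by (auto simp: rtensor_same same(1) same_lact)
  show ?thesis
    unfolding mult_map_def the_lin_def e unfolding rtensor_same lin_cong[OF same(1-3) refl refl refl] ..
qed

lemma essential_same:
  assumes "essential (CcG0 G) M" shows "essential (CcG0 G) N"
proof -
  have M: "alg_module (CcG0 G) M" using assms by (simp add: essential_def)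
  have v: "vspace N" by (rule vspace_cong[OF alg_moduleD(1)[OF M] same(1,2,4,3)])
  have "pmult a b \<in> CcInf (gtop0 G)" if "a \<in> CcInf (gtop0 G)" "b \<in> CcInf (gtop0 G)" for a b
    using CcInf_pmult[OF that(1) CcInf_loc_const[OF that(2)]] .
  then have "alg_module (CcG0 G) N"
    unfolding alg_module_def using v M vspaceD(2)[OF v] vspaceD(2)[OF alg_moduleD(1)[OF M]]
      abelian_monoid.a_closed[OF abelian_group.axioms(1)[OF vspaceD(1)[OF alg_moduleD(1)[OF M]]]]
    by (auto simp: same same_lact alg_moduleD(2-7)[OF M, simplified] CcInf_add CcInf_smult)
  then show ?thesis using assms by (simp add: essential_def mult_map_same rtensor_same same(1))
qed

end

section \<open>The functors on objects\<close>

abbreviation "AO G \<equiv> omap (functor_A G)"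
abbreviation "BO G \<equiv> omap (functor_B G)"

lemma AO_simps [simp]:
  "carrier (AO G M) = carrier M" "add (AO G M) = add M" "zero (AO G M) = zero M" "smult (AO G M) = smult M"
  "mult (AO G M) = mult M" "one (AO G M) = one M" "coT (AO G M) = TM G M"
  "lact (AO G M) = (\<lambda>h. if h \<in> CcInf (gtop0 G) then lact M h else (\<lambda>_. undefined))"
  by (simp_all add: functor_A_def)

lemma BO_simps [simp]:
  "carrier (BO G M) = carrier M" "add (BO G M) = add M" "zero (BO G M) = zero M" "smult (BO G M) = smult M"
  "mult (BO G M) = mult M" "one (BO G M) = one M"
  "lact (BO G M) = (\<lambda>f x. if f \<in> CcInf (gtop G) \<and> x \<in> carrier M then muM G M (pure (DG G) M f x) else undefined)"
  by (simp_all add: functor_B_def)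

context ample_groupoid
begin

lemma same_AO: "same_module G (AO G M) M"
  by (rule same_module.intro) simp_all

lemma comodule_AO:
  assumes "essential (DG G) M" shows "comodule G (AO G M)"
proof -
  interpret M: groupoid_module G M by unfold_locales (rule assms)
  interpret same_module G "AO G M" M by (rule same_AO)
  show ?thesis
    unfolding comodule_def
    using essential_same[OF M.ess] M.TM_clinear M.TM_bij M.TM_cocycle
    by (simp add: clinear_same ptensor_same dstar_same)
qed

lemma normalised_AO: "normalised (DG G) M \<Longrightarrow> normalised (CcG0 G) (AO G M)"
  by (auto simp: normalised_def CG0_CG)

lemma BO_AO:
  fixes M :: "('a \<Rightarrow> complex, 'm) alg_mod"
  assumes "essential (DG G) M" "normalised (DG G) M" shows "BO G (AO G M) = M"
proof -
  interpret M: groupoid_module G M by unfold_locales (rule assms)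
  interpret same_module G "AO G M" M by (rule same_AO)
  interpret N: groupoid_comodule G "AO G M" by unfold_locales (rule comodule_AO[OF assms(1)])
  \<comment> \<open>The trace uses the action of functions on units only, and there the functor A
    changes nothing.\<close>
  have tr: "N.ptrace p = M.ptrace p" if "leg p" for p
    by (simp add: N.ptrace_def M.ptrace_def the_lin_def lin_def ptensor_same lamp_closed[OF _ that])
  have mu: "N.mu f x = lact M f x" if f: "f \<in> CG" and x: "x \<in> carrier M" for f x
    using f
  proof (induction f rule: CG_induct)
    case (indicator c U)
    note y = M.indicator_lact_closed[OF indicator x]
    \<comment> \<open>The computation behind surjectivity of \<open>TM\<close> exhibits the
      preimage, so the inverse is known on generators.\<close>
    have "inv_into (carrier (M.PG rr)) (TM G M) (M.pg ss (indicator U) x) = M.pg rr (indicator U) (lact M (indicator U) x)"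
      using M.TM_surj_indicator[OF indicator x] M.TM_bij M.pg_closed[OF leg_rr CG_indicator[OF indicator] y]
      by (metis bij_betw_imp_inj_on inv_into_f_f)
    then have "N.mu (indicator U) x = lact M (indicator (rr ` U)) (lact M (indicator U) x)"
      using M.ptrace_indicator[OF leg_rr indicator y] by (simp add: N.mu_def ptensor_same tr[OF leg_rr])
    also have "\<dots> = lact M (indicator U) x"
      by (rule M.indicator_range_lact[OF indicator order_refl bisec_copen[OF indicator] x])
    finally show ?case
      using N.mu_simps(4)[OF CG_indicator[OF indicator]] M.D_simps(4)[OF CG_indicator[OF indicator] x] x by simp
  next
    case (add f g)
    then show ?case using N.mu_simps(2)[OF add(1,2)] M.D_simps(3)[OF add(1,2) x] x by simp
  qed
  \<comment> \<open>Off the domain both actions are \<open>undefined\<close>, one by the definition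
    of the functor B and the other by normalisation.\<close>
  have "lact (BO G (AO G M)) f x = lact M f x" for f x
    using N.muM_pure[of f x] mu[of f x] assms(2) by (auto simp: normalised_def)
  then have "lact (BO G (AO G M)) = lact M" by (intro ext)
  then show ?thesis by (intro alg_mod.equality) simp_all
qed

end

section \<open>The module attached to a comodule, and its coaction\<close>

context groupoid_comodule
begin

lemma lact_BO: "f \<in> CG \<Longrightarrow> x \<in> carrier M \<Longrightarrow> lact (BO G M) f x = mu f x"
  by (simp add: muM_pure)

lemma essential_BO: "essential (DG G) (BO G M)"
proof -
  have v: "vspace (BO G M)" by (rule vspace_cong[OF vspM]) simp_all
  have A: "alg_module (DG G) (BO G M)"
    unfolding alg_module_def
    using v vspaceD(2)[OF vspM] addM_closed
    by (auto simp: muM_pure mu_simps mu_conv conv_closed CcInf_add CcInf_smult)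
  have "\<exists>K\<in>{K. copen (gtop0 G) K}. lact (BO G M) (indicator K) x = x" if x: "x \<in> carrier (BO G M)" for x
  proof -
    have x': "x \<in> carrier M" using x by simp
    obtain K where "copen (gtop0 G) K" "indicator K \<rhd> x = x" using act_unit[OF x'] by blast
    then show ?thesis
      using lact_BO[OF CG0_CG[OF indicator_CcInf] x'] mu_unit_indicator[OF _ x'] by (intro bexI[of _ K]) simp_all
  qed
  then show ?thesis using unitsD.essential_iff[OF A] by blast
qed

lemma normalised_BO: "normalised (CcG0 G) M \<Longrightarrow> normalised (DG G) (BO G M)"
  by (auto simp: normalised_def)

text \<open>The coaction rebuilt from \<open>mu\<close> acts on 1_U \<otimes> x through the inverse
  of U, that is, through \<open>tau U\<close>; so it agrees with the given one on generators.
  Normalisation settles the values of the action off its domain.\<close>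

lemma AO_BO:
  assumes "normalised (CcG0 G) M" shows "AO G (BO G M) = M"
proof -
  interpret B: groupoid_module G "BO G M" by unfold_locales (rule essential_BO)
  interpret same_module G "BO G M" M
    by (rule same_module.intro) (simp_all add: CG0_CG muM_pure mu_unit)
  have "TM G (BO G M) = T"
  proof (rule lin_eqI[of _ "PG rr" "PG ss"])
    show TL: "TM G (BO G M) \<in> lin (PG rr) (PG ss)" using B.TM_lin by (simp add: ptensor_same)
    show "T \<in> lin (PG rr) (PG ss)" by (rule T_lin)
    fix t assume "t \<in> carrier (PG rr)"
    then show "TM G (BO G M) t = T t" using leg_rr
    proof (induction rule: PG_bisec_induct)
      case (indicator U x)
      have "TM G (BO G M) (pg rr (indicator U) x) = pg ss (indicator U) (lact (BO G M) (indicator (iv ` U)) x)"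
        using B.TM_indicator[OF indicator(1)] indicator(2) by (simp add: ptensor_same)
      also have "\<dots> = T (pg rr (indicator U) x)"
        unfolding lact_BO[OF CG_indicator[OF bisec_iv[OF indicator(1)]] indicator(2)] T_indicator[OF indicator]
          tau_eq_mu[OF indicator] ..
      finally show ?case .
    next
      case (add s t)
      show ?case unfolding linmapD(2)[OF lin_linmap[OF TL] add(1,2)] T_simps(2)[OF add(1,2)] add(3,4) ..
    qed
  qed
  moreover have "lact (AO G (BO G M)) h x = lact M h x" for h x
    using assms muM_pure[OF CG0_CG, of h x] mu_unit[of h x] by (auto simp: normalised_def CG0_CG)
  then have "lact (AO G (BO G M)) = lact M" by (intro ext)
  ultimately show ?thesis by (intro comod.equality) simp_all
qed

end

section \<open>The functors on morphisms\<close>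

lemma mod_homD:
  assumes "f \<in> mod_hom R M N"
  shows "f \<in> lin M N" "a \<in> carrier R \<Longrightarrow> x \<in> carrier M \<Longrightarrow> f (lact M a x) = lact N a (f x)"
  using assms by (auto simp: mod_hom_def)

context ample_groupoid
begin

lemma ptensor_map:
  assumes M: "essential (CcG0 G) M" and N: "essential (CcG0 G) N" and f: "f \<in> mod_hom (CcG0 G) M N" and p: "leg p"
  shows "ptensor_map G p M N f \<in> lin (ptensor G (gtop G) p M) (ptensor G (gtop G) p N)"
    "k \<in> CG \<Longrightarrow> x \<in> carrier M \<Longrightarrow>
      ptensor_map G p M N f (ppure G (gtop G) p M k x) = ppure G (gtop G) p N k (f x)"
proof -
  interpret M: unitary_module G M by unfold_locales (rule M)
  interpret N: unitary_module G N by unfold_locales (rule N)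
  note fs = linmapD[OF lin_linmap[OF mod_homD(1)[OF f]]]
  have b: "bilin (CcG G) M (N.PG p) (\<lambda>k x. N.pg p k (f x))"
    by (intro bilinI linmapI) (simp_all add: fs N.pg_simps[OF p])
  have "N.pg p (pmult k (h \<circ> p)) (f x) = N.pg p k (f (lact M h x))"
    if "k \<in> CG" "h \<in> CG0" "x \<in> carrier M" for k h x
    using N.pg_bal[OF p that(1,2) fs(1)[OF that(3)]] mod_homD(2)[OF f, of h x] that by simp
  from M.PT_the_lin[OF leg_continuous[OF p] N.PG_vspace[OF p] b] this
  show "ptensor_map G p M N f \<in> lin (ptensor G (gtop G) p M) (ptensor G (gtop G) p N)"
    "k \<in> CG \<Longrightarrow> x \<in> carrier M \<Longrightarrow>
      ptensor_map G p M N f (ppure G (gtop G) p M k x) = ppure G (gtop G) p N k (f x)"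
    unfolding ptensor_map_def by auto
qed

lemma comod_hom_AO_iff:
  "f \<in> comod_hom G (AO G M) (AO G N) \<longleftrightarrow> f \<in> mod_hom (CcG0 G) M N \<and>
    (\<forall>t\<in>carrier (ptensor G (gtop G) rr M).
      ptensor_map G ss M N f (TM G M t) = TM G N (ptensor_map G rr M N f t))"
proof -
  interpret M: same_module G "AO G M" M by (rule same_AO)
  interpret N: same_module G "AO G N" N by (rule same_AO)
  have "ptensor_map G p (AO G M) (AO G N) f = ptensor_map G p M N f" for p
    by (simp add: ptensor_map_def M.ptensor_same N.ptensor_same)
  moreover have "lin (AO G M) (AO G N) = lin M N" by (rule lin_cong) simp_all
  ultimately show ?thesis by (simp add: comod_hom_def mod_hom_def M.ptensor_same)
qed

text \<open>In one direction the coaction is given on generators by the module action. In the other,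
  commuting with the coactions equates two tensors over the indicator of \<open>U\<close>, and
  tracing equates their entries projected to the corner over the sources of \<open>U\<close>. Both
  entries already lie there, because \<open>f\<close> commutes with functions on units.\<close>

lemma mod_hom_comod_hom:
  assumes M: "essential (DG G) M" and N: "essential (DG G) N"
  shows "comod_hom G (AO G M) (AO G N) = mod_hom (DG G) M N"
proof (intro equalityI subsetI)
  interpret M: groupoid_module G M by unfold_locales (rule M)
  interpret N: groupoid_module G N by unfold_locales (rule N)
  note Tm = linmapD[OF lin_linmap[OF M.TM_lin]] and Tn = linmapD[OF lin_linmap[OF N.TM_lin]]
  {
    fix f assume f: "f \<in> mod_hom (DG G) M N"
    then have f0: "f \<in> mod_hom (CcG0 G) M N" by (simp add: mod_hom_def CG0_CG)
    note fs = linmapD[OF lin_linmap[OF mod_homD(1)[OF f]]]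
    note pm = ptensor_map[OF M.ess N.ess f0]
    note pl = linmapD[OF lin_linmap[OF pm(1)]]
    have "ptensor_map G ss M N f (TM G M t) = TM G N (ptensor_map G rr M N f t)" if t: "t \<in> carrier (M.PG rr)" for t
      using t leg_rr
    proof (induction rule: M.PG_bisec_induct)
      case (indicator U x)
      note u = CG_indicator[OF indicator(1)]
      note I = bisec_iv[OF indicator(1)]
      have "f (lact M (indicator (iv ` U)) x) = lact N (indicator (iv ` U)) (f x)"
        using mod_homD(2)[OF f, of "indicator (iv ` U)" x] CG_indicator[OF I] indicator(2) by simp
      then show ?case
        unfolding M.TM_indicator[OF indicator] pm(2)[OF leg_ss u M.indicator_lact_closed[OF I indicator(2)]]
          pm(2)[OF leg_rr u indicator(2)] N.TM_indicator[OF indicator(1) fs(1)[OF indicator(2)]] by simp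
    next
      case (add s t)
      show ?case
        unfolding Tm(2)[OF add(1,2)] pl(2)[OF leg_ss Tm(1)[OF add(1)] Tm(1)[OF add(2)]] pl(2)[OF leg_rr add(1,2)]
          Tn(2)[OF pl(1)[OF leg_rr add(1)] pl(1)[OF leg_rr add(2)]] add(3,4) ..
    qed
    with f0 show "f \<in> comod_hom G (AO G M) (AO G N)" by (simp add: comod_hom_AO_iff)
  next
    fix f assume "f \<in> comod_hom G (AO G M) (AO G N)"
    then have f0: "f \<in> mod_hom (CcG0 G) M N"
      and fT: "\<And>t. t \<in> carrier (M.PG rr) \<Longrightarrow> ptensor_map G ss M N f (TM G M t) = TM G N (ptensor_map G rr M N f t)"
      by (auto simp: comod_hom_AO_iff)
    note fs = linmapD[OF lin_linmap[OF mod_homD(1)[OF f0]]]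
    note pm = ptensor_map[OF M.ess N.ess f0]
    have ind: "f (lact M (indicator (iv ` U)) x) = lact N (indicator (iv ` U)) (f x)"
      if U: "bisec U" and x: "x \<in> carrier M" for U x
    proof -
      note u = CG_indicator[OF U] and I = bisec_iv[OF U]
      note s = bisec_leg_image[OF U leg_ss]
      note y = M.indicator_lact_closed[OF I x] and z = N.indicator_lact_closed[OF I fs(1)[OF x]]
      have "N.pg ss (indicator U) (f (lact M (indicator (iv ` U)) x)) = N.pg ss (indicator U) (lact N (indicator (iv ` U)) (f x))"
        using fT[OF M.pg_closed[OF leg_rr u x]]
        unfolding M.TM_indicator[OF U x] pm(2)[OF leg_ss u y] pm(2)[OF leg_rr u x] N.TM_indicator[OF U fs(1)[OF x]] .
      then have "lact N (indicator (ss ` U)) (f (lact M (indicator (iv ` U)) x)) = lact N (indicator (ss ` U)) (lact N (indicator (iv ` U)) (f x))"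
        using N.ptrace_indicator[OF leg_ss U fs(1)[OF y]] N.ptrace_indicator[OF leg_ss U z] by simp
      moreover have "lact N (indicator (ss ` U)) (f (lact M (indicator (iv ` U)) x)) = f (lact M (indicator (ss ` U)) (lact M (indicator (iv ` U)) x))"
        using mod_homD(2)[OF f0, of "indicator (ss ` U)" "lact M (indicator (iv ` U)) x"] indicator_CcInf[OF s] y by simp
      moreover have "lact M (indicator (ss ` U)) (lact M (indicator (iv ` U)) x) = lact M (indicator (iv ` U)) x"
        using M.indicator_range_lact[OF I order_refl bisec_copen[OF I] x] leg_iv_image(1)[OF U] by simp
      moreover have "lact N (indicator (ss ` U)) (lact N (indicator (iv ` U)) (f x)) = lact N (indicator (iv ` U)) (f x)"
        using N.indicator_range_lact[OF I order_refl bisec_copen[OF I] fs(1)[OF x]] leg_iv_image(1)[OF U] by simp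
      ultimately show ?thesis by simp
    qed
    have "f (lact M g x) = lact N g (f x)" if g: "g \<in> CG" and x: "x \<in> carrier M" for g x
      using g
    proof (induction g rule: CG_induct)
      case (indicator c U)
      \<comment> \<open>The commutation is known for inverses of bisections, and every bisection is
        the inverse of its own inverse.\<close>
      have "f (lact M (indicator U) x) = lact N (indicator U) (f x)"
        using ind[OF bisec_iv[OF indicator] x] iv_iv_image[OF indicator] by simp
      then show ?case
        unfolding M.D_simps(4)[OF CG_indicator[OF indicator] x] N.D_simps(4)[OF CG_indicator[OF indicator] fs(1)[OF x]]
          fs(3)[OF M.indicator_lact_closed[OF indicator x]] by simp
    next
      case (add g h)
      then show ?case
        unfolding M.D_simps(3)[OF add(1,2) x] N.D_simps(3)[OF add(1,2) fs(1)[OF x]]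
          fs(2)[OF M.D_closed[OF add(1) x] M.D_closed[OF add(2) x]] by simp
    qed
    with mod_homD(1)[OF f0] show "f \<in> mod_hom (DG G) M N" by (simp add: mod_hom_def)
  }
qed

end

section \<open>The isomorphism of categories\<close>

text \<open>Extensionality of the arrows makes the identity laws literal: composing with a
  restricted identity changes no value, not even off the carrier.\<close>

lemma concrete_category:
  assumes id: "\<And>U. U \<in> \<O> \<Longrightarrow> restrict id (c U) \<in> H U U"
    and comp: "\<And>U V W f g. U \<in> \<O> \<Longrightarrow> V \<in> \<O> \<Longrightarrow> W \<in> \<O> \<Longrightarrow> f \<in> H U V \<Longrightarrow> g \<in> H V W \<Longrightarrow> compose (c U) g f \<in> H U W"
    and ext: "\<And>U V f. U \<in> \<O> \<Longrightarrow> V \<in> \<O> \<Longrightarrow> f \<in> H U V \<Longrightarrow> f \<in> c U \<rightarrow>\<^sub>E c V"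
  shows "is_category \<lparr>Obj = \<O>, Hom = H, Ident = (\<lambda>M. restrict id (c M)), Comp = (\<lambda>L M N g f. compose (c L) g f)\<rparr>"
  unfolding is_category_def category.simps
proof (intro conjI ballI)
  fix U V f assume *: "U \<in> \<O>" "V \<in> \<O>" "f \<in> H U V"
  then have f: "f \<in> c U \<rightarrow>\<^sub>E c V" by (rule ext)
  show "compose (c U) f (restrict id (c U)) = f" "compose (c U) (restrict id (c V)) f = f"
    using f by (auto simp: compose_def fun_eq_iff restrict_def PiE_def extensional_def)
next
  fix T U V W f g h assume *: "T \<in> \<O>" "U \<in> \<O>" "V \<in> \<O>" "W \<in> \<O>" "f \<in> H T U" "g \<in> H U V" "h \<in> H V W"
  have "f \<in> c T \<rightarrow> c U" using ext[OF *(1,2,5)] by (simp add: PiE_def)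
  then show "compose (c T) (compose (c U) h g) f = compose (c T) h (compose (c T) g f)"
    by (auto simp: compose_def fun_eq_iff restrict_def)
qed (use id comp in auto)

lemma lin_id: "vspace M \<Longrightarrow> restrict id (carrier M) \<in> lin M M"
  by (rule restrict_in_lin) (auto simp: linmap_def)

lemma lin_compose: "vspace L \<Longrightarrow> f \<in> lin L M \<Longrightarrow> g \<in> lin M N \<Longrightarrow> compose (carrier L) g f \<in> lin L N"
  using restrict_in_lin[OF _ linmap_comp[OF lin_linmap lin_linmap], of L f M g N] by (simp add: compose_def o_def)

lemma is_category_GMod: "is_category (GMod G)"
  unfolding GMod_def
proof (rule concrete_category)
  fix U assume "U \<in> {M. essential (DG G) M \<and> normalised (DG G) M}"
  then have U: "alg_module (DG G) U" by (simp add: essential_def)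
  show "restrict id (carrier U) \<in> mod_hom (DG G) U U"
    using lin_id[OF alg_moduleD(1)[OF U]] alg_moduleD(2)[OF U] by (simp add: mod_hom_def)
next
  fix U V W f g
  assume "U \<in> {M. essential (DG G) M \<and> normalised (DG G) M}" "f \<in> mod_hom (DG G) U V" "g \<in> mod_hom (DG G) V W"
  then have U: "alg_module (DG G) U" and f: "f \<in> mod_hom (DG G) U V" and g: "g \<in> mod_hom (DG G) V W"
    by (auto simp: essential_def)
  note fs = linmapD[OF lin_linmap[OF mod_homD(1)[OF f]]]
  show "compose (carrier U) g f \<in> mod_hom (DG G) U W"
    unfolding mod_hom_def
    using lin_compose[OF alg_moduleD(1)[OF U] mod_homD(1)[OF f] mod_homD(1)[OF g]] mod_homD(2)[OF f] mod_homD(2)[OF g]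
      alg_moduleD(2)[OF U] fs(1)
    by (auto simp: compose_eq)
next
  fix U V f assume "f \<in> mod_hom (DG G) U V"
  then show "f \<in> carrier U \<rightarrow>\<^sub>E carrier V" by (simp add: mod_hom_def lin_def)
qed

context ample_groupoid
begin

lemma GMod_AO:
  fixes M N :: "('a \<Rightarrow> complex, 'm) alg_mod"
  assumes "M \<in> Obj (GMod G)"
  shows "AO G M \<in> Obj (Comod G)" "BO G (AO G M) = M"
    "N \<in> Obj (GMod G) \<Longrightarrow> Hom (Comod G) (AO G M) (AO G N) = Hom (GMod G) M N"
proof -
  have M: "essential (DG G) M" "normalised (DG G) M" using assms by (simp_all add: GMod_def)
  show "AO G M \<in> Obj (Comod G)" using comodule_AO[OF M(1)] normalised_AO[OF M(2)] by (simp add: Comod_def)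
  show "BO G (AO G M) = M" by (rule BO_AO[OF M])
  show "Hom (Comod G) (AO G M) (AO G N) = Hom (GMod G) M N" if "N \<in> Obj (GMod G)"
    using mod_hom_comod_hom[OF M(1), of N] that by (simp add: GMod_def Comod_def)
qed

lemma Comod_BO:
  fixes M N :: "('a, 'm) comod"
  assumes "M \<in> Obj (Comod G)"
  shows "BO G M \<in> Obj (GMod G)" "AO G (BO G M) = M"
    "N \<in> Obj (Comod G) \<Longrightarrow> Hom (GMod G) (BO G M) (BO G N) = Hom (Comod G) M N"
proof -
  have *: "BO G M \<in> Obj (GMod G) \<and> AO G (BO G M) = M" if "M \<in> Obj (Comod G)" for M :: "('a, 'm) comod"
  proof -
    have c: "comodule G M" "normalised (CcG0 G) M" using that by (auto simp: Comod_def)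
    interpret groupoid_comodule G M by unfold_locales (rule c)
    show ?thesis using essential_BO normalised_BO[OF c(2)] AO_BO[OF c(2)] by (simp add: GMod_def)
  qed
  then show "BO G M \<in> Obj (GMod G)" "AO G (BO G M) = M" using assms by auto
  show "Hom (GMod G) (BO G M) (BO G N) = Hom (Comod G) M N" if "N \<in> Obj (Comod G)"
    using GMod_AO(3)[of "BO G M" "BO G N"] *[OF assms] *[OF that] by simp
qed

text \<open>The functor B preserves hom-sets, identities and compositions literally, as the latter
  two depend on the carrier only. The laws are therefore those of \<open>GMod\<close>.\<close>

lemma is_category_Comod: "is_category (Comod G :: (('a, 'm) comod, 'm \<Rightarrow> 'm) category)"
proof -
  note cat = is_category_GMod[of G, unfolded is_category_def]
  have id: "Ident (Comod G) M = Ident (GMod G) (BO G M)" for M :: "('a, 'm) comod"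
    by (simp add: Comod_def GMod_def)
  have comp: "Comp (Comod G) L M N = Comp (GMod G) (BO G L) (BO G M) (BO G N)" for L M N :: "('a, 'm) comod"
    by (simp add: Comod_def GMod_def)
  show ?thesis
    unfolding is_category_def id comp
    using cat Comod_BO(1) Comod_BO(3) by (smt (verit, best))
qed

lemma is_functor_A: "is_functor (GMod G :: (('a \<Rightarrow> complex, 'm) alg_mod, 'm \<Rightarrow> 'm) category) (Comod G) (functor_A G)"
proof -
  have am: "amap (functor_A G) M N f = f" for M N :: "('a \<Rightarrow> complex, 'm) alg_mod" and f by (simp add: functor_A_def)
  have id: "Ident (Comod G) (AO G M) = Ident (GMod G) M" for M :: "('a \<Rightarrow> complex, 'm) alg_mod"
    by (simp add: Comod_def GMod_def)
  have comp: "Comp (Comod G) (AO G L) (AO G M) (AO G N) = Comp (GMod G) L M N" for L M N :: "('a \<Rightarrow> complex, 'm) alg_mod"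
    by (simp add: Comod_def GMod_def)
  show ?thesis
    unfolding is_functor_def am id comp by (auto simp: is_category_GMod is_category_Comod GMod_AO)
qed

lemma is_functor_B: "is_functor (Comod G :: (('a, 'm) comod, 'm \<Rightarrow> 'm) category) (GMod G) (functor_B G)"
proof -
  have am: "amap (functor_B G) M N f = f" for M N :: "('a, 'm) comod" and f by (simp add: functor_B_def)
  have id: "Ident (GMod G) (BO G M) = Ident (Comod G) M" for M :: "('a, 'm) comod"
    by (simp add: Comod_def GMod_def)
  have comp: "Comp (GMod G) (BO G L) (BO G M) (BO G N) = Comp (Comod G) L M N" for L M N :: "('a, 'm) comod"
    by (simp add: Comod_def GMod_def)
  show ?thesis
    unfolding is_functor_def am id comp by (auto simp: is_category_GMod is_category_Comod Comod_BO)
qed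

lemma left_inverse_AB: "left_inverse_functor (GMod G :: (('a \<Rightarrow> complex, 'm) alg_mod, 'm \<Rightarrow> 'm) category) (functor_A G) (functor_B G)"
  unfolding left_inverse_functor_def using GMod_AO(2) by (auto simp: functor_A_def functor_B_def)

lemma left_inverse_BA: "left_inverse_functor (Comod G :: (('a, 'm) comod, 'm \<Rightarrow> 'm) category) (functor_B G) (functor_A G)"
  unfolding left_inverse_functor_def using Comod_BO(2) by (auto simp: functor_A_def functor_B_def)

end

theorem proposition3p6:
  fixes G :: "'g groupoid"
  assumes "ample_groupoid G"
  shows "mutually_inverse (GMod G :: (('g \<Rightarrow> complex, 'm) alg_mod, 'm \<Rightarrow> 'm) category)
             (Comod G :: (('g, 'm) comod, 'm \<Rightarrow> 'm) category) (functor_A G) (functor_B G) \<and>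
         category_isomorphism (GMod G :: (('g \<Rightarrow> complex, 'm) alg_mod, 'm \<Rightarrow> 'm) category)
             (Comod G :: (('g, 'm) comod, 'm \<Rightarrow> 'm) category) (functor_A G) \<and>
         category_isomorphism (Comod G :: (('g, 'm) comod, 'm \<Rightarrow> 'm) category)
             (GMod G :: (('g \<Rightarrow> complex, 'm) alg_mod, 'm \<Rightarrow> 'm) category) (functor_B G)"
proof -
  interpret ample_groupoid G by fact
  have "mutually_inverse (GMod G :: (('g \<Rightarrow> complex, 'm) alg_mod, 'm \<Rightarrow> 'm) category)
             (Comod G :: (('g, 'm) comod, 'm \<Rightarrow> 'm) category) (functor_A G) (functor_B G)"
    "mutually_inverse (Comod G :: (('g, 'm) comod, 'm \<Rightarrow> 'm) category)
             (GMod G :: (('g \<Rightarrow> complex, 'm) alg_mod, 'm \<Rightarrow> 'm) category) (functor_B G) (functor_A G)"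
    unfolding mutually_inverse_def
    by (simp_all add: is_functor_A is_functor_B left_inverse_AB left_inverse_BA)
  then show ?thesis unfolding category_isomorphism_def by blast
qed

end
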